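(* Let $\mathbb{K}$ be a field of characteristic zero, let $R=\mathbb{K}[x_1,\ldots,x_n]$, and let $P\subset R$ be a prime ideal of codimension $c$ such that $\{x_{c+1},\ldots,x_n\}$ is a maximal independent set of variables modulo $P$. Let $\mathbb{F}$ be the field of fractions of $R/P$ and let $m\ge 1$ be an integer. Then the following four sets are in natural bijective correspondence: (a) the $P$-primary ideals $Q$ in $R$ of multiplicity $m$ over $P$; (b) the points of the punctual Hilbert scheme $\mathrm{Hilb}^m(\mathbb{F}[[y_1,\ldots,y_c]])$, i.e. the ideals $I$ of colength $m$ in $\mathbb{F}[[y_1,\ldots,y_c]]$; (c) the $m$-dimensional $\mathbb{F}$-subspaces $V$ of $\mathbb{F}[z_1,\ldots,z_c]$ that are closed under differentiation; (d) the $m$-dimensional $\mathbb{F}$-subspaces $\mathcal{E}$ of the Weyl-Noether module $\mathbb{F}\otimes_R D_{n,c}$ that are $R$-bimodules. The bijections are given by the following mutually inverse maps. (a)$\leftrightarrow$(b): $Q\mapsto I=\langle y_1,\ldots,y_c\rangle^m+\gamma(Q)\,\mathbb{F}[y_1,\ldots,y_c]$, with inverse $I\mapsto Q=\gamma^{-1}(I)$. (b)$\leftrightarrow$(c): $I\mapsto V=I^\perp$, with inverse $V\mapsto I=\mathrm{Ann}(V)$. (c)$\leftrightarrow$(d): $V\mapsto\mathcal{E}=\omega(V)$, with inverse $\mathcal{E}\mapsto\omega^{-1}(\mathcal{E})$. Moreover, any $\mathbb{F}$-basis of the subspace $\mathcal{E}$ in (d) lifts to operators $A_1,\ldots,A_m\in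 D_{n,c}$ (Noetherian operators) that represent the corresponding ideal $Q$ in (a), meaning that $$Q=\{\,f\in R : A_l\bullet f\in P\ \text{ for } l=1,\ldots,m\,\}.$$
   Context: Independence: $\{x_{c+1},\ldots,x_n\}$ being a maximal independent set modulo $P$ means that $\mathbb{K}[x_{c+1},\ldots,x_n]\cap P=\{0\}$ and the set is maximal with this property. Consequently $\mathbb{F}=\mathrm{Quot}(R/P)$ is algebraic over $\mathbb{K}(x_{c+1},\ldots,x_n)$. This can always be arranged by permuting the variables. Write $u_i$ for the class of $x_i$ in $\mathbb{F}$. Multiplicity: the multiplicity of a $P$-primary ideal $Q$ over $P$ is the length of the artinian local ring $R_P/QR_P$. The map $\gamma$: $\gamma:R\hookrightarrow\mathbb{F}[y_1,\ldots,y_c]$ is the $\mathbb{K}$-algebra inclusion with $x_i\mapsto y_i+u_i$ for $1\le i\le c$ and $x_j\mapsto u_j$ for $c+1\le j\le n$. Identification: an ideal of colength $m$ in $\mathbb{F}[[y_1,\ldots,y_c]]$ contains $\langle y_1,\ldots,y_c\rangle^m$. Such ideals are identified, by contraction and extension, with the $\langle y_1,\ldots,y_c\rangle$-primary ideals of colength $m$ in $\mathbb{F}[y_1,\ldots,y_c]$. Points of the punctual Hilbert scheme are understood as these ideals. Inverse systems: $\mathbb{F}[[y_1,\ldots,y_c]]$ acts on $\mathbb{F}[z_1,\ldots,z_c]$ with $y_i$ acting as $\partial_{z_i}=\partial/\partial z_i$; write $f\bullet F$ for this action. Then $$I^\perp=\{F\in\mathbb{F}[z_1,\ldots,z_c]: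 f\bullet F=0\text{ for all }f\in I\},\qquad \mathrm{Ann}(V)=\{f\in\mathbb{F}[[y_1,\ldots,y_c]]: f\bullet F=0\text{ for all }F\in V\}.$$ A subspace $V$ is closed under differentiation if $\partial_{z_i}\bullet F\in V$ for all $F\in V$ and $1\le i\le c$. Relative Weyl algebra: $D_{n,c}=\mathbb{K}\langle x_1,\ldots,x_n,\partial_{x_1},\ldots,\partial_{x_c}\rangle=R\langle\partial_{x_1},\ldots,\partial_{x_c}\rangle$, where the generators commute except that $\partial_{x_i}x_i=x_i\partial_{x_i}+1$ for $1\le i\le c$. It acts on $R$ by $x_i\bullet f=x_if$ and $\partial_{x_i}\bullet f=\partial f/\partial x_i$. Weyl-Noether module: $\mathbb{F}\otimes_R D_{n,c}$ is formed using the left $R$-module structure of $D_{n,c}$. It is a left $\mathbb{F}$-vector space with basis $\{1\otimes\partial_{\mathbf{x}}^\beta:\beta\in\mathbb{N}^c\}$, where $\partial_{\mathbf{x}}^\beta=\partial_{x_1}^{\beta_1}\cdots\partial_{x_c}^{\beta_c}$. The left $R$-action is through $R\to\mathbb{F}$, and the right $R$-action is $(a\otimes A)\cdot r=a\otimes(Ar)$ with the product $Ar$ taken in $D_{n,c}$. An $\mathbb{F}$-subspace is an $R$-bimodule if it is closed under both $R$-actions. The map $\omega$: $\omega:\mathbb{F}[z_1,\ldots,z_c]\to\mathbb{F}\otimes_R D_{n,c}$ is the $\mathbb{F}$-linear isomorphism $z_1^{\alpha_1}\cdots z_c^{\alpha_c}\mapsto 1\otimes\partial_{x_1}^{\alpha_1}\cdots\partial_{x_c}^{\alpha_c}$.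 Lifting: given an $\mathbb{F}$-basis of $\mathcal{E}$, multiply each basis element by a nonzero element of $\mathbb{F}$ (clearing denominators) so that it has the form $\sum_\alpha\overline{\lambda_\alpha}\otimes\partial_{\mathbf{x}}^\alpha$, where $\lambda_\alpha\in R$ and $\overline{\lambda_\alpha}$ is the class of $\lambda_\alpha$ in $R/P$. A lift is then the operator $\sum_\alpha\lambda_\alpha\partial_{\mathbf{x}}^\alpha\in D_{n,c}$. *)

theory Defs
  imports
    "HOL-Library.Poly_Mapping"
    "HOL-Library.Extended_Nat"
    "HOL-Computational_Algebra.Fraction_Field"
    "HOL-Algebra.QuotRing"
    "HOL-Algebra.Ideal_Product"
    "HOL-Algebra.Algebraic_Closure_Type"
begin

abbreviation "lookup \<equiv> Poly_Mapping.lookup"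
abbreviation "keys \<equiv> Poly_Mapping.keys"
abbreviation "single \<equiv> Poly_Mapping.single"


section \<open>Ring-theoretic notions\<close>

text \<open>The length of a ring as a module over itself: the supremum of the lengths of its
  strict chains of ideals.\<close>

definition ring_length :: "('a, 'b) ring_scheme \<Rightarrow> enat" where
  "ring_length A = Sup {enat k | k. \<exists>J :: nat \<Rightarrow> 'a set.
     (\<forall>i\<le>k. ideal (J i) A) \<and> (\<forall>i<k. J i \<subset> J (Suc i))}"

definition colength :: "('a, 'b) ring_scheme \<Rightarrow> 'a set \<Rightarrow> enat" where
  "colength A I = ring_length (A Quot I)"

definition codimension :: "('a, 'b) ring_scheme \<Rightarrow> 'a set \<Rightarrow> enat" where
  "codimension A P = Sup {enat k | k. \<exists>p :: nat \<Rightarrow> 'a set.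
     (\<forall>i\<le>k. primeideal (p i) A) \<and> (\<forall>i<k. p i \<subset> p (Suc i)) \<and> p k = P}"

definition radical :: "('a, 'b) ring_scheme \<Rightarrow> 'a set \<Rightarrow> 'a set" where
  "radical A I = {a \<in> carrier A. \<exists>k::nat. a [^]\<^bsub>A\<^esub> k \<in> I}"

definition primary_ideal :: "'a set \<Rightarrow> ('a, 'b) ring_scheme \<Rightarrow> bool" where
  "primary_ideal Q A \<longleftrightarrow> ideal Q A \<and> Q \<noteq> carrier A \<and>
     (\<forall>a\<in>carrier A. \<forall>b\<in>carrier A. a \<otimes>\<^bsub>A\<^esub> b \<in> Q \<longrightarrow> a \<in> Q \<or> (\<exists>k::nat. b [^]\<^bsub>A\<^esub> k \<in> Q))"

definition primary_to :: "('a, 'b) ring_scheme \<Rightarrow> 'a set \<Rightarrow> 'a set \<Rightarrow> bool" where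
  "primary_to A P Q \<longleftrightarrow> primary_ideal Q A \<and> radical A Q = P"

text \<open>The localization at a prime \<open>P\<close> of a subring \<open>A\<close> of an integral domain type, as a
  subring of the field of fractions of that type.\<close>

definition localization :: "('a::idom, 'b) ring_scheme \<Rightarrow> 'a set \<Rightarrow> 'a fract ring" where
  "localization A P =
     ring_of_type_algebra\<lparr>carrier := {Fract a s | a s. a \<in> carrier A \<and> s \<in> carrier A - P}\<rparr>"

definition localized_ideal :: "('a::idom, 'b) ring_scheme \<Rightarrow> 'a set \<Rightarrow> 'a set \<Rightarrow> 'a fract set" where
  "localized_ideal A P Q = Idl\<^bsub>localization A P\<^esub> ((\<lambda>a. Fract a 1) ` Q)"

definition multiplicity_over :: "('a::idom, 'b) ring_scheme \<Rightarrow> 'a set \<Rightarrow> 'a set \<Rightarrow> enat" where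
  "multiplicity_over A P Q = ring_length (localization A P Quot localized_ideal A P Q)"

text \<open>The field \<open>'f\<close>, together with \<open>\<pi>\<close>, is the field of fractions of \<open>A/P\<close>: the map \<open>\<pi>\<close>
  induces an injection of \<open>A/P\<close> into \<open>'f\<close>, and every element of \<open>'f\<close> is a quotient of two
  elements of its image. Thus \<open>\<pi> f\<close> is the class of \<open>f\<close>.\<close>

definition is_fraction_field_of_quotient ::
    "('a, 'b) ring_scheme \<Rightarrow> 'a set \<Rightarrow> ('a \<Rightarrow> 'f::field) \<Rightarrow> bool" where
  "is_fraction_field_of_quotient A P \<pi> \<longleftrightarrow>
     \<pi> \<in> ring_hom A ring_of_type_algebra \<and>
     a_kernel A ring_of_type_algebra \<pi> = P \<and>
     (\<forall>z. \<exists>a\<in>carrier A. \<exists>s\<in>carrier A - P. z = \<pi> a / \<pi> s)"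


section \<open>Polynomials and power series\<close>

text \<open>Variables are indexed by natural numbers; a monomial is its exponent vector.\<close>

type_synonym mon = "nat \<Rightarrow>\<^sub>0 nat"
type_synonym 'a mpol = "mon \<Rightarrow>\<^sub>0 'a"
type_synonym 'a mps = "mon \<Rightarrow> 'a"

definition mpoly_ring :: "nat set \<Rightarrow> 'a::comm_ring_1 mpol ring" where
  "mpoly_ring V = ring_of_type_algebra\<lparr>carrier := {p. \<forall>\<alpha>\<in>keys p. keys \<alpha> \<subseteq> V}\<rparr>"

definition mvar :: "nat \<Rightarrow> 'a::comm_ring_1 mpol" where
  "mvar i = single (single i 1) 1"

definition mconst :: "'a::comm_ring_1 \<Rightarrow> 'a mpol" where
  "mconst a = single 0 a"

definition eval_mpoly ::
    "('a::comm_ring_1 \<Rightarrow> 'b::comm_ring_1) \<Rightarrow> (nat \<Rightarrow> 'b) \<Rightarrow> 'a mpol \<Rightarrow> 'b" where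
  "eval_mpoly \<phi> g f = (\<Sum>\<alpha>\<in>keys f. \<phi> (lookup f \<alpha>) * (\<Prod>i\<in>keys \<alpha>. g i ^ lookup \<alpha> i))"

definition mpderiv :: "nat \<Rightarrow> 'a::comm_ring_1 mpol \<Rightarrow> 'a mpol" where
  "mpderiv i f =
     (\<Sum>\<alpha>\<in>keys f. single (\<alpha> - single i 1) (of_nat (lookup \<alpha> i) * lookup f \<alpha>))"

text \<open>For operators \<open>D\<^sub>1, D\<^sub>2, \<dots>\<close> the composite \<open>D\<^sup>\<alpha>\<close>; it is only used for commuting operators,
  so the order of the factors is irrelevant.\<close>

definition multi_iter :: "(nat \<Rightarrow> 'b \<Rightarrow> 'b) \<Rightarrow> mon \<Rightarrow> 'b \<Rightarrow> 'b" where
  "multi_iter D \<alpha> = foldr (\<lambda>i. D i ^^ lookup \<alpha> i) (sorted_list_of_set (keys \<alpha>))"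

definition mps_ring :: "nat set \<Rightarrow> 'a::comm_ring_1 mps ring" where
  "mps_ring V = \<lparr>
     carrier = {f. \<forall>\<alpha>. f \<alpha> \<noteq> 0 \<longrightarrow> keys \<alpha> \<subseteq> V},
     monoid.mult = (\<lambda>f g \<alpha>. \<Sum>(\<beta>, \<delta>) | \<beta> + \<delta> = \<alpha>. f \<beta> * g \<delta>),
     one = (\<lambda>\<alpha>. if \<alpha> = 0 then 1 else 0),
     ring.zero = (\<lambda>_. 0),
     add = (\<lambda>f g \<alpha>. f \<alpha> + g \<alpha>)\<rparr>"

definition mscale :: "'a::comm_ring_1 \<Rightarrow> 'a mpol \<Rightarrow> 'a mpol" where
  "mscale a f = mconst a * f"

global_interpretation mpol: vector_space "mscale :: 'a::field \<Rightarrow> 'a mpol \<Rightarrow> 'a mpol"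
  defines mpol_subspace = mpol.subspace
    and mpol_span = mpol.span
    and mpol_dependent = mpol.dependent
    and mpol_dim = mpol.dim
  by unfold_locales
    (auto simp: mscale_def mconst_def algebra_simps single_add mult_single simp flip: mult.assoc)


section \<open>The prime ideal and the map \<gamma>\<close>

definition independent_mod :: "'k::field mpol set \<Rightarrow> nat set \<Rightarrow> bool" where
  "independent_mod P S \<longleftrightarrow> carrier (mpoly_ring S) \<inter> P = {0}"

definition maximal_independent_mod :: "nat \<Rightarrow> 'k::field mpol set \<Rightarrow> nat set \<Rightarrow> bool" where
  "maximal_independent_mod n P S \<longleftrightarrow> S \<subseteq> {1..n} \<and> independent_mod P S \<and>
     (\<forall>T. S \<subset> T \<and> T \<subseteq> {1..n} \<longrightarrow> \<not> independent_mod P T)"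

definition gamma :: "nat \<Rightarrow> ('k::field mpol \<Rightarrow> 'f::field) \<Rightarrow> 'k mpol \<Rightarrow> 'f mpol" where
  "gamma c \<pi> = eval_mpoly (\<lambda>a. mconst (\<pi> (mconst a)))
     (\<lambda>i. if i \<in> {1..c} then mvar i + mconst (\<pi> (mvar i)) else mconst (\<pi> (mvar i)))"

definition y_ideal :: "nat \<Rightarrow> 'f::field mpol set" where
  "y_ideal c = Idl\<^bsub>mpoly_ring {1..c}\<^esub> (mvar ` {1..c})"


section \<open>The four sets\<close>

definition primary_ideals :: "nat \<Rightarrow> 'k::field mpol set \<Rightarrow> nat \<Rightarrow> 'k mpol set set" where
  "primary_ideals n P m =
     {Q. primary_to (mpoly_ring {1..n}) P Q \<and> multiplicity_over (mpoly_ring {1..n}) P Q = enat m}"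

definition punctual_hilbert :: "nat \<Rightarrow> nat \<Rightarrow> 'f::field mps set set" where
  "punctual_hilbert c m =
     {I. ideal I (mps_ring {1..c}) \<and> colength (mps_ring {1..c}) I = enat m}"

definition punctual_hilbert_poly :: "nat \<Rightarrow> nat \<Rightarrow> 'f::field mpol set set" where
  "punctual_hilbert_poly c m =
     {I. primary_to (mpoly_ring {1..c}) (y_ideal c) I \<and> colength (mpoly_ring {1..c}) I = enat m}"

definition contract_ideal :: "nat \<Rightarrow> 'f::field mps set \<Rightarrow> 'f mpol set" where
  "contract_ideal c I = {f \<in> carrier (mpoly_ring {1..c}). lookup f \<in> I}"

definition extend_ideal :: "nat \<Rightarrow> 'f::field mpol set \<Rightarrow> 'f mps set" where
  "extend_ideal c I = Idl\<^bsub>mps_ring {1..c}\<^esub> (lookup ` I)"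

definition diff_closed_subspaces :: "nat \<Rightarrow> nat \<Rightarrow> 'f::field mpol set set" where
  "diff_closed_subspaces c m =
     {V. V \<subseteq> carrier (mpoly_ring {1..c}) \<and> mpol_subspace V \<and> mpol_dim V = m \<and>
         (\<forall>i\<in>{1..c}. \<forall>F\<in>V. mpderiv i F \<in> V)}"

text \<open>The relative Weyl algebra: \<open>A\<close> stands for the operator \<open>\<Sum>\<^sub>\<alpha> A\<^sub>\<alpha> \<partial>\<^sup>\<alpha>\<close> in normal form, with
  \<open>A\<^sub>\<alpha> \<in> R\<close>. The product is determined by \<open>\<partial>\<^sub>i r = r \<partial>\<^sub>i + \<partial>r/\<partial>x\<^sub>i\<close> for \<open>r \<in> R\<close>, which
  gives left multiplication by \<open>\<partial>\<^sub>i\<close>. The type-class product on this type is a different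
  (commutative) one; it is used below only to multiply all coefficients by a polynomial.\<close>

type_synonym 'k weyl_op = "mon \<Rightarrow>\<^sub>0 'k mpol"

definition weyl_coeff :: "'k::comm_ring_1 mpol \<Rightarrow> 'k weyl_op" where
  "weyl_coeff r = single 0 r"

definition weyl_partial :: "mon \<Rightarrow> 'k::comm_ring_1 weyl_op" where
  "weyl_partial \<beta> = single \<beta> 1"

definition partial_left_mult :: "nat \<Rightarrow> 'k::comm_ring_1 weyl_op \<Rightarrow> 'k weyl_op" where
  "partial_left_mult i A =
     (\<Sum>\<alpha>\<in>keys A. single (\<alpha> + single i 1) (lookup A \<alpha>) + single \<alpha> (mpderiv i (lookup A \<alpha>)))"

definition weyl_mult :: "'k::comm_ring_1 weyl_op \<Rightarrow> 'k weyl_op \<Rightarrow> 'k weyl_op" where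
  "weyl_mult A B =
     (\<Sum>\<alpha>\<in>keys A. weyl_coeff (lookup A \<alpha>) * multi_iter partial_left_mult \<alpha> B)"

definition weyl_algebra :: "nat \<Rightarrow> nat \<Rightarrow> 'k::comm_ring_1 weyl_op ring" where
  "weyl_algebra n c = \<lparr>
     carrier = {A. \<forall>\<alpha>\<in>keys A. keys \<alpha> \<subseteq> {1..c} \<and> lookup A \<alpha> \<in> carrier (mpoly_ring {1..n})},
     monoid.mult = weyl_mult,
     one = 1,
     ring.zero = 0,
     add = (+)\<rparr>"

definition weyl_act :: "'k::comm_ring_1 weyl_op \<Rightarrow> 'k mpol \<Rightarrow> 'k mpol" where
  "weyl_act A f = (\<Sum>\<alpha>\<in>keys A. lookup A \<alpha> * multi_iter mpderiv \<alpha> f)"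

text \<open>Since the Weyl algebra is a free left \<open>R\<close>-module on the \<open>\<partial>\<^sup>\<beta>\<close>, its extension of scalars
  to \<open>\<F>\<close> is the \<open>\<F>\<close>-vector space on the \<open>1 \<otimes> \<partial>\<^sup>\<beta>\<close>: \<open>w\<close> stands for
  \<open>\<Sum>\<^sub>\<beta> w\<^sub>\<beta> (1 \<otimes> \<partial>\<^sup>\<beta>)\<close>, with \<open>\<F>\<close> acting by \<^const>\<open>mscale\<close>, and \<open>pure_tensor \<pi> a A\<close> is
  \<open>a \<otimes> A\<close>. See \<open>weyl_noether_universal\<close>.\<close>

type_synonym 'f weyl_noether = "mon \<Rightarrow>\<^sub>0 'f"

definition weyl_noether_module :: "nat \<Rightarrow> 'f::field weyl_noether set" where
  "weyl_noether_module c = {w. \<forall>\<beta>\<in>keys w. keys \<beta> \<subseteq> {1..c}}"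

definition pure_tensor ::
    "('k::field mpol \<Rightarrow> 'f::field) \<Rightarrow> 'f \<Rightarrow> 'k weyl_op \<Rightarrow> 'f weyl_noether" where
  "pure_tensor \<pi> a A = (\<Sum>\<beta>\<in>keys A. single \<beta> (a * \<pi> (lookup A \<beta>)))"

text \<open>The right action is the additive extension of \<open>(a \<otimes> A) r = a \<otimes> (A r)\<close>.\<close>

definition right_act ::
    "nat \<Rightarrow> nat \<Rightarrow> ('k::field mpol \<Rightarrow> 'f::field) \<Rightarrow> 'f weyl_noether \<Rightarrow> 'k mpol \<Rightarrow> 'f weyl_noether" where
  "right_act n c \<pi> w r =
     (\<Sum>\<beta>\<in>keys w.
        pure_tensor \<pi> (lookup w \<beta>) (weyl_partial \<beta> \<otimes>\<^bsub>weyl_algebra n c\<^esub> weyl_coeff r))"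

definition sub_bimodules ::
    "nat \<Rightarrow> nat \<Rightarrow> ('k::field mpol \<Rightarrow> 'f::field) \<Rightarrow> nat \<Rightarrow> 'f weyl_noether set set" where
  "sub_bimodules n c \<pi> m =
     {E. E \<subseteq> weyl_noether_module c \<and> mpol_subspace E \<and> mpol_dim E = m \<and>
         (\<forall>r\<in>carrier (mpoly_ring {1..n}). \<forall>w\<in>E.
            mscale (\<pi> r) w \<in> E \<and> right_act n c \<pi> w r \<in> E)}"


section \<open>The maps\<close>

definition mutually_inverse :: "('a \<Rightarrow> 'b) \<Rightarrow> ('b \<Rightarrow> 'a) \<Rightarrow> 'a set \<Rightarrow> 'b set \<Rightarrow> bool" where
  "mutually_inverse f g A B \<longleftrightarrow>
     f ` A \<subseteq> B \<and> g ` B \<subseteq> A \<and> (\<forall>a\<in>A. g (f a) = a) \<and> (\<forall>b\<in>B. f (g b) = b)"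

definition primary_to_hilbert ::
    "nat \<Rightarrow> ('k::field mpol \<Rightarrow> 'f::field) \<Rightarrow> nat \<Rightarrow> 'k mpol set \<Rightarrow> 'f mpol set" where
  "primary_to_hilbert c \<pi> m Q =
     (y_ideal c [^]\<^bsub>ideals_set (mpoly_ring {1..c})\<^esub> m)
       <+>\<^bsub>mpoly_ring {1..c}\<^esub> (Idl\<^bsub>mpoly_ring {1..c}\<^esub> (gamma c \<pi> ` Q))"

definition hilbert_to_primary ::
    "nat \<Rightarrow> nat \<Rightarrow> ('k::field mpol \<Rightarrow> 'f::field) \<Rightarrow> 'f mpol set \<Rightarrow> 'k mpol set" where
  "hilbert_to_primary n c \<pi> I = {f \<in> carrier (mpoly_ring {1..n}). gamma c \<pi> f \<in> I}"

text \<open>The action of power series on polynomials by differentiation; only finitely many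
  iterated derivatives \<open>\<partial>\<^sup>\<alpha> F\<close> of a polynomial \<open>F\<close> are nonzero.\<close>

definition series_act :: "'f::field mps \<Rightarrow> 'f mpol \<Rightarrow> 'f mpol" where
  "series_act f F =
     (\<Sum>\<alpha> | multi_iter mpderiv \<alpha> F \<noteq> 0. mscale (f \<alpha>) (multi_iter mpderiv \<alpha> F))"

definition inverse_system :: "nat \<Rightarrow> 'f::field mps set \<Rightarrow> 'f mpol set" where
  "inverse_system c I = {F \<in> carrier (mpoly_ring {1..c}). \<forall>f\<in>I. series_act f F = 0}"

definition annihilator :: "nat \<Rightarrow> 'f::field mpol set \<Rightarrow> 'f mps set" where
  "annihilator c V = {f \<in> carrier (mps_ring {1..c}). \<forall>F\<in>V. series_act f F = 0}"

definition omega :: "('k::field mpol \<Rightarrow> 'f::field) \<Rightarrow> 'f mpol \<Rightarrow> 'f weyl_noether" where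
  "omega \<pi> F = (\<Sum>\<alpha>\<in>keys F. mscale (lookup F \<alpha>) (pure_tensor \<pi> 1 (weyl_partial \<alpha>)))"

definition omega_preimage ::
    "nat \<Rightarrow> ('k::field mpol \<Rightarrow> 'f::field) \<Rightarrow> 'f weyl_noether set \<Rightarrow> 'f mpol set" where
  "omega_preimage c \<pi> E = {F \<in> carrier (mpoly_ring {1..c}). omega \<pi> F \<in> E}"

text \<open>The operator \<open>A = \<Sum>\<^sub>\<alpha> \<lambda>\<^sub>\<alpha> \<partial>\<^sup>\<alpha>\<close> is a lift of \<open>w\<close> if some nonzero multiple of \<open>w\<close> is
  \<open>\<Sum>\<^sub>\<alpha> \<pi>(\<lambda>\<^sub>\<alpha>) \<otimes> \<partial>\<^sup>\<alpha> = 1 \<otimes> A\<close>.\<close>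

definition is_lift ::
    "nat \<Rightarrow> nat \<Rightarrow> ('k::field mpol \<Rightarrow> 'f::field) \<Rightarrow> 'k weyl_op \<Rightarrow> 'f weyl_noether \<Rightarrow> bool" where
  "is_lift n c \<pi> A w \<longleftrightarrow> A \<in> carrier (weyl_algebra n c) \<and>
     (\<exists>d. d \<noteq> 0 \<and> mscale d w = pure_tensor \<pi> 1 A)"

definition is_basis :: "nat \<Rightarrow> (nat \<Rightarrow> 'f::field mpol) \<Rightarrow> 'f mpol set \<Rightarrow> bool" where
  "is_basis m b E \<longleftrightarrow> inj_on b {1..m} \<and> \<not> mpol_dependent (b ` {1..m}) \<and> mpol_span (b ` {1..m}) = E"


section \<open>Correctness of the encodings\<close>

text \<open>Polynomials, power series and the relative Weyl algebra form rings, the latter satisfies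
  its defining relations and acts on polynomials, the sum in \<^const>\<open>series_act\<close> is finite,
  and the Weyl-Noether module is a tensor product.\<close>

lemma pm_induct [case_names single add]:
  fixes p :: "'x \<Rightarrow>\<^sub>0 'y::comm_monoid_add"
  assumes "\<And>a y. Q (single a y)" "\<And>p q. Q p \<Longrightarrow> Q q \<Longrightarrow> Q (p + q)"
  shows "Q p"
proof (induction p rule: update_induct)
  case const
  show ?case using assms(1)[of undefined 0] by simp
next
  case (update f a b)
  have "Poly_Mapping.update a b f = f + single a b"
    by (rule poly_mapping_eqI) (use update in \<open>auto simp: Poly_Mapping.update.rep_eq lookup_add lookup_single when_def in_keys_iff\<close>)
  then show ?case using assms update by simp
qed

lemma keys_sum_add:
  fixes p q :: "'x \<Rightarrow>\<^sub>0 'y::comm_monoid_add" and g :: "'x \<Rightarrow> 'y \<Rightarrow> 'z::comm_monoid_add"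
  assumes "\<And>a x y. g a (x + y) = g a x + g a y" "\<And>a. g a 0 = 0"
  shows "(\<Sum>a\<in>keys (p + q). g a (lookup (p + q) a)) =
    (\<Sum>a\<in>keys p. g a (lookup p a)) + (\<Sum>a\<in>keys q. g a (lookup q a))"
proof -
  have e: "(\<Sum>a\<in>keys r. g a (lookup r a)) = (\<Sum>a\<in>keys p \<union> keys q. g a (lookup r a))"
    if "keys r \<subseteq> keys p \<union> keys q" for r
    by (rule sum.mono_neutral_left) (use that in \<open>auto simp: in_keys_iff assms\<close>)
  show ?thesis
    by (subst (1 2 3) e) (use Poly_Mapping.keys_add[of p q] in \<open>auto simp: lookup_add assms sum.distrib\<close>)
qed

lemma keys_sum_single:
  assumes "\<And>a. g a 0 = 0"
  shows "(\<Sum>a\<in>keys (single b y). g a (lookup (single b y) a)) = g b y"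
  by (cases "y = 0") (auto simp: assms)

lemma poly_mapping_sum_monomials: "(\<Sum>a\<in>keys p. single a (lookup p a)) = p"
proof (induction p rule: pm_induct)
  case (single a y) show ?case by (rule keys_sum_single) simp
next
  case (add p q) then show ?case by (subst keys_sum_add) (simp_all add: single_add)
qed

lemma mpderiv_single: "mpderiv i (single \<alpha> a) = single (\<alpha> - single i 1) (of_nat (lookup \<alpha> i) * a)"
  unfolding mpderiv_def by (rule keys_sum_single) simp

lemma mpderiv_add: "mpderiv i (f + g) = mpderiv i f + mpderiv i g"
  unfolding mpderiv_def by (rule keys_sum_add) (simp_all add: single_add distrib_left)

lemma mpderiv_zero [simp]: "mpderiv i 0 = 0"
  by (simp add: mpderiv_def)

lemma mon_diff_diff: fixes a b c :: mon shows "a - b - c = a - c - b"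
  by (rule poly_mapping_eqI) (simp add: lookup_minus)

lemma mpderiv_commute: "mpderiv i (mpderiv j f) = mpderiv j (mpderiv i f)"
proof (induction f rule: pm_induct)
  case (single \<alpha> a)
  show ?case
    by (cases "i = j") (auto simp: mpderiv_single mon_diff_diff[of \<alpha> "single i (Suc 0)"] lookup_minus lookup_single algebra_simps)
qed (simp add: mpderiv_add)

lemma mpderiv_mult: "mpderiv i (f * g) = mpderiv i f * g + f * mpderiv i g"
proof (induction f rule: pm_induct)
  case (single \<alpha> a)
  show ?case
  proof (induction g rule: pm_induct)
    case (single \<beta> b)
    have 1: "\<alpha> + \<beta> - single i 1 = \<alpha> - single i 1 + \<beta>" if "lookup \<alpha> i \<noteq> 0"
      by (rule poly_mapping_eqI) (use that in \<open>auto simp: lookup_minus lookup_add lookup_single when_def\<close>)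
    have 2: "\<alpha> + \<beta> - single i 1 = \<alpha> + (\<beta> - single i 1)" if "lookup \<beta> i \<noteq> 0"
      by (rule poly_mapping_eqI) (use that in \<open>auto simp: lookup_minus lookup_add lookup_single when_def\<close>)
    show ?case using 1 2
      by (cases "lookup \<alpha> i = 0"; cases "lookup \<beta> i = 0")
        (auto simp: mpderiv_single mult_single lookup_add algebra_simps simp flip: single_add)
  qed (simp add: mpderiv_add algebra_simps)
qed (simp add: mpderiv_add algebra_simps)

lemma mpderiv_one [simp]: "mpderiv i 1 = 0"
  by (simp only: single_one[symmetric] mpderiv_single) simp

lemma pl_single: "partial_left_mult i (single \<alpha> r) = single (\<alpha> + single i 1) r + single \<alpha> (mpderiv i r)"
  unfolding partial_left_mult_def by (rule keys_sum_single) simp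

lemma pl_add: "partial_left_mult i (A + B) = partial_left_mult i A + partial_left_mult i B"
  unfolding partial_left_mult_def by (rule keys_sum_add) (simp_all add: single_add mpderiv_add algebra_simps)

lemma pl_zero [simp]: "partial_left_mult i 0 = 0" by (simp add: partial_left_mult_def)

lemma pl_commute: "partial_left_mult i (partial_left_mult j A) = partial_left_mult j (partial_left_mult i A)"
proof (induction A rule: pm_induct)
  case (single \<alpha> a)
  show ?case by (auto simp: pl_single pl_add algebra_simps mpderiv_commute[of i])
qed (simp add: pl_add)

lemma pl_coeff: "partial_left_mult i (weyl_coeff r * B) = weyl_coeff (mpderiv i r) * B + weyl_coeff r * partial_left_mult i B"
proof (induction B rule: pm_induct)
  case (single \<alpha> a)
  show ?case by (auto simp: pl_single pl_add algebra_simps mpderiv_mult weyl_coeff_def mult_single simp flip: single_add)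
qed (simp add: pl_add algebra_simps)

lemma foldr_extra: "(\<And>i. \<not> Pr i \<Longrightarrow> f i = id) \<Longrightarrow> foldr f (filter Pr xs) = foldr f xs"
  by (induction xs) auto

lemma multi_iter_eq:
  assumes "finite V" "keys \<alpha> \<subseteq> V"
  shows "multi_iter D \<alpha> = foldr (\<lambda>i. D i ^^ lookup \<alpha> i) (sorted_list_of_set V)"
proof -
  have "sorted_list_of_set (keys \<alpha>) = filter (\<lambda>i. i \<in> keys \<alpha>) (sorted_list_of_set V)"
    by (rule sorted_distinct_set_unique) (use assms in \<open>auto intro!: sorted_wrt_filter\<close>)
  then show ?thesis unfolding multi_iter_def
    by (simp only:) (rule foldr_extra, auto simp: in_keys_iff)
qed

lemma funpow_comm: "(\<And>x. D (E x) = E (D x)) \<Longrightarrow> D ((E ^^ k) x) = (E ^^ k) (D x)"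
  by (induction k) auto

lemma multi_iter_plus:
  assumes c: "\<And>i j x. D i (D j x) = D j (D i x)"
  shows "multi_iter D (\<alpha> + single i 1) x = D i (multi_iter D \<alpha> x)"
proof -
  let ?V = "insert i (keys \<alpha>)"
  have fold: "foldr (\<lambda>j. D j ^^ lookup (\<alpha> + single i 1) j) xs x =
     (if i \<in> set xs then D i else id) (foldr (\<lambda>j. D j ^^ lookup \<alpha> j) xs x)" if "distinct xs" for xs
    using that
  proof (induction xs)
    case (Cons j xs)
    have "(D j ^^ k) (D i y) = D i ((D j ^^ k) y)" for k y
      using funpow_comm[of "D i" "D j"] c by metis
    with Cons show ?case by (auto simp: lookup_add lookup_single when_def)
  qed simp
  have k: "keys (\<alpha> + single i 1) \<subseteq> ?V" using Poly_Mapping.keys_add[of \<alpha> "single i 1"] by auto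
  have "multi_iter D (\<alpha> + single i 1) = foldr (\<lambda>j. D j ^^ lookup (\<alpha> + single i 1) j) (sorted_list_of_set ?V)"
    by (rule multi_iter_eq) (use k in auto)
  moreover have "multi_iter D \<alpha> = foldr (\<lambda>j. D j ^^ lookup \<alpha> j) (sorted_list_of_set ?V)"
    by (rule multi_iter_eq) auto
  moreover have "i \<in> set (sorted_list_of_set ?V)" by (subst set_sorted_list_of_set) auto
  moreover have "distinct (sorted_list_of_set ?V)" by (rule distinct_sorted_list_of_set)
  ultimately show ?thesis using fold[of "sorted_list_of_set ?V"] by presburger
qed

lemma multi_iter_0 [simp]: "multi_iter D 0 = id" by (simp add: multi_iter_def)

lemma mon_induct [case_names zero plus]:
  fixes \<alpha> :: mon
  assumes "Q 0" "\<And>\<alpha> i. Q \<alpha> \<Longrightarrow> Q (\<alpha> + single i 1)"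
  shows "Q \<alpha>"
proof -
  have "Q \<beta> \<Longrightarrow> Q (\<beta> + \<alpha>)" for \<beta>
  proof (induction \<alpha> arbitrary: \<beta> rule: pm_induct)
    case (single a y)
    then show ?case
    proof (induction y)
      case (Suc y)
      have "single a (Suc y) = single a y + single a 1" by (simp flip: single_add)
      with assms(2)[OF Suc.IH[OF Suc.prems]] show ?case by (simp add: add.assoc)
    qed simp
  next
    case (add p q) then show ?case by (simp flip: add.assoc)
  qed
  from this[OF assms(1)] show ?thesis by simp
qed

lemma mi_pl_add: "multi_iter partial_left_mult \<alpha> (A + B) = multi_iter partial_left_mult \<alpha> A + multi_iter partial_left_mult \<alpha> B"
  by (induction \<alpha> rule: mon_induct) (simp_all add: multi_iter_plus pl_commute pl_add del: One_nat_def)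

lemma mi_pl_zero [simp]: "multi_iter partial_left_mult \<alpha> 0 = 0"
  by (induction \<alpha> rule: mon_induct) (simp_all add: multi_iter_plus pl_commute del: One_nat_def)

lemma wc_add: "weyl_coeff (r + s) = weyl_coeff r + weyl_coeff s" by (simp add: weyl_coeff_def single_add)
lemma wc_zero [simp]: "weyl_coeff 0 = 0" by (simp add: weyl_coeff_def)
lemma wc_mult: "weyl_coeff (r * s) = weyl_coeff r * weyl_coeff s" by (simp add: weyl_coeff_def mult_single)

lemma wm_add_left: "weyl_mult (A + B) C = weyl_mult A C + weyl_mult B C"
  unfolding weyl_mult_def by (rule keys_sum_add) (simp_all add: wc_add algebra_simps)
lemma wm_single: "weyl_mult (single \<alpha> r) C = weyl_coeff r * multi_iter partial_left_mult \<alpha> C"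
  unfolding weyl_mult_def by (rule keys_sum_single) simp
lemma wm_add_right: "weyl_mult A (B + C) = weyl_mult A B + weyl_mult A C"
  by (simp add: weyl_mult_def mi_pl_add algebra_simps sum.distrib)
lemma wm_zero [simp]: "weyl_mult A 0 = 0" "weyl_mult 0 A = 0"
  by (simp_all add: weyl_mult_def)

lemma wm_pl: "weyl_mult (partial_left_mult i A) B = partial_left_mult i (weyl_mult A B)"
proof (induction A rule: pm_induct)
  case (single \<alpha> r)
  show ?case by (simp add: pl_single wm_add_left wm_single pl_coeff multi_iter_plus pl_commute algebra_simps del: One_nat_def)
qed (simp add: wm_add_left pl_add)

lemma wm_coeff: "weyl_mult (weyl_coeff r * A) B = weyl_coeff r * weyl_mult A B"
proof (induction A rule: pm_induct)
  case (single \<alpha> s)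
  have "weyl_coeff r * single \<alpha> s = single \<alpha> (r * s)" by (simp add: weyl_coeff_def mult_single)
  then show ?case by (simp add: wm_single wc_mult mult.assoc)
qed (simp add: wm_add_left algebra_simps)

lemma wm_mi: "weyl_mult (multi_iter partial_left_mult \<alpha> B) C = multi_iter partial_left_mult \<alpha> (weyl_mult B C)"
  by (induction \<alpha> rule: mon_induct) (simp_all add: multi_iter_plus pl_commute wm_pl del: One_nat_def)

lemma weyl_mult_assoc: "weyl_mult (weyl_mult A B) C = weyl_mult A (weyl_mult B C)"
proof (induction A rule: pm_induct)
  case (single \<alpha> r)
  show ?case by (simp add: wm_single wm_coeff wm_mi)
qed (simp add: wm_add_left)

lemma mi_pl_1: "multi_iter partial_left_mult \<alpha> 1 = weyl_partial \<alpha>"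
proof (induction \<alpha> rule: mon_induct)
  case (plus \<alpha> i)
  show ?case using plus
    by (simp add: multi_iter_plus pl_commute weyl_partial_def pl_single del: One_nat_def)
qed (simp add: weyl_partial_def)

lemma weyl_mult_one: "weyl_mult 1 A = A" "weyl_mult A 1 = A"
proof -
  show "weyl_mult 1 A = A" by (simp only: single_one[symmetric] wm_single) (simp add: weyl_coeff_def)
  show "weyl_mult A 1 = A"
  proof (induction A rule: pm_induct)
    case (single a y)
    then show ?case by (simp add: wm_single mi_pl_1) (simp add: weyl_partial_def weyl_coeff_def mult_single)
  qed (simp add: wm_add_left)
qed

lemma weyl_relations:
  "weyl_mult (weyl_partial (single i 1)) (weyl_coeff r) =
     weyl_mult (weyl_coeff r) (weyl_partial (single i 1)) + weyl_coeff (mpderiv i r)"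
  "weyl_mult (weyl_coeff r) (weyl_coeff s) = weyl_coeff (r * s)"
  "weyl_mult (weyl_partial \<alpha>) (weyl_partial \<beta>) = weyl_partial (\<alpha> + \<beta>)"
proof -
  have *: "weyl_mult (weyl_partial (single i 1)) A = partial_left_mult i A" for i and A :: "'z::comm_ring_1 weyl_op"
    using multi_iter_plus[of partial_left_mult 0 i A, OF pl_commute]
    by (simp add: weyl_partial_def wm_single weyl_coeff_def)
  show "weyl_mult (weyl_partial (single i 1)) (weyl_coeff r) =
     weyl_mult (weyl_coeff r) (weyl_partial (single i 1)) + weyl_coeff (mpderiv i r)"
    by (subst *) (simp add: weyl_coeff_def weyl_partial_def pl_single wm_single mult_single)
  show "weyl_mult (weyl_coeff r) (weyl_coeff s) = weyl_coeff (r * s)"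
    by (simp add: weyl_coeff_def wm_single mult_single)
  show "weyl_mult (weyl_partial \<alpha>) (weyl_partial \<beta>) = weyl_partial (\<alpha> + \<beta>)"
  proof (induction \<alpha> rule: mon_induct)
    case zero
    show ?case using weyl_mult_one(1)[of "weyl_partial \<beta>"] by (simp add: weyl_partial_def)
  next
    case (plus \<alpha> i)
    have 1: "weyl_partial (\<gamma> + single i 1) = weyl_mult (weyl_partial (single i 1)) (weyl_partial \<gamma>)" for \<gamma>
      by (subst *) (simp add: weyl_partial_def pl_single)
    show ?case unfolding 1[of \<alpha>] weyl_mult_assoc plus 1[of "\<alpha> + \<beta>", symmetric] by (simp only: add_ac)
  qed
qed

lemma act_add_left: "weyl_act (A + B) f = weyl_act A f + weyl_act B f"
  unfolding weyl_act_def by (rule keys_sum_add) (simp_all add: algebra_simps)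
lemma act_single: "weyl_act (single \<alpha> r) f = r * multi_iter mpderiv \<alpha> f"
  unfolding weyl_act_def by (rule keys_sum_single) simp
lemma act_pl: "weyl_act (partial_left_mult i A) f = mpderiv i (weyl_act A f)"
proof (induction A rule: pm_induct)
  case (single \<alpha> r)
  show ?case by (simp add: pl_single act_add_left act_single mpderiv_mult multi_iter_plus mpderiv_commute algebra_simps del: One_nat_def)
qed (simp add: act_add_left pl_add mpderiv_add)
lemma act_mi: "weyl_act (multi_iter partial_left_mult \<alpha> A) f = multi_iter mpderiv \<alpha> (weyl_act A f)"
  by (induction \<alpha> rule: mon_induct) (simp_all add: multi_iter_plus mpderiv_commute pl_commute act_pl del: One_nat_def)
lemma act_coeff: "weyl_act (weyl_coeff r * A) f = r * weyl_act A f"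
proof (induction A rule: pm_induct)
  case (single \<alpha> s)
  have "weyl_coeff r * single \<alpha> s = single \<alpha> (r * s)" by (simp add: weyl_coeff_def mult_single)
  then show ?case by (simp add: act_single mult.assoc)
qed (simp add: act_add_left algebra_simps)
lemma weyl_act_mult: "weyl_act (weyl_mult A B) f = weyl_act A (weyl_act B f)"
proof (induction A rule: pm_induct)
  case (single \<alpha> r)
  show ?case by (simp add: wm_single act_coeff act_mi act_single)
qed (simp add: act_add_left wm_add_left)


lemma carrier_mpoly_ring: "carrier (mpoly_ring V) = {p. \<forall>\<alpha>\<in>keys p. keys \<alpha> \<subseteq> V}"
  by (simp add: mpoly_ring_def)

lemma mon_keys_plus: "keys (\<alpha> + \<beta>) = keys \<alpha> \<union> keys (\<beta> :: mon)"
  by (auto simp: in_keys_iff lookup_add)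

lemma mpoly_zero: "0 \<in> carrier (mpoly_ring V)" by (simp add: carrier_mpoly_ring)
lemma mpoly_one: "1 \<in> carrier (mpoly_ring V)" by (simp add: carrier_mpoly_ring)
lemma mpoly_add: "p \<in> carrier (mpoly_ring V) \<Longrightarrow> q \<in> carrier (mpoly_ring V) \<Longrightarrow> p + q \<in> carrier (mpoly_ring V)"
  using Poly_Mapping.keys_add[of p q] by (auto simp: carrier_mpoly_ring)
lemma mpoly_uminus: "p \<in> carrier (mpoly_ring V) \<Longrightarrow> - p \<in> carrier (mpoly_ring V)"
  by (auto simp: carrier_mpoly_ring)
lemma mpoly_mult: "p \<in> carrier (mpoly_ring V) \<Longrightarrow> q \<in> carrier (mpoly_ring V) \<Longrightarrow> p * q \<in> carrier (mpoly_ring V)"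
  using keys_mult[of p q] by (fastforce simp: carrier_mpoly_ring mon_keys_plus)
lemma mpoly_sum: "(\<And>i. i \<in> S \<Longrightarrow> f i \<in> carrier (mpoly_ring V)) \<Longrightarrow> sum f S \<in> carrier (mpoly_ring V)"
  by (induction S rule: infinite_finite_induct) (auto intro: mpoly_add mpoly_zero)
lemma mpoly_deriv: "p \<in> carrier (mpoly_ring V) \<Longrightarrow> mpderiv i p \<in> carrier (mpoly_ring V)"
proof -
  assume p: "p \<in> carrier (mpoly_ring V)"
  have "keys (\<alpha> - single i 1) \<subseteq> keys \<alpha>" for \<alpha> :: mon
    by (auto simp: in_keys_iff lookup_minus)
  with p show ?thesis unfolding mpderiv_def
    by (intro mpoly_sum) (force simp: carrier_mpoly_ring simp del: One_nat_def)
qed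

lemma ring_of_simps [simp]:
  "monoid.mult ring_of_type_algebra = (*)" "one ring_of_type_algebra = 1"
  "ring.zero ring_of_type_algebra = 0" "add ring_of_type_algebra = (+)" "carrier ring_of_type_algebra = UNIV"
  by (simp_all add: ring_of_type_algebra_def fun_eq_iff)

lemma cring_mpoly_ring: "cring (mpoly_ring V :: 'a::comm_ring_1 mpol ring)"
proof -
  have s: "monoid.mult (mpoly_ring V :: 'a mpol ring) = (*)" "one (mpoly_ring V :: 'a mpol ring) = 1"
  "ring.zero (mpoly_ring V :: 'a mpol ring) = 0" "add (mpoly_ring V :: 'a mpol ring) = (+)" 
    by (simp_all add: mpoly_ring_def)
  show ?thesis
    by (intro cringI abelian_groupI comm_monoidI; (simp only: s)?)
      (auto simp: algebra_simps s intro: mpoly_add mpoly_mult mpoly_zero mpoly_one intro!: bexI[OF _ mpoly_uminus])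
qed

lemma finite_mon_decomp: "finite {(\<beta>, \<delta>). \<beta> + \<delta> = (\<alpha>::mon)}"
proof -
  have *: "inj_on lookup {\<beta>::mon. \<exists>\<delta>. \<beta> + \<delta> = \<alpha>}" by (rule inj_onI) (rule poly_mapping_eqI, simp)
  have "lookup ` {\<beta>::mon. \<exists>\<delta>. \<beta> + \<delta> = \<alpha>} \<subseteq> {f. \<forall>i. (i \<in> keys \<alpha> \<longrightarrow> f i \<in> {0..Max (insert 0 (lookup \<alpha> ` keys \<alpha>))}) \<and> (i \<notin> keys \<alpha> \<longrightarrow> f i = 0)}"
    (is "_ \<subseteq> ?S")
  proof
    fix f assume "f \<in> lookup ` {\<beta>::mon. \<exists>\<delta>. \<beta> + \<delta> = \<alpha>}"
    then obtain \<beta> \<delta> :: mon where \<alpha>: "\<alpha> = \<beta> + \<delta>" and f: "f = lookup \<beta>" by blast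
    have "lookup \<beta> i \<le> Max (insert 0 (lookup \<alpha> ` keys \<alpha>))" if "i \<in> keys \<alpha>" for i
      by (rule order_trans[of _ "lookup \<alpha> i"]) (use that in \<open>auto simp: \<alpha> lookup_add intro!: Max_ge\<close>)
    then show "f \<in> ?S" unfolding f \<alpha> by (auto simp: in_keys_iff lookup_add)
  qed
  then have "finite (lookup ` {\<beta>::mon. \<exists>\<delta>. \<beta> + \<delta> = \<alpha>})"
    by (rule finite_subset) (rule finite_set_of_finite_funs, auto)
  with * have "finite {\<beta>::mon. \<exists>\<delta>. \<beta> + \<delta> = \<alpha>}" by (blast dest: finite_imageD)
  then have "finite ((\<lambda>\<beta>. (\<beta>, \<alpha> - \<beta>)) ` {\<beta>::mon. \<exists>\<delta>. \<beta> + \<delta> = \<alpha>})" by blast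
  then show ?thesis by (rule rev_finite_subset) auto
qed

lemma finite_mon_decomp': "finite {p. fst p + snd p = (\<alpha>::mon)}"
  using finite_mon_decomp[of \<alpha>] by (simp add: split_def)

lemma mps_simps: 
  "carrier (mps_ring V) = {f. \<forall>\<alpha>. f \<alpha> \<noteq> 0 \<longrightarrow> keys \<alpha> \<subseteq> V}"
  "monoid.mult (mps_ring V) = (\<lambda>f g \<alpha>. \<Sum>(\<beta>, \<delta>) | \<beta> + \<delta> = \<alpha>. f \<beta> * g \<delta>)"
  "one (mps_ring V) = (\<lambda>\<alpha>. if \<alpha> = 0 then 1 else 0)"
  "ring.zero (mps_ring V) = (\<lambda>_. 0)" "add (mps_ring V) = (\<lambda>f g \<alpha>. f \<alpha> + g \<alpha>)"
  by (simp_all add: mps_ring_def)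

lemma cring_mps_ring: "cring (mps_ring V :: 'a::comm_ring_1 mps ring)"
proof (intro cringI abelian_groupI comm_monoidI)
  let ?M = "\<lambda>(f::'a mps) g \<alpha>. \<Sum>(\<beta>, \<delta>) | \<beta> + \<delta> = \<alpha>. f \<beta> * g \<delta>"
  show "x \<otimes>\<^bsub>mps_ring V\<^esub> y \<in> carrier (mps_ring V)" if "x \<in> carrier (mps_ring V)" "y \<in> carrier (mps_ring V)" for x y :: "'a mps"
  proof -
    have "?M x y \<alpha> = 0" if "\<not> keys \<alpha> \<subseteq> V" for \<alpha>
    proof (rule sum.neutral, clarsimp)
      fix \<beta> \<delta> assume "\<alpha> = \<beta> + \<delta>"
      with that have "\<not> keys \<beta> \<subseteq> V \<or> \<not> keys \<delta> \<subseteq> V" by (auto simp: mon_keys_plus)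
      then show "x \<beta> * y \<delta> = 0" using \<open>x \<in> _\<close> \<open>y \<in> _\<close>
        unfolding mps_simps mem_Collect_eq by (metis mult_zero_left mult_zero_right)
    qed
    then show ?thesis by (auto simp: mps_simps)
  qed
  show "(x \<otimes>\<^bsub>mps_ring V\<^esub> y) \<otimes>\<^bsub>mps_ring V\<^esub> z = x \<otimes>\<^bsub>mps_ring V\<^esub> (y \<otimes>\<^bsub>mps_ring V\<^esub> z)" for x y z :: "'a mps"
  proof (rule ext)
    fix \<alpha>
    have "?M (?M x y) z \<alpha> = (\<Sum>(\<beta>, \<delta>) | \<beta> + \<delta> = \<alpha>. \<Sum>(\<beta>1, \<beta>2) | \<beta>1 + \<beta>2 = \<beta>. x \<beta>1 * y \<beta>2 * z \<delta>)"
      by (simp add: sum_distrib_right split_def)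
    also have "\<dots> = (\<Sum>(p, q) \<in> (SIGMA p:{(\<beta>, \<delta>). \<beta> + \<delta> = \<alpha>}. {(\<beta>1, \<beta>2). \<beta>1 + \<beta>2 = fst p}). x (fst q) * y (snd q) * z (snd p))"
      by (subst sum.Sigma[symmetric]) (auto simp: finite_mon_decomp' split_def)
    also have "\<dots> = (\<Sum>(p, q) \<in> (SIGMA p:{(\<beta>, \<delta>). \<beta> + \<delta> = \<alpha>}. {(\<delta>1, \<delta>2). \<delta>1 + \<delta>2 = snd p}). x (fst p) * (y (fst q) * z (snd q)))"
      by (rule sum.reindex_bij_witness[where j = "\<lambda>((b, d), (b1, b2)). ((b1, b2 + d), (b2, d))" and i = "\<lambda>((b, d), (d1, d2)). ((b + d1, d2), (b, d1))"])
        (auto simp: add_ac mult.assoc)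
    also have "\<dots> = (\<Sum>(\<beta>, \<delta>) | \<beta> + \<delta> = \<alpha>. \<Sum>(\<delta>1, \<delta>2) | \<delta>1 + \<delta>2 = \<delta>. x \<beta> * (y \<delta>1 * z \<delta>2))"
      by (subst sum.Sigma[symmetric]) (auto simp: finite_mon_decomp' split_def)
    also have "\<dots> = ?M x (?M y z) \<alpha>" by (simp add: sum_distrib_left split_def)
    finally show "((x \<otimes>\<^bsub>mps_ring V\<^esub> y) \<otimes>\<^bsub>mps_ring V\<^esub> z) \<alpha> = (x \<otimes>\<^bsub>mps_ring V\<^esub> (y \<otimes>\<^bsub>mps_ring V\<^esub> z)) \<alpha>"
      by (simp add: mps_simps)
  qed
  show "x \<otimes>\<^bsub>mps_ring V\<^esub> y = y \<otimes>\<^bsub>mps_ring V\<^esub> x" for x y :: "'a mps"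
  proof (rule ext)
    fix \<alpha> show "(x \<otimes>\<^bsub>mps_ring V\<^esub> y) \<alpha> = (y \<otimes>\<^bsub>mps_ring V\<^esub> x) \<alpha>"
      unfolding mps_simps
      by (rule sum.reindex_bij_witness[where i = prod.swap and j = prod.swap]) (auto simp: add_ac mult_ac)
  qed
  show "\<one>\<^bsub>mps_ring V\<^esub> \<otimes>\<^bsub>mps_ring V\<^esub> x = x" for x :: "'a mps"
  proof (rule ext)
    fix \<alpha>
    have "?M (\<one>\<^bsub>mps_ring V\<^esub>) x \<alpha> = (\<Sum>(\<beta>, \<delta>) \<in> {(0, \<alpha>)}. \<one>\<^bsub>mps_ring V\<^esub> \<beta> * x \<delta>)"
      by (rule sum.mono_neutral_right) (auto simp: finite_mon_decomp mps_simps split: if_splits)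
    then show "(\<one>\<^bsub>mps_ring V\<^esub> \<otimes>\<^bsub>mps_ring V\<^esub> x) \<alpha> = x \<alpha>" by (simp add: mps_simps)
  qed
  show "\<exists>y\<in>carrier (mps_ring V). y \<oplus>\<^bsub>mps_ring V\<^esub> x = \<zero>\<^bsub>mps_ring V\<^esub>" if "x \<in> carrier (mps_ring V)" for x :: "'a mps"
    by (rule bexI[of _ "\<lambda>\<alpha>. - x \<alpha>"]) (use that in \<open>auto simp: mps_simps\<close>)
  show "x \<oplus>\<^bsub>mps_ring V\<^esub> y \<in> carrier (mps_ring V)" if "x \<in> carrier (mps_ring V)" "y \<in> carrier (mps_ring V)" for x y :: "'a mps"
    using that unfolding mps_simps mem_Collect_eq by (metis add.right_neutral)
qed (auto simp: mps_simps algebra_simps split_def sum.distrib)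

lemma weyl_simps:
  "carrier (weyl_algebra n c) = {A. \<forall>\<alpha>\<in>keys A. keys \<alpha> \<subseteq> {1..c} \<and> lookup A \<alpha> \<in> carrier (mpoly_ring {1..n})}"
  "monoid.mult (weyl_algebra n c) = weyl_mult" "one (weyl_algebra n c) = 1"
  "ring.zero (weyl_algebra n c) = 0" "add (weyl_algebra n c) = (+)"
  by (simp_all add: weyl_algebra_def)

lemma weyl_carrier_iff: "A \<in> carrier (weyl_algebra n c) \<longleftrightarrow> 
  (\<forall>\<alpha>. (\<not> keys \<alpha> \<subseteq> {1..c} \<longrightarrow> lookup A \<alpha> = 0) \<and> lookup A \<alpha> \<in> carrier (mpoly_ring {1..n}))"
proof (intro iffI allI)
  fix \<alpha> assume "A \<in> carrier (weyl_algebra n c)"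
  then show "(\<not> keys \<alpha> \<subseteq> {1..c} \<longrightarrow> lookup A \<alpha> = 0) \<and> lookup A \<alpha> \<in> carrier (mpoly_ring {1..n})"
    by (cases "\<alpha> \<in> keys A") (simp_all add: weyl_simps in_keys_iff mpoly_zero)
next
  assume "\<forall>\<alpha>. (\<not> keys \<alpha> \<subseteq> {1..c} \<longrightarrow> lookup A \<alpha> = 0) \<and> lookup A \<alpha> \<in> carrier (mpoly_ring {1..n})"
  then show "A \<in> carrier (weyl_algebra n c)" by (simp add: weyl_simps in_keys_iff) blast
qed

lemma weyl_add: "A \<in> carrier (weyl_algebra n c) \<Longrightarrow> B \<in> carrier (weyl_algebra n c) \<Longrightarrow> A + B \<in> carrier (weyl_algebra n c)"
  by (auto simp: weyl_carrier_iff lookup_add intro: mpoly_add)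
lemma weyl_uminus: "A \<in> carrier (weyl_algebra n c) \<Longrightarrow> - A \<in> carrier (weyl_algebra n c)"
  by (auto simp: weyl_carrier_iff intro: mpoly_uminus)
lemma weyl_zero: "0 \<in> carrier (weyl_algebra n c)" by (simp add: weyl_simps)
lemma weyl_sum: "(\<And>i. i \<in> S \<Longrightarrow> f i \<in> carrier (weyl_algebra n c)) \<Longrightarrow> sum f S \<in> carrier (weyl_algebra n c)"
  by (induction S rule: infinite_finite_induct) (auto intro: weyl_add weyl_zero)
lemma weyl_single: "keys \<alpha> \<subseteq> {1..c} \<Longrightarrow> r \<in> carrier (mpoly_ring {1..n}) \<Longrightarrow> single \<alpha> r \<in> carrier (weyl_algebra n c)"
  by (auto simp: weyl_simps)
lemma weyl_pl: "i \<in> {1..c} \<Longrightarrow> A \<in> carrier (weyl_algebra n c) \<Longrightarrow> partial_left_mult i A \<in> carrier (weyl_algebra n c)"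
  unfolding partial_left_mult_def
  by (intro weyl_sum weyl_add weyl_single mpoly_deriv) (auto simp: weyl_simps mon_keys_plus)
lemma weyl_mi: "keys \<alpha> \<subseteq> {1..c} \<Longrightarrow> A \<in> carrier (weyl_algebra n c) \<Longrightarrow> multi_iter partial_left_mult \<alpha> A \<in> carrier (weyl_algebra n c)"
  by (induction \<alpha> rule: mon_induct) (auto simp: multi_iter_plus pl_commute mon_keys_plus weyl_pl simp del: One_nat_def)
lemma lookup_wc: "lookup (weyl_coeff r * A) \<alpha> = r * lookup A \<alpha>"
proof (induction A rule: pm_induct)
  case (single \<beta> s) show ?case by (simp add: weyl_coeff_def mult_single lookup_single when_def)
qed (simp add: lookup_add algebra_simps)
lemma weyl_wc: "r \<in> carrier (mpoly_ring {1..n}) \<Longrightarrow> A \<in> carrier (weyl_algebra n c) \<Longrightarrow> weyl_coeff r * A \<in> carrier (weyl_algebra n c)"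
  by (auto simp: weyl_carrier_iff lookup_wc intro: mpoly_mult)
lemma weyl_mult_closed: "A \<in> carrier (weyl_algebra n c) \<Longrightarrow> B \<in> carrier (weyl_algebra n c) \<Longrightarrow> weyl_mult A B \<in> carrier (weyl_algebra n c)"
  unfolding weyl_mult_def by (intro weyl_sum weyl_wc weyl_mi) (auto simp: weyl_simps)

lemma ring_weyl_algebra: "ring (weyl_algebra n c :: 'k::comm_ring_1 weyl_op ring)"
proof -
  have "1 \<in> carrier (weyl_algebra n c :: 'k weyl_op ring)"
    using weyl_single[of 0 c "1 :: 'k mpol" n, OF _ mpoly_one] by simp
  moreover have "\<exists>y\<in>carrier (weyl_algebra n c). y \<oplus>\<^bsub>weyl_algebra n c\<^esub> x = \<zero>\<^bsub>weyl_algebra n c\<^esub>"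
    if "x \<in> carrier (weyl_algebra n c)" for x :: "'k weyl_op"
    using that by (intro bexI[of _ "-x"] weyl_uminus) (auto simp: weyl_simps)
  ultimately show ?thesis
    by (intro ringI abelian_groupI monoidI)
      (auto simp: weyl_simps(2-) weyl_mult_assoc weyl_mult_one wm_add_left wm_add_right add_ac
        intro: weyl_add weyl_mult_closed weyl_zero)
qed

lemma lookup_pure_tensor:
  assumes "\<pi> 0 = 0"
  shows "lookup (pure_tensor \<pi> a A) \<beta> = a * \<pi> (lookup A \<beta>)"
proof -
  have "lookup (pure_tensor \<pi> a A) \<beta> = (\<Sum>\<gamma>\<in>keys A. if \<gamma> = \<beta> then a * \<pi> (lookup A \<gamma>) else 0)"
    by (auto simp: pure_tensor_def lookup_sum lookup_single when_def intro!: sum.cong)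
  also have "\<dots> = a * \<pi> (lookup A \<beta>)" using assms by (auto simp: in_keys_iff)
  finally show ?thesis .
qed

context
  fixes n c :: nat and \<pi> :: "'k::field mpol \<Rightarrow> 'f::field"
  assumes hom: "\<pi> \<in> ring_hom (mpoly_ring {1..n}) ring_of_type_algebra"
begin

lemma hom_simps: 
  "r \<in> carrier (mpoly_ring {1..n}) \<Longrightarrow> s \<in> carrier (mpoly_ring {1..n}) \<Longrightarrow> \<pi> (r + s) = \<pi> r + \<pi> s"
  "r \<in> carrier (mpoly_ring {1..n}) \<Longrightarrow> s \<in> carrier (mpoly_ring {1..n}) \<Longrightarrow> \<pi> (r * s) = \<pi> r * \<pi> s"
  "\<pi> 1 = 1" "\<pi> 0 = 0"
proof -
  show *: "r \<in> carrier (mpoly_ring {1..n}) \<Longrightarrow> s \<in> carrier (mpoly_ring {1..n}) \<Longrightarrow> \<pi> (r + s) = \<pi> r + \<pi> s" for r s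
    using ring_hom_add[OF hom] by (auto simp: mpoly_ring_def)
  show "\<pi> (r * s) = \<pi> r * \<pi> s" if "r \<in> carrier (mpoly_ring {1..n})" "s \<in> carrier (mpoly_ring {1..n})"
    using ring_hom_mult[OF hom] that by (auto simp: mpoly_ring_def)
  show "\<pi> 1 = 1" using ring_hom_one[OF hom] by (auto simp: mpoly_ring_def)
  show "\<pi> 0 = 0" using *[OF mpoly_zero mpoly_zero] by (metis add.right_neutral add_left_cancel)
qed

lemma pure_tensor_add_left: "pure_tensor \<pi> (a + b) A = pure_tensor \<pi> a A + pure_tensor \<pi> b A"
  by (simp add: pure_tensor_def distrib_right single_add sum.distrib)

lemma pure_tensor_add_right:
  assumes "A \<in> carrier (weyl_algebra n c)" "B \<in> carrier (weyl_algebra n c)"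
  shows "pure_tensor \<pi> a (A + B) = pure_tensor \<pi> a A + pure_tensor \<pi> a B"
  by (rule poly_mapping_eqI)
    (use assms in \<open>auto simp: lookup_pure_tensor lookup_add hom_simps weyl_carrier_iff distrib_left\<close>)

lemma pure_tensor_balanced:
  assumes "A \<in> carrier (weyl_algebra n c)" "r \<in> carrier (mpoly_ring {1..n})"
  shows "pure_tensor \<pi> (a * \<pi> r) A = pure_tensor \<pi> a (weyl_coeff r \<otimes>\<^bsub>weyl_algebra n c\<^esub> A)"
proof -
  have "weyl_coeff r \<otimes>\<^bsub>weyl_algebra n c\<^esub> A = weyl_coeff r * A"
    by (simp add: weyl_simps weyl_coeff_def wm_single[of 0 r A])
  then show ?thesis
    by (intro poly_mapping_eqI)
      (use assms in \<open>auto simp: lookup_pure_tensor hom_simps weyl_carrier_iff lookup_wc mult.assoc\<close>)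
qed

lemma weyl_noether_generated:
  assumes "w \<in> weyl_noether_module c"
  shows "w = (\<Sum>\<beta>\<in>keys w. pure_tensor \<pi> (lookup w \<beta>) (weyl_partial \<beta>))"
proof -
  have "pure_tensor \<pi> a (weyl_partial \<beta>) = single \<beta> a" for a \<beta>
    by (simp add: pure_tensor_def weyl_partial_def hom_simps)
  then show ?thesis by (simp flip: poly_mapping_sum_monomials)
qed

text \<open>Every \<open>R\<close>-balanced biadditive map on \<open>\<F> \<times> D\<close> factors through \<^const>\<open>pure_tensor\<close>.\<close>

lemma weyl_noether_universal:
  fixes B :: "'f \<Rightarrow> 'k weyl_op \<Rightarrow> 'g::ab_group_add"
  assumes "\<And>a b A. A \<in> carrier (weyl_algebra n c) \<Longrightarrow> B (a + b) A = B a A + B b A"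
    and "\<And>a A A'. A \<in> carrier (weyl_algebra n c) \<Longrightarrow> A' \<in> carrier (weyl_algebra n c) \<Longrightarrow>
           B a (A + A') = B a A + B a A'"
    and "\<And>a A r. A \<in> carrier (weyl_algebra n c) \<Longrightarrow> r \<in> carrier (mpoly_ring {1..n}) \<Longrightarrow>
           B (a * \<pi> r) A = B a (weyl_coeff r \<otimes>\<^bsub>weyl_algebra n c\<^esub> A)"
  shows "\<exists>h. (\<forall>v\<in>weyl_noether_module c. \<forall>w\<in>weyl_noether_module c. h (v + w) = h v + h w) \<and>
    (\<forall>a. \<forall>A\<in>carrier (weyl_algebra n c). h (pure_tensor \<pi> a A) = B a A)"
proof -
  have p: "(weyl_partial \<beta> :: 'k weyl_op) \<in> carrier (weyl_algebra n c)" if "keys \<beta> \<subseteq> {1..c}" for \<beta>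
    unfolding weyl_partial_def using that by (rule weyl_single[OF _ mpoly_one])
  define g where "g \<beta> a = (if keys \<beta> \<subseteq> {1..c} then B a (weyl_partial \<beta>) else 0)" for \<beta> a
  have B0: "B 0 A = 0" if "A \<in> carrier (weyl_algebra n c)" for A
    using assms(1)[of A 0 0] that by simp
  have B0': "B a 0 = 0" for a
    using assms(2)[OF weyl_zero weyl_zero, of a] by simp
  have g: "g \<beta> (a + b) = g \<beta> a + g \<beta> b" "g \<beta> 0 = 0" for \<beta> a b
    using p assms(1) B0 by (auto simp: g_def)
  define h where "h w = (\<Sum>\<beta>\<in>keys w. g \<beta> (lookup w \<beta>))" for w
  have h_add: "h (v + w) = h v + h w" for v w
    unfolding h_def by (rule keys_sum_add) (simp_all add: g)
  have h_single: "h (single \<beta> a) = g \<beta> a" for \<beta> a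
    unfolding h_def by (rule keys_sum_single) (simp add: g)
  have h_sum: "h (sum f S) = (\<Sum>i\<in>S. h (f i))" for f and S :: "mon set"
    by (induction S rule: infinite_finite_induct) (simp_all add: h_add, simp_all add: h_def)
  have "h (pure_tensor \<pi> a A) = B a A" if A: "A \<in> carrier (weyl_algebra n c)" for a A
  proof -
    have s: "B a (\<Sum>i\<in>S. f i) = (\<Sum>i\<in>S. B a (f i))" if "\<And>i. i \<in> S \<Longrightarrow> f i \<in> carrier (weyl_algebra n c)"
      for f and S :: "mon set"
      using that by (induction S rule: infinite_finite_induct) (auto simp: B0' assms(2) weyl_sum)
    have "h (pure_tensor \<pi> a A) = (\<Sum>\<beta>\<in>keys A. g \<beta> (a * \<pi> (lookup A \<beta>)))"
      by (simp add: pure_tensor_def h_sum h_single)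
    also have "\<dots> = (\<Sum>\<beta>\<in>keys A. B a (single \<beta> (lookup A \<beta>)))"
    proof (rule sum.cong, goal_cases)
      case (2 \<beta>)
      with A have k: "keys \<beta> \<subseteq> {1..c}" "lookup A \<beta> \<in> carrier (mpoly_ring {1..n})" by (auto simp: weyl_simps)
      have "weyl_coeff (lookup A \<beta>) \<otimes>\<^bsub>weyl_algebra n c\<^esub> weyl_partial \<beta> = single \<beta> (lookup A \<beta>)"
        by (simp add: weyl_simps weyl_coeff_def weyl_partial_def wm_single mult_single)
      with assms(3)[OF p[OF k(1)] k(2)] k(1) show ?case by (simp add: g_def)
    qed simp
    also have "\<dots> = B a (\<Sum>\<beta>\<in>keys A. single \<beta> (lookup A \<beta>))"
      by (rule s[symmetric]) (use A in \<open>auto intro!: weyl_single simp: weyl_simps\<close>)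
    finally show ?thesis by (simp add: poly_mapping_sum_monomials)
  qed
  with h_add show ?thesis by blast
qed

end

lemma mi_mpderiv_add: "multi_iter mpderiv \<alpha> (f + g) = multi_iter mpderiv \<alpha> f + multi_iter mpderiv \<alpha> g"
  by (induction \<alpha> rule: mon_induct) (simp_all add: multi_iter_plus mpderiv_commute mpderiv_add del: One_nat_def)
lemma mi_mpderiv_zero: "multi_iter mpderiv \<alpha> 0 = 0"
  by (induction \<alpha> rule: mon_induct) (simp_all add: multi_iter_plus mpderiv_commute del: One_nat_def)
lemma mi_mpderiv_single: "\<exists>k. multi_iter mpderiv \<alpha> (single \<beta> b) = single (\<beta> - \<alpha>) k \<and> ((\<exists>i. lookup \<alpha> i > lookup \<beta> i) \<longrightarrow> k = 0)"
proof (induction \<alpha> rule: mon_induct)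
  case (plus \<alpha> i)
  then obtain k where k: "multi_iter mpderiv \<alpha> (single \<beta> b) = single (\<beta> - \<alpha>) k" "((\<exists>i. lookup \<alpha> i > lookup \<beta> i) \<longrightarrow> k = 0)" by blast
  have d: "\<beta> - \<alpha> - single i 1 = \<beta> - (\<alpha> + single i 1)" by (simp add: diff_diff_eq)
  show ?case
    by (rule exI[of _ "of_nat (lookup \<beta> i - lookup \<alpha> i) * k"])
      (use k d in \<open>auto simp: multi_iter_plus mpderiv_commute mpderiv_single lookup_minus lookup_add lookup_single when_def simp del: One_nat_def split: if_splits\<close>)
qed auto

lemma finite_nonzero_derivs: "finite {\<alpha>. multi_iter mpderiv \<alpha> F \<noteq> 0}"
proof (induction F rule: pm_induct)
  case (single \<beta> b)
  have "{\<alpha>. multi_iter mpderiv \<alpha> (single \<beta> b) \<noteq> 0} \<subseteq> fst ` {(\<alpha>, \<delta>). \<alpha> + \<delta> = \<beta>}"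
  proof
    fix \<alpha> assume "\<alpha> \<in> {\<alpha>. multi_iter mpderiv \<alpha> (single \<beta> b) \<noteq> 0}"
    with mi_mpderiv_single[of \<alpha> \<beta> b] have "\<And>i. lookup \<alpha> i \<le> lookup \<beta> i" by (metis single_zero mem_Collect_eq not_less)
    then have "\<alpha> + (\<beta> - \<alpha>) = \<beta>" by (intro poly_mapping_eqI) (simp add: lookup_add lookup_minus)
    then show "\<alpha> \<in> fst ` {(\<alpha>, \<delta>). \<alpha> + \<delta> = \<beta>}" by force
  qed
  then show ?case using finite_mon_decomp finite_subset by blast
next
  case (add p q)
  have "{\<alpha>. multi_iter mpderiv \<alpha> (p + q) \<noteq> 0} \<subseteq> {\<alpha>. multi_iter mpderiv \<alpha> p \<noteq> 0} \<union> {\<alpha>. multi_iter mpderiv \<alpha> q \<noteq> 0}"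
    by (auto simp: mi_mpderiv_add)
  with add show ?case by (meson finite_UnI finite_subset)
qed

end

theory Submission
  imports Defs
begin

text \<open>
  Write \<open>S = \<F>[y\<^sub>1, \<dots>, y\<^sub>c]\<close>, and let \<open>\<langle>y\<rangle>\<close> be the ideal generated by the variables, in \<open>S\<close> or in
  \<open>\<F>[[y]]\<close>. Each of the four sets consists of the members of length \<open>m\<close> of an ordered family: the
  ideals of \<open>\<F>[[y]]\<close> and of \<open>S\<close> that contain \<open>\<langle>y\<rangle>\<^sup>m\<close>, the ideals of \<open>R\<close> that contain \<open>P\<^sup>m\<close> and are
  saturated with respect to \<open>P\<close> (contracted from \<open>R\<^sub>P\<close>), and the spaces of polynomials of degree
  less than \<open>m\<close> that are closed under differentiation. Colength and multiplicity are lengths of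
  longest chains in these families, and so is the dimension of a space closed under
  differentiation, which has a full flag of subspaces of the same kind. It therefore suffices to
  give mutually inverse maps between the families that preserve or reverse inclusions. That
  an ideal of length \<open>m\<close> contains \<open>\<langle>y\<rangle>\<^sup>m\<close>, or \<open>P\<^sup>m\<close>, follows from a longest chain above it, as each
  step of the chain is annihilated by \<open>\<langle>y\<rangle>\<close>, or by \<open>P\<close> (\<open>power_subset_if_chain_length\<close>).

  Power series and polynomials are compared by truncation. For inverse systems, \<open>\<F>[[y]]\<close> is the
  full dual of \<open>\<F>[z]\<close> under the pairing \<open>\<langle>f, F\<rangle> = \<Sum>\<^sub>\<alpha> \<alpha>! f\<^sub>\<alpha> F\<^sub>\<alpha>\<close>, the constant term of \<open>f \<bullet> F\<close>; for
  ideals and for spaces closed under differentiation, annihilation by the action is the same as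
  orthogonality, so the correspondence is that of orthogonal complements
  (\<open>macaulay_duality\<close>).

  The map \<open>\<gamma>\<close> identifies \<open>R\<^sub>P/P\<^sup>mR\<^sub>P\<close> with \<open>S/\<langle>y\<rangle>\<^sup>m\<close>. Let \<open>p\<^sub>i \<in> P\<close> be a non-zero polynomial in \<open>x\<^sub>i\<close> and the
  independent variables, of least degree in \<open>x\<^sub>i\<close>. As \<open>\<partial>p\<^sub>i/\<partial>x\<^sub>i \<notin> P\<close> in characteristic zero,
  \<open>\<gamma>(p\<^sub>i) = y\<^sub>i h\<^sub>i\<close> with \<open>h\<^sub>i(0) \<noteq> 0\<close> (\<open>local_parameter\<close>). Hence fractions of elements of \<open>\<gamma>(R)\<close>
  approximate every polynomial modulo \<open>\<langle>y\<rangle>\<^sup>m\<close> (\<open>approx\<close>), which gives surjectivity, and \<open>\<langle>y\<rangle>\<^sup>m\<close> lies in the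
  saturation of \<open>\<gamma>(P\<^sup>m)S\<close>. Injectivity is then a descent statement (\<open>descent\<close>): if
  \<open>H \<gamma>(f) \<in> \<gamma>(J)S\<close> with \<open>H(0) \<noteq> 0\<close> and \<open>J\<close> saturated, then \<open>f \<in> J\<close>. Since \<open>S\<close> is the \<open>\<F>\<close>-span
  of \<open>\<gamma>(R)\<close>, it suffices to expand the finitely many coefficients in such a relation in a family that is
  linearly independent over \<open>K[x\<^sub>c\<^sub>+\<^sub>1, \<dots>, x\<^sub>n]\<close>: comparing coordinates gives relations \<open>w f \<in> J\<close> in \<open>R\<close>,
  and \<open>w \<notin> P\<close> for one of them.

  With the monomial bases as coordinates, \<open>\<omega>\<close> is the identity. Taylor's formula says that \<open>\<alpha>!\<close> times
  the coefficient of \<open>y\<^sup>\<alpha>\<close> in \<open>\<gamma>(f)\<close> is the class of \<open>\<partial>\<^sup>\<alpha>f\<close>; so the class of \<open>A \<bullet> f\<close> is the pairing of \<open>\<gamma>(f)\<close>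
  with \<open>1 \<otimes> A\<close> (\<open>pi_weyl_act\<close>). This identifies right multiplication by \<open>r\<close> with the
  action of \<open>\<gamma>(r)\<close> by differentiation, so that sub-bimodules are the spaces closed
  under differentiation, and it turns the description of \<open>Q\<close> by Noetherian operators into
  orthogonality to a basis of \<open>V\<close>.
\<close>

section \<open>Lengths of chains\<close>

definition chain_length :: "'a set set \<Rightarrow> enat" where
  "chain_length C = Sup {enat k | k. \<exists>J :: nat \<Rightarrow> 'a set.
     (\<forall>i\<le>k. J i \<in> C) \<and> (\<forall>i<k. J i \<subset> J (Suc i))}"

lemma chain_length_ge:
  assumes "\<forall>i\<le>k. J i \<in> C" "\<forall>i<k. J i \<subset> J (Suc i)"
  shows "enat k \<le> chain_length C"
  unfolding chain_length_def by (rule Sup_upper) (use assms in blast)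

lemma chain_length_leI:
  assumes "\<And>k J. \<forall>i\<le>k. J i \<in> C \<Longrightarrow> \<forall>i<k. J i \<subset> J (Suc i) \<Longrightarrow> enat k \<le> l"
  shows "chain_length C \<le> l"
  unfolding chain_length_def by (rule Sup_least) (use assms in blast)

lemma chain_length_mono:
  assumes "f ` C \<subseteq> D" "\<And>A B. A \<in> C \<Longrightarrow> B \<in> C \<Longrightarrow> A \<subset> B \<Longrightarrow> f A \<subset> f B"
  shows "chain_length C \<le> chain_length D"
proof (rule chain_length_leI)
  fix k :: nat and J assume J: "\<forall>i\<le>k. J i \<in> C" "\<forall>i<k. J i \<subset> J (Suc i)"
  show "enat k \<le> chain_length D"
    by (rule chain_length_ge[of _ "\<lambda>i. f (J i)"]) (use J assms in auto)
qed

lemma chain_length_antimono: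
  assumes "f ` C \<subseteq> D" "\<And>A B. A \<in> C \<Longrightarrow> B \<in> C \<Longrightarrow> A \<subset> B \<Longrightarrow> f B \<subset> f A"
  shows "chain_length C \<le> chain_length D"
proof (rule chain_length_leI)
  fix k :: nat and J assume J: "\<forall>i\<le>k. J i \<in> C" "\<forall>i<k. J i \<subset> J (Suc i)"
  show "enat k \<le> chain_length D"
  proof (rule chain_length_ge[of _ "\<lambda>i. f (J (k - i))"]; intro allI impI)
    fix i assume "i < k"
    then have "J (k - Suc i) \<subset> J (Suc (k - Suc i))" "J (k - Suc i) \<in> C" "J (k - i) \<in> C" using J by auto
    moreover have "Suc (k - Suc i) = k - i" using \<open>i < k\<close> by simp
    ultimately show "f (J (k - i)) \<subset> f (J (k - Suc i))" using assms(2) by metis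
  qed (use J assms(1) in auto)
qed

lemma chain_length_eq:
  assumes inv: "mutually_inverse f g C D"
    and f: "\<And>A B. A \<in> C \<Longrightarrow> B \<in> C \<Longrightarrow> A \<subseteq> B \<Longrightarrow> f A \<subseteq> f B"
    and g: "\<And>A B. A \<in> D \<Longrightarrow> B \<in> D \<Longrightarrow> A \<subseteq> B \<Longrightarrow> g A \<subseteq> g B"
  shows "chain_length C = chain_length D"
proof (rule antisym; rule chain_length_mono)
  show "f ` C \<subseteq> D" "g ` D \<subseteq> C" using inv by (auto simp: mutually_inverse_def)
  show "f A \<subset> f B" if "A \<in> C" "B \<in> C" "A \<subset> B" for A B
    using that f inv unfolding mutually_inverse_def by (metis psubsetE psubsetI)
  show "g A \<subset> g B" if "A \<in> D" "B \<in> D" "A \<subset> B" for A B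
    using that g inv unfolding mutually_inverse_def by (metis psubsetE psubsetI)
qed

lemma chain_length_eq_anti:
  assumes inv: "mutually_inverse f g C D"
    and f: "\<And>A B. A \<in> C \<Longrightarrow> B \<in> C \<Longrightarrow> A \<subseteq> B \<Longrightarrow> f B \<subseteq> f A"
    and g: "\<And>A B. A \<in> D \<Longrightarrow> B \<in> D \<Longrightarrow> A \<subseteq> B \<Longrightarrow> g B \<subseteq> g A"
  shows "chain_length C = chain_length D"
proof (rule antisym; rule chain_length_antimono)
  show "f ` C \<subseteq> D" "g ` D \<subseteq> C" using inv by (auto simp: mutually_inverse_def)
  show "f B \<subset> f A" if "A \<in> C" "B \<in> C" "A \<subset> B" for A B
    using that f inv unfolding mutually_inverse_def by (metis psubsetE psubsetI)
  show "g B \<subset> g A" if "A \<in> D" "B \<in> D" "A \<subset> B" for A B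
    using that g inv unfolding mutually_inverse_def by (metis psubsetE psubsetI)
qed

lemma mutually_inverse_above:
  assumes "mutually_inverse f g C D" "A \<in> C"
    and "\<And>A B. A \<in> C \<Longrightarrow> B \<in> C \<Longrightarrow> A \<subseteq> B \<Longrightarrow> f A \<subseteq> f B"
    and "\<And>A B. A \<in> D \<Longrightarrow> B \<in> D \<Longrightarrow> A \<subseteq> B \<Longrightarrow> g A \<subseteq> g B"
  shows "mutually_inverse f g {B \<in> C. A \<subseteq> B} {B \<in> D. f A \<subseteq> B}"
  unfolding mutually_inverse_def
proof (intro conjI)
  show "f ` {B \<in> C. A \<subseteq> B} \<subseteq> {B \<in> D. f A \<subseteq> B}"
    using assms unfolding mutually_inverse_def by auto
  show "g ` {B \<in> D. f A \<subseteq> B} \<subseteq> {B \<in> C. A \<subseteq> B}"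
  proof clarify
    fix B assume B: "B \<in> D" "f A \<subseteq> B"
    have "f A \<in> D" "g (f A) = A" "g B \<in> C" using assms(1,2) B unfolding mutually_inverse_def by auto
    then show "g B \<in> C \<and> A \<subseteq> g B" using assms(4)[of "f A" B] B by simp
  qed
qed (use assms(1) in \<open>auto simp: mutually_inverse_def\<close>)

lemma chain_length_above_eq:
  assumes "mutually_inverse f g C D" "A \<in> C"
    and "\<And>A B. A \<in> C \<Longrightarrow> B \<in> C \<Longrightarrow> A \<subseteq> B \<Longrightarrow> f A \<subseteq> f B"
    and "\<And>A B. A \<in> D \<Longrightarrow> B \<in> D \<Longrightarrow> A \<subseteq> B \<Longrightarrow> g A \<subseteq> g B"
  shows "chain_length {B \<in> C. A \<subseteq> B} = chain_length {B \<in> D. f A \<subseteq> B}"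
  by (rule chain_length_eq[OF mutually_inverse_above[OF assms(1,2)]]) (use assms(3,4) in auto)

lemma chain_length_attained:
  assumes "chain_length C = enat m" "A \<in> C"
  obtains J where "\<forall>i\<le>m. J i \<in> C" "\<forall>i<m. J i \<subset> J (Suc i)"
proof -
  let ?S = "{enat k | k. \<exists>J :: nat \<Rightarrow> 'a set. (\<forall>i\<le>k. J i \<in> C) \<and> (\<forall>i<k. J i \<subset> J (Suc i))}"
  have "enat 0 \<in> ?S" using assms(2) by (auto intro!: exI[of _ "\<lambda>_. A"])
  then have ne: "?S \<noteq> {}" by blast
  have "?S \<subseteq> {..enat m}" using assms(1) unfolding chain_length_def by (metis (no_types, lifting) Sup_upper atMost_iff subsetI)
  moreover have "finite {..enat m}" by (rule finite_enat_bounded[of _ m]) auto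
  ultimately have "finite ?S" by (rule finite_subset)
  moreover have "Sup S \<in> S" if "finite S" "S \<noteq> {}" for S :: "enat set"
    using that by (simp add: Sup_enat_def)
  ultimately have "Sup ?S \<in> ?S" using ne by blast
  then have "enat m \<in> ?S" using assms(1) by (simp add: chain_length_def)
  then show ?thesis using that by auto
qed

text \<open>If \<open>A\<close> were the top element, every chain above \<open>A\<close> would be trivial.\<close>

lemma chain_length_proper:
  assumes "chain_length {B \<in> C. A \<subseteq> B} = enat m" "m \<ge> 1" "\<And>B. B \<in> C \<Longrightarrow> B \<subseteq> T"
  shows "A \<noteq> T"
proof
  assume "A = T"
  have "k = 0" if J: "\<forall>i\<le>k. J i \<in> {B \<in> C. A \<subseteq> B}" "\<forall>i<k. J i \<subset> J (Suc i)" for k :: nat and J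
  proof (rule ccontr)
    assume "k \<noteq> 0"
    then have "J 0 \<subset> J (Suc 0)" "A \<subseteq> J 0" "J (Suc 0) \<subseteq> T" using J assms(3) by auto
    then show False using \<open>A = T\<close> by blast
  qed
  then have "chain_length {B \<in> C. A \<subseteq> B} \<le> 0" by (intro chain_length_leI) (metis zero_enat_def order_refl)
  then show False using assms by (simp add: zero_enat_def)
qed

lemma ring_length_eq: "ring_length A = chain_length {J. ideal J A}"
  by (simp add: ring_length_def chain_length_def)

lemma (in ring) ring_length_quotient:
  assumes I: "ideal I R"
  shows "ring_length (R Quot I) = chain_length {J. ideal J R \<and> I \<subseteq> J}"
proof -
  have bij: "bij_betw (\<lambda>J. (+>) I ` J) {J. ideal J R \<and> I \<subseteq> J} {J. ideal J (R Quot I)}"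
    by (rule quot_ideal_correspondence[OF I])
  have UN: "\<Union> ((+>) I ` J) = J" if "ideal J R" "I \<subseteq> J" for J
    using ideal_incl_iff[OF I that(1)] that(2) by simp
  have "mutually_inverse (\<lambda>J. (+>) I ` J) Union {J. ideal J R \<and> I \<subseteq> J} {J. ideal J (R Quot I)}"
    unfolding mutually_inverse_def
  proof (intro conjI)
    show *: "(\<lambda>J. (+>) I ` J) ` {J. ideal J R \<and> I \<subseteq> J} \<subseteq> {J. ideal J (R Quot I)}"
      using bij by (auto simp: bij_betw_def)
    show "\<forall>J\<in>{J. ideal J R \<and> I \<subseteq> J}. \<Union> ((+>) I ` J) = J" using UN by auto
    have B: "\<exists>J. ideal J R \<and> I \<subseteq> J \<and> B = (+>) I ` J" if "ideal B (R Quot I)" for B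
    proof -
      have "B \<in> (\<lambda>J. (+>) I ` J) ` {J. ideal J R \<and> I \<subseteq> J}"
        using that bij by (simp add: bij_betw_def)
      then show ?thesis by blast
    qed
    show "Union ` {J. ideal J (R Quot I)} \<subseteq> {J. ideal J R \<and> I \<subseteq> J}"
    proof clarify
      fix B assume "ideal B (R Quot I)"
      then obtain J where "ideal J R" "I \<subseteq> J" "B = (+>) I ` J" using B by blast
      then show "ideal (\<Union> B) R \<and> I \<subseteq> \<Union> B" using UN by simp
    qed
    show "\<forall>B\<in>{J. ideal J (R Quot I)}. (+>) I ` \<Union> B = B"
    proof clarify
      fix B assume "ideal B (R Quot I)"
      then obtain J where J: "ideal J R" "I \<subseteq> J" "B = (+>) I ` J" using B by blast
      then have "\<Union> B = J" using UN by simp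
      with J(3) show "(+>) I ` \<Union> B = B" by simp
    qed
  qed
  then show ?thesis unfolding ring_length_eq by (intro chain_length_eq[symmetric]) auto
qed

section \<open>Saturated ideals\<close>

text \<open>For a prime ideal \<open>P\<close>, these are the ideals contracted from the localization at \<open>P\<close>.\<close>

definition saturated_ideals :: "('a, 'b) ring_scheme \<Rightarrow> 'a set \<Rightarrow> 'a set set" where
  "saturated_ideals A P = {J. ideal J A \<and>
     (\<forall>s\<in>carrier A - P. \<forall>a\<in>carrier A. s \<otimes>\<^bsub>A\<^esub> a \<in> J \<longrightarrow> a \<in> J)}"

context cring begin

lemma ideal_iff:
  "ideal J R \<longleftrightarrow> J \<subseteq> carrier R \<and> \<zero> \<in> J \<and> (\<forall>a\<in>J. \<forall>b\<in>J. a \<oplus> b \<in> J) \<and>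
     (\<forall>r\<in>carrier R. \<forall>a\<in>J. r \<otimes> a \<in> J)"
  (is "_ = ?rhs")
proof
  assume "ideal J R"
  then interpret J: ideal J R .
  show ?rhs using J.a_subset J.I_l_closed by auto
next
  assume J: ?rhs
  show "ideal J R"
  proof (rule idealI)
    show "subgroup J (add_monoid R)"
    proof (rule subgroup.intro)
      show "J \<subseteq> carrier (add_monoid R)" "\<one>\<^bsub>add_monoid R\<^esub> \<in> J"
        "\<And>x y. x \<in> J \<Longrightarrow> y \<in> J \<Longrightarrow> x \<otimes>\<^bsub>add_monoid R\<^esub> y \<in> J" using J by auto
      show "inv\<^bsub>add_monoid R\<^esub> x \<in> J" if "x \<in> J" for x
      proof -
        have "\<ominus> x = (\<ominus> \<one>) \<otimes> x" using J that by (simp add: subset_iff l_minus)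
        then show ?thesis using J that by (metis a_inv_def a_inv_closed one_closed)
      qed
    qed
    show "x \<otimes> a \<in> J" "a \<otimes> x \<in> J" if "a \<in> J" "x \<in> carrier R" for a x
      using J that by (auto simp: m_comm subset_iff)
  qed (rule ring_axioms)
qed

lemma saturation_ideal:
  assumes P: "primeideal P R" and J: "ideal J R"
  shows "{a \<in> carrier R. \<exists>s\<in>carrier R - P. s \<otimes> a \<in> J} \<in> saturated_ideals R P" (is "?S \<in> _")
proof -
  interpret P: primeideal P R by fact
  interpret J: ideal J R by fact
  have mult: "s \<otimes> t \<in> carrier R - P" if "s \<in> carrier R - P" "t \<in> carrier R - P" for s t
    using that P.I_prime by auto
  have one: "\<one> \<in> carrier R - P" using P.I_notcarr P.one_imp_carrier by auto
  have "ideal ?S R" unfolding ideal_iff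
  proof (intro conjI ballI)
    show "\<zero> \<in> ?S" using one by auto
    fix a b assume "a \<in> ?S" "b \<in> ?S"
    then obtain s t where st: "a \<in> carrier R" "b \<in> carrier R" "s \<in> carrier R - P" "t \<in> carrier R - P" "s \<otimes> a \<in> J" "t \<otimes> b \<in> J"
      by auto
    have "s \<otimes> t \<otimes> (a \<oplus> b) = t \<otimes> (s \<otimes> a) \<oplus> s \<otimes> (t \<otimes> b)"
      using st by (auto simp: r_distr m_ac)
    also have "\<dots> \<in> J" using st by (auto intro: J.I_l_closed)
    finally show "a \<oplus> b \<in> ?S" using mult[of s t] st by auto
  next
    fix r a assume r: "r \<in> carrier R" "a \<in> ?S"
    then obtain s where s: "a \<in> carrier R" "s \<in> carrier R - P" "s \<otimes> a \<in> J" by auto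
    have "s \<otimes> (r \<otimes> a) = r \<otimes> (s \<otimes> a)" using s r by (auto simp: m_ac)
    also have "\<dots> \<in> J" using s r by (auto intro: J.I_l_closed)
    finally show "r \<otimes> a \<in> ?S" using r s by auto
  qed auto
  moreover have "a \<in> ?S" if "s \<in> carrier R - P" "a \<in> carrier R" "s \<otimes> a \<in> ?S" for s a
  proof -
    from that obtain t where "t \<in> carrier R - P" "t \<otimes> (s \<otimes> a) \<in> J" by auto
    moreover have "t \<otimes> (s \<otimes> a) = t \<otimes> s \<otimes> a" using calculation that by (simp add: m_assoc)
    ultimately show ?thesis using mult[of t s] that by auto
  qed
  ultimately show ?thesis by (auto simp: saturated_ideals_def)
qed

lemma ideal_power_ideal: "ideal J R \<Longrightarrow> ideal (J [^]\<^bsub>ideals_set R\<^esub> (k::nat)) R"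
proof -
  interpret I: monoid "ideals_set R" using ideals_set_is_comm_monoid by (rule comm_monoid.axioms)
  show "ideal J R \<Longrightarrow> ideal (J [^]\<^bsub>ideals_set R\<^esub> (k::nat)) R"
    using I.nat_pow_closed[of J k] by (simp add: ideals_set_def)
qed

lemma ideal_power_0: "J [^]\<^bsub>ideals_set R\<^esub> (0::nat) = carrier R"
  by (simp add: ideals_set_def nat_pow_def)

lemma ideal_power_Suc: "J [^]\<^bsub>ideals_set R\<^esub> Suc k = ideal_prod R (J [^]\<^bsub>ideals_set R\<^esub> k) J"
  by (simp add: ideals_set_def nat_pow_def)

lemma ideal_prod_subset:
  assumes "ideal K R" "\<And>i j. i \<in> I \<Longrightarrow> j \<in> J \<Longrightarrow> i \<otimes> j \<in> K"
  shows "ideal_prod R I J \<subseteq> K"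
proof
  fix x assume "x \<in> ideal_prod R I J"
  then show "x \<in> K"
    by induction (use assms in \<open>auto intro: additive_subgroup.a_closed[OF ideal.axioms(1)]\<close>)
qed

text \<open>A longest chain \<open>Q = J\<^sub>0 \<subset> \<dots> \<subset> J\<^sub>m = R\<close> cannot be refined, which forces \<open>P J\<^sub>i\<^sub>+\<^sub>1 \<subseteq> J\<^sub>i\<close>: if \<open>a p \<notin> J\<^sub>i\<close>,
  then the saturation of \<open>J\<^sub>i + (a p)\<close> is all of \<open>J\<^sub>i\<^sub>+\<^sub>1\<close>, so \<open>s a = j + r a p\<close> with \<open>s \<notin> P\<close>, and
  \<open>(s - r p) a \<in> J\<^sub>i\<close> gives \<open>a \<in> J\<^sub>i\<close>.\<close>

lemma power_subset_if_chain_length: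
  assumes "chain_length {J \<in> saturated_ideals R P. Q \<subseteq> J} = enat m"
    and P: "primeideal P R" and Q: "Q \<in> saturated_ideals R P"
  shows "P [^]\<^bsub>ideals_set R\<^esub> m \<subseteq> Q"
proof -
  interpret P: primeideal P R by fact
  let ?C = "{J \<in> saturated_ideals R P. Q \<subseteq> J}"
  have no: False if "\<forall>i\<le>Suc m. J i \<in> ?C" "\<forall>i<Suc m. J i \<subset> J (Suc i)" for J
    using chain_length_ge[OF that] assms(1) by simp
  obtain J where J: "\<forall>i\<le>m. J i \<in> ?C" "\<forall>i<m. J i \<subset> J (Suc i)"
    by (rule chain_length_attained[OF assms(1), of Q]) (use Q in auto)
  have J': "J i \<in> saturated_ideals R P" "Q \<subseteq> J i" "ideal (J i) R" if "i \<le> m" for i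
    using J that by (auto simp: saturated_ideals_def)
  have "J 0 = Q"
  proof (rule ccontr)
    assume "J 0 \<noteq> Q"
    then have "Q \<subset> J 0" using J'(2)[of 0] by auto
    show False
    proof (rule no[of "\<lambda>i. if i = 0 then Q else J (i - 1)"]; intro allI impI)
      fix i assume "i < Suc m"
      then show "(if i = 0 then Q else J (i - 1)) \<subset> (if Suc i = 0 then Q else J (Suc i - 1))"
        using \<open>Q \<subset> J 0\<close> J(2) by (cases i) auto
    qed (use J(1) Q in auto)
  qed
  have "J m = carrier R"
  proof (rule ccontr)
    assume "J m \<noteq> carrier R"
    then have "J m \<subset> carrier R" using J'(3)[of m] unfolding ideal_iff by auto
    moreover have "carrier R \<in> saturated_ideals R P" by (auto simp: saturated_ideals_def oneideal)
    moreover have "Q \<subseteq> carrier R" using J'(2)[of m] calculation(1) by auto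
    ultimately show False using J
      by (intro no[of "\<lambda>i. if i \<le> m then J i else carrier R"]) (auto simp: less_Suc_eq le_Suc_eq)
  qed
  \<comment> \<open>A saturated ideal strictly between \<open>J\<^sub>i\<close> and \<open>J\<^sub>i\<^sub>+\<^sub>1\<close> would give a longer chain.\<close>
  have simple: "K = J (Suc i)" if "K \<in> saturated_ideals R P" "J i \<subset> K" "K \<subseteq> J (Suc i)" "i < m" for K i
  proof (rule ccontr)
    assume "K \<noteq> J (Suc i)"
    let ?J = "\<lambda>j. if j \<le> i then J j else if j = Suc i then K else J (j - 1)"
    show False
    proof (rule no[of ?J]; intro allI impI)
      have "Q \<subseteq> K" using J'(2)[of i] that by auto
      fix j assume "j \<le> Suc m" then show "?J j \<in> ?C" using J \<open>Q \<subseteq> K\<close> that by auto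
    next
      fix j assume j: "j < Suc m"
      consider "j < i" | "j = i" | "j = Suc i" | "j > Suc i" by linarith
      then show "?J j \<subset> ?J (Suc j)"
      proof cases
        case 4
        then have "j - 1 < m" "Suc (j - 1) = j" using j by auto
        then have "J (j - 1) \<subset> J j" using J(2) by metis
        with 4 show ?thesis by simp
      qed (use J that \<open>K \<noteq> J (Suc i)\<close> in auto)
    qed
  qed
  have step: "a \<otimes> p \<in> J i" if "i < m" "a \<in> J (Suc i)" "p \<in> P" for i a p
  proof (rule ccontr)
    assume np: "a \<otimes> p \<notin> J i"
    interpret I: ideal "J i" R using J'(3) that by simp
    interpret I': ideal "J (Suc i)" R using J'(3) that by simp
    have car: "a \<in> carrier R" "p \<in> carrier R" using that by auto
    let ?b = "a \<otimes> p"
    let ?L = "J i <+>\<^bsub>R\<^esub> (PIdl ?b)"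
    let ?K = "{x \<in> carrier R. \<exists>s\<in>carrier R - P. s \<otimes> x \<in> ?L}"
    have one: "\<one> \<in> carrier R - P" using P.I_notcarr P.one_imp_carrier by auto
    have L: "ideal ?L R" using car by (intro add_ideals cgenideal_ideal) (auto intro: I.is_ideal)
    have K: "?K \<in> saturated_ideals R P" by (rule saturation_ideal[OF P L])
    have Li: "J i \<subseteq> ?L"
    proof
      fix x assume x: "x \<in> J i"
      have "\<zero> \<otimes> ?b \<in> PIdl ?b" unfolding cgenideal_def by blast
      then have "x \<oplus> \<zero> \<otimes> ?b \<in> ?L" using x unfolding set_add_def' by blast
      then show "x \<in> ?L" using x car by simp
    qed
    have bL: "?b \<in> ?L"
    proof -
      have "?b \<in> PIdl ?b" using car by (simp add: cgenideal_self)
      moreover have "\<zero> \<in> J i" by (rule I.zero_closed)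
      ultimately have "\<zero> \<oplus> ?b \<in> ?L" unfolding set_add_def' by blast
      then show ?thesis using car by simp
    qed
    have LK: "?L \<subseteq> ?K" using one ideal.Icarr[OF L] by (auto intro!: bexI[of _ \<one>])
    have "J i \<subset> ?K" using Li bL LK np by blast
    moreover have "?K \<subseteq> J (Suc i)"
    proof
      have "?b \<in> J (Suc i)" using that car by (auto intro: I'.I_r_closed)
      then have "PIdl ?b \<subseteq> J (Suc i)" by (rule cgenideal_minimal[OF I'.is_ideal])
      moreover have "J i \<subseteq> J (Suc i)" using J(2) that by auto
      ultimately have LJ: "?L \<subseteq> J (Suc i)" unfolding set_add_def' by auto
      fix x assume "x \<in> ?K"
      then show "x \<in> J (Suc i)" using LJ J'(1)[of "Suc i"] that(1) unfolding saturated_ideals_def by auto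
    qed
    ultimately have "?K = J (Suc i)" using K that by (intro simple) auto
    then have "a \<in> ?K" using that(2) by (rule ssubst)
    then obtain s where s: "s \<in> carrier R - P" "s \<otimes> a \<in> ?L" by blast
    then obtain j r where jr: "j \<in> J i" "r \<in> carrier R" "s \<otimes> a = j \<oplus> r \<otimes> ?b"
      unfolding set_add_def' cgenideal_def by auto
    \<comment> \<open>\<open>s - r p\<close> lies outside \<open>P\<close> and multiplies \<open>a\<close> into \<open>J i\<close>.\<close>
    let ?t = "s \<ominus> r \<otimes> p"
    have tP: "?t \<notin> P"
    proof
      assume "?t \<in> P"
      then have "?t \<oplus> r \<otimes> p \<in> P" using that jr by (intro P.a_closed P.I_l_closed) auto
      then show False using s jr car by (simp add: minus_eq a_assoc l_neg)
    qed
    have "?t \<otimes> a = s \<otimes> a \<ominus> r \<otimes> ?b" using s(1) jr(2) car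
      by (simp add: minus_eq l_distr r_distr l_minus r_minus m_ac)
    also have "\<dots> = j" unfolding jr(3) using jr(1,2) car by (simp add: minus_eq a_assoc r_neg)
    finally have ta: "?t \<otimes> a \<in> J i" using jr(1) by simp
    have "?t \<in> carrier R - P" using tP s(1) jr(2) car(2) by simp
    moreover have "J i \<in> saturated_ideals R P" using J'(1) that(1) by simp
    ultimately have "a \<in> J i" using ta car(1) unfolding saturated_ideals_def by blast
    then show False using np that(3) car by (auto intro: I.I_r_closed)
  qed
  have "P [^]\<^bsub>ideals_set R\<^esub> k \<subseteq> J (m - k)" if "k \<le> m" for k
    using that
  proof (induction k)
    case 0 show ?case unfolding ideal_power_0 by (simp add: \<open>J m = carrier R\<close>)
  next
    case (Suc k)
    then have e: "m - k = Suc (m - Suc k)" by simp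
    show ?case unfolding ideal_power_Suc
      by (rule ideal_prod_subset) (use Suc e J'(3) step[of "m - Suc k"] in auto)
  qed
  from this[of m] show ?thesis by (simp add: \<open>J 0 = Q\<close>)
qed

lemma power_subset_if_colength:
  assumes "colength R I = enat m" and P: "primeideal P R" and I: "ideal I R"
    and sat: "\<And>J. ideal J R \<Longrightarrow> I \<subseteq> J \<Longrightarrow> J \<in> saturated_ideals R P"
  shows "P [^]\<^bsub>ideals_set R\<^esub> m \<subseteq> I"
proof (rule power_subset_if_chain_length[OF _ P sat[OF I order_refl]])
  have "{J \<in> saturated_ideals R P. I \<subseteq> J} = {J. ideal J R \<and> I \<subseteq> J}"
    using sat by (auto simp: saturated_ideals_def)
  then show "chain_length {J \<in> saturated_ideals R P. I \<subseteq> J} = enat m"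
    using assms(1) ring_length_quotient[OF I] by (simp add: colength_def)
qed

lemma colength_eq_chain_length:
  assumes "ideal I R" "K \<subseteq> I"
  shows "colength R I = chain_length {J \<in> {J. ideal J R \<and> K \<subseteq> J}. I \<subseteq> J}"
proof -
  have "{J \<in> {J. ideal J R \<and> K \<subseteq> J}. I \<subseteq> J} = {J. ideal J R \<and> I \<subseteq> J}"
    using assms(2) by auto
  then show ?thesis using ring_length_quotient[OF assms(1)] by (simp add: colength_def)
qed

text \<open>Saturation makes every element outside \<open>P\<close> a non-zero-divisor modulo \<open>J\<close>, and \<open>P\<^sup>m \<subseteq> J\<close> makes
  every element of \<open>P\<close> nilpotent modulo \<open>J\<close>.\<close>

lemma primary_to_if_saturated:
  assumes P: "primeideal P R" and J: "J \<in> saturated_ideals R P"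
    and pow: "P [^]\<^bsub>ideals_set R\<^esub> (m::nat) \<subseteq> J" and proper: "J \<noteq> carrier R"
  shows "primary_to R P J"
proof -
  interpret P: primeideal P R by fact
  have Ji: "ideal J R" and sat: "\<And>s a. s \<in> carrier R - P \<Longrightarrow> a \<in> carrier R \<Longrightarrow> s \<otimes> a \<in> J \<Longrightarrow> a \<in> J"
    using J by (auto simp: saturated_ideals_def)
  interpret J: ideal J R by (rule Ji)
  have one: "\<one> \<notin> P" using P.I_notcarr P.one_imp_carrier by auto
  have JP: "J \<subseteq> P"
  proof
    fix s assume s: "s \<in> J"
    show "s \<in> P"
    proof (rule ccontr)
      assume "s \<notin> P"
      then have "\<one> \<in> J" using sat[of s \<one>] s by simp
      then show False using J.one_imp_carrier proper by simp
    qed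
  qed
  have "a [^] (k::nat) \<in> P [^]\<^bsub>ideals_set R\<^esub> k" if a: "a \<in> P" for a k
  proof (induction k)
    case 0 show ?case unfolding ideal_power_0 by simp
  next
    case (Suc k)
    have "a [^] k \<otimes> a \<in> P [^]\<^bsub>ideals_set R\<^esub> Suc k"
      unfolding ideal_power_Suc by (rule ideal_prod.prod[OF Suc a])
    then show ?case by simp
  qed
  then have nil: "a [^] m \<in> J" if "a \<in> P" for a using that pow by blast
  have root: "a \<in> P" if a: "a \<in> carrier R" "a [^] (k::nat) \<in> P" for a k
    using a(2)
  proof (induction k)
    case (Suc k)
    then show ?case using P.I_prime[of "a [^] k" a] a(1) by auto
  qed (use one in simp)
  have "radical R J = P" unfolding radical_def
  proof (intro equalityI subsetI)
    fix a assume "a \<in> {a \<in> carrier R. \<exists>k::nat. a [^] k \<in> J}"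
    then show "a \<in> P" using root JP by blast
  qed (use nil P.Icarr in blast)
  moreover have "primary_ideal J R" unfolding primary_ideal_def
  proof (intro conjI ballI impI)
    fix a b assume ab: "a \<in> carrier R" "b \<in> carrier R" "a \<otimes> b \<in> J"
    show "a \<in> J \<or> (\<exists>k::nat. b [^] k \<in> J)"
    proof (cases "b \<in> P")
      case False
      have "b \<otimes> a \<in> J" using ab by (simp add: m_comm)
      then show ?thesis using sat ab False by blast
    qed (use nil in blast)
  qed (use Ji proper in auto)
  ultimately show ?thesis by (simp add: primary_to_def)
qed

end

section \<open>Polynomials and their orders\<close>

\<comment> \<open>The simplifier would rewrite \<open>{1..c}\<close> and \<open>single i 1\<close>, which occur in most statements.\<close>
declare One_nat_def [simp del]

lemma mpoly_ring_simps:
  "monoid.mult (mpoly_ring V) = (*)" "one (mpoly_ring V) = 1"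
  "ring.zero (mpoly_ring V) = 0" "add (mpoly_ring V) = (+)"
  by (simp_all add: mpoly_ring_def)

lemma mpoly_ring_pow: "x [^]\<^bsub>mpoly_ring V\<^esub> (k::nat) = x ^ k"
  by (induction k) (simp_all add: nat_pow_def mpoly_ring_simps mult.commute)

lemma mpoly_power: "p \<in> carrier (mpoly_ring V) \<Longrightarrow> p ^ k \<in> carrier (mpoly_ring V)"
  by (induction k) (auto intro: mpoly_mult mpoly_one)

lemma mpoly_diff: "p \<in> carrier (mpoly_ring V) \<Longrightarrow> q \<in> carrier (mpoly_ring V) \<Longrightarrow> p - q \<in> carrier (mpoly_ring V)"
  using mpoly_add[OF _ mpoly_uminus, of p V q] by simp

lemma mpoly_single: "keys \<alpha> \<subseteq> V \<Longrightarrow> single \<alpha> a \<in> carrier (mpoly_ring V)"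
  by (auto simp: carrier_mpoly_ring)

lemma mpoly_mconst: "mconst a \<in> carrier (mpoly_ring V)"
  unfolding mconst_def by (rule mpoly_single) simp

lemma mpoly_mvar: "i \<in> V \<Longrightarrow> mvar i \<in> carrier (mpoly_ring V)"
  unfolding mvar_def by (rule mpoly_single) simp

lemma mpoly_carrier_iff:
  "p \<in> carrier (mpoly_ring V) \<longleftrightarrow> (\<forall>\<alpha>. lookup p \<alpha> \<noteq> 0 \<longrightarrow> keys \<alpha> \<subseteq> V)"
  by (auto simp: carrier_mpoly_ring in_keys_iff)

lemma mconst_simps:
  "mconst (a + b) = mconst a + mconst b" "mconst (a * b) = mconst a * mconst b"
  "mconst 0 = 0" "mconst 1 = 1"
  by (simp_all add: mconst_def single_add mult_single)

lemma lookup_mconst_mult: "lookup (mconst a * p) \<alpha> = a * lookup p \<alpha>"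
  by (induction p rule: pm_induct)
    (simp_all add: mconst_def mult_single lookup_single when_def lookup_add distrib_left)

lemma lookup_mscale: "lookup (mscale a p) \<alpha> = a * lookup p \<alpha>"
  by (simp add: mscale_def lookup_mconst_mult)

lemma mpoly_mscale: "p \<in> carrier (mpoly_ring V) \<Longrightarrow> mscale a p \<in> carrier (mpoly_ring V)"
  unfolding mscale_def by (rule mpoly_mult[OF mpoly_mconst])

text \<open>Unlike \<open>pm_induct\<close>, this rule stays inside the carrier.\<close>

lemma mpoly_induct [consumes 1, case_names zero add]:
  assumes "p \<in> carrier (mpoly_ring V)" "Q 0"
    and "\<And>\<alpha> a p. keys \<alpha> \<subseteq> V \<Longrightarrow> p \<in> carrier (mpoly_ring V) \<Longrightarrow> Q p \<Longrightarrow> Q (single \<alpha> a + p)"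
  shows "Q p"
proof -
  have "Q (\<Sum>\<alpha>\<in>S. single \<alpha> (lookup p \<alpha>))" if "finite S" "S \<subseteq> keys p" for S
    using that
  proof (induction S rule: finite_induct)
    case (insert \<alpha> S)
    have "keys \<beta> \<subseteq> V" if "\<beta> \<in> insert \<alpha> S" for \<beta>
      using that insert.prems assms(1) unfolding carrier_mpoly_ring by blast
    then have "keys \<alpha> \<subseteq> V" "(\<Sum>\<alpha>\<in>S. single \<alpha> (lookup p \<alpha>)) \<in> carrier (mpoly_ring V)"
      by (auto intro!: mpoly_sum mpoly_single)
    then show ?case using assms(3) insert by simp
  qed (simp add: assms(2))
  from this[of "keys p"] show ?thesis by (simp add: poly_mapping_sum_monomials)
qed

lemma ideal_mpoly_iff:
  "ideal J (mpoly_ring V) \<longleftrightarrow> J \<subseteq> carrier (mpoly_ring V) \<and> 0 \<in> J \<and> (\<forall>a\<in>J. \<forall>b\<in>J. a + b \<in> J) \<and>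
     (\<forall>r\<in>carrier (mpoly_ring V). \<forall>a\<in>J. r * a \<in> J)"
  by (simp add: cring.ideal_iff[OF cring_mpoly_ring] mpoly_ring_simps)

lemma ideal_mpolyD:
  assumes "ideal J (mpoly_ring V)"
  shows "a \<in> J \<Longrightarrow> a \<in> carrier (mpoly_ring V)" "0 \<in> J" "a \<in> J \<Longrightarrow> b \<in> J \<Longrightarrow> a + b \<in> J"
    "r \<in> carrier (mpoly_ring V) \<Longrightarrow> a \<in> J \<Longrightarrow> r * a \<in> J"
    "r \<in> carrier (mpoly_ring V) \<Longrightarrow> a \<in> J \<Longrightarrow> a * r \<in> J"
    "a \<in> J \<Longrightarrow> b \<in> J \<Longrightarrow> a - b \<in> J"
proof -
  show *: "a \<in> J \<Longrightarrow> a \<in> carrier (mpoly_ring V)" "0 \<in> J" "a \<in> J \<Longrightarrow> b \<in> J \<Longrightarrow> a + b \<in> J"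
    "r \<in> carrier (mpoly_ring V) \<Longrightarrow> a \<in> J \<Longrightarrow> r * a \<in> J" for a b r
    using assms unfolding ideal_mpoly_iff by auto
  show "r \<in> carrier (mpoly_ring V) \<Longrightarrow> a \<in> J \<Longrightarrow> a * r \<in> J"
    using *(4)[of r a] by (simp add: mult.commute)
  show "a \<in> J \<Longrightarrow> b \<in> J \<Longrightarrow> a - b \<in> J"
    using *(3)[of a "-b"] *(4)[OF mpoly_uminus[OF mpoly_one], of b] by simp
qed

lemma ideal_mpoly_sum:
  assumes "ideal J (mpoly_ring V)" "\<And>i. i \<in> S \<Longrightarrow> f i \<in> J"
  shows "sum f S \<in> J"
  using assms(2) by (induction S rule: infinite_finite_induct) (auto intro: ideal_mpolyD[OF assms(1)])

definition mps_mult :: "'a::comm_ring_1 mps \<Rightarrow> 'a mps \<Rightarrow> 'a mps" where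
  "mps_mult f g \<alpha> = (\<Sum>(\<beta>, \<delta>) | \<beta> + \<delta> = \<alpha>. f \<beta> * g \<delta>)"

text \<open>Sharing the unit and the product with polynomials, through \<open>lookup\<close>, makes passing between polynomials and power
  series a matter of rewriting.\<close>

lemma mps_ring_simps:
  "monoid.mult (mps_ring V) = mps_mult" "one (mps_ring V) = lookup 1"
  "ring.zero (mps_ring V) = (\<lambda>_. 0)" "add (mps_ring V) = (\<lambda>f g \<alpha>. f \<alpha> + g \<alpha>)"
  by (auto simp: mps_simps mps_mult_def fun_eq_iff lookup_one when_def)

lemma lookup_mult_mps: "lookup (p * q) = mps_mult (lookup p) (lookup q)"
proof (induction p rule: pm_induct)
  case (single a x)
  show ?case
  proof (induction q rule: pm_induct)
    case (single b y)
    show ?case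
    proof
      fix \<alpha>
      have "mps_mult (lookup (single a x)) (lookup (single b y)) \<alpha>
          = (\<Sum>p\<in>{(\<beta>, \<delta>). \<beta> + \<delta> = \<alpha>} \<inter> {(a, b)}. x * y)"
        unfolding mps_mult_def
        by (rule sum.mono_neutral_cong_right)
          (auto simp: finite_mon_decomp lookup_single when_def split: if_splits)
      also have "\<dots> = lookup (single a x * single b y) \<alpha>"
        by (auto simp: mult_single lookup_single when_def)
      finally show "lookup (single a x * single b y) \<alpha> = mps_mult (lookup (single a x)) (lookup (single b y)) \<alpha>" ..
    qed
  qed (simp add: fun_eq_iff mps_mult_def distrib_left lookup_add split_def sum.distrib)
qed (simp add: fun_eq_iff mps_mult_def distrib_right lookup_add split_def sum.distrib)

definition mdeg :: "mon \<Rightarrow> nat" where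
  "mdeg \<alpha> = (\<Sum>i\<in>keys \<alpha>. lookup \<alpha> i)"

lemma mdeg_add: "mdeg (\<alpha> + \<beta>) = mdeg \<alpha> + mdeg \<beta>"
  unfolding mdeg_def by (rule keys_sum_add) auto
lemma mdeg_single [simp]: "mdeg (single i k) = k"
  unfolding mdeg_def by (rule keys_sum_single) auto
lemma mdeg_0 [simp]: "mdeg 0 = 0"
  by (simp add: mdeg_def)
lemma mdeg_eq_0 [simp]: "mdeg \<alpha> = 0 \<longleftrightarrow> \<alpha> = 0"
  by (auto simp: mdeg_def in_keys_iff intro: poly_mapping_eqI)

lemma mdeg_pos [simp]: "0 < mdeg \<alpha> \<longleftrightarrow> \<alpha> \<noteq> 0"
  using mdeg_eq_0[of \<alpha>] by (auto simp del: mdeg_eq_0)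

lemma mon_add_eq_0 [simp]: "\<alpha> + \<beta> = 0 \<longleftrightarrow> \<alpha> = 0 \<and> \<beta> = (0::mon)"
  using mdeg_add[of \<alpha> \<beta>] mdeg_eq_0 by (metis add.right_neutral add_is_0)

lemma lookup_le_mdeg: "lookup \<alpha> i \<le> mdeg \<alpha>"
  by (cases "i \<in> keys \<alpha>") (auto simp: mdeg_def in_keys_iff intro: member_le_sum)

lemma mon_split:
  assumes "k \<le> mdeg \<alpha>"
  obtains \<beta> \<delta> where "\<alpha> = \<beta> + \<delta>" "mdeg \<beta> = k"
proof -
  have "\<exists>\<beta> \<delta>. \<alpha> = \<beta> + \<delta> \<and> mdeg \<beta> = k"
    using assms
  proof (induction \<alpha> rule: mon_induct)
    case (plus \<alpha> i)
    show ?case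
    proof (cases "k \<le> mdeg \<alpha>")
      case True
      with plus obtain \<beta> \<delta> where "\<alpha> = \<beta> + \<delta>" "mdeg \<beta> = k" by blast
      then show ?thesis by (metis add.assoc)
    next
      case False
      with plus(2) show ?thesis by (intro exI[of _ "\<alpha> + single i 1"] exI[of _ 0]) (simp add: mdeg_add)
    qed
  qed simp
  with that show ?thesis by blast
qed

lemma finite_mon_mdeg:
  assumes "finite V"
  shows "finite {\<alpha>. keys \<alpha> \<subseteq> V \<and> mdeg \<alpha> < k}"
proof -
  have "inj_on lookup {\<alpha>. keys \<alpha> \<subseteq> V \<and> mdeg \<alpha> < k}"
    by (rule inj_onI) (rule poly_mapping_eqI, simp)
  moreover have "lookup ` {\<alpha>. keys \<alpha> \<subseteq> V \<and> mdeg \<alpha> < k} \<subseteq> {f. \<forall>i. (i \<in> V \<longrightarrow> f i \<in> {..k}) \<and> (i \<notin> V \<longrightarrow> f i = 0)}"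
  proof clarify
    fix \<alpha> :: mon and i assume \<alpha>: "keys \<alpha> \<subseteq> V" "mdeg \<alpha> < k"
    have "lookup \<alpha> i \<le> k" using lookup_le_mdeg[of \<alpha> i] \<alpha>(2) by simp
    moreover have "lookup \<alpha> i = 0" if "i \<notin> V" using \<alpha>(1) that by (auto simp: in_keys_iff)
    ultimately show "(i \<in> V \<longrightarrow> lookup \<alpha> i \<in> {..k}) \<and> (i \<notin> V \<longrightarrow> lookup \<alpha> i = 0)"
      by simp
  qed
  moreover have "finite {f. \<forall>i. (i \<in> V \<longrightarrow> f i \<in> {..k}) \<and> (i \<notin> V \<longrightarrow> f i = (0::nat))}"
    by (rule finite_set_of_finite_funs) (use assms in auto)
  ultimately show ?thesis by (meson finite_imageD finite_subset)
qed

text \<open>Stated for power series, so that it applies to a polynomial \<open>p\<close> as \<open>order_ge k (lookup p)\<close>.\<close>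

definition order_ge :: "nat \<Rightarrow> 'a::comm_ring_1 mps \<Rightarrow> bool" where
  "order_ge k f \<longleftrightarrow> (\<forall>\<alpha>. mdeg \<alpha> < k \<longrightarrow> f \<alpha> = 0)"

lemma order_ge_mult:
  assumes "order_ge j f" "order_ge k g"
  shows "order_ge (j + k) (mps_mult f g)"
  unfolding order_ge_def mps_mult_def
proof (intro allI impI sum.neutral ballI, clarify)
  fix \<beta> \<delta> assume "mdeg (\<beta> + \<delta>) < j + k"
  then have "mdeg \<beta> < j \<or> mdeg \<delta> < k" by (auto simp: mdeg_add)
  then show "f \<beta> * g \<delta> = 0" using assms by (auto simp: order_ge_def)
qed

lemma order_ge_1: "order_ge 1 f \<longleftrightarrow> f 0 = 0"
  by (auto simp: order_ge_def)

lemma order_ge_0 [simp]: "order_ge 0 f"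
  by (simp add: order_ge_def)

lemma order_ge_mono: "order_ge k f \<Longrightarrow> j \<le> k \<Longrightarrow> order_ge j f"
  by (auto simp: order_ge_def)

lemma order_ge_poly:
  "order_ge k (lookup 0)" "order_ge k (lookup p) \<Longrightarrow> order_ge k (lookup q) \<Longrightarrow> order_ge k (lookup (p + q))"
  "order_ge k (lookup p) \<Longrightarrow> order_ge k (lookup q) \<Longrightarrow> order_ge k (lookup (p - q))"
  "order_ge j (lookup p) \<Longrightarrow> order_ge k (lookup q) \<Longrightarrow> order_ge (j + k) (lookup (p * q))"
  "order_ge k (lookup q) \<Longrightarrow> order_ge k (lookup (p * q))"
  "order_ge k (lookup q) \<Longrightarrow> order_ge k (lookup (q * p))"
proof -
  show *: "order_ge j (lookup p) \<Longrightarrow> order_ge k (lookup q) \<Longrightarrow> order_ge (j + k) (lookup (p * q))" for j p q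
    unfolding lookup_mult_mps by (rule order_ge_mult)
  show "order_ge k (lookup q) \<Longrightarrow> order_ge k (lookup (p * q))" using *[of 0 p q] by simp
  then show "order_ge k (lookup q) \<Longrightarrow> order_ge k (lookup (q * p))" by (simp add: mult.commute)
qed (auto simp: order_ge_def lookup_add lookup_minus)

definition order_ideal :: "nat set \<Rightarrow> nat \<Rightarrow> 'a::comm_ring_1 mpol set" where
  "order_ideal V k = {p \<in> carrier (mpoly_ring V). order_ge k (lookup p)}"

lemma ideal_order_ideal: "ideal (order_ideal V k) (mpoly_ring V)"
  by (auto simp: ideal_mpoly_iff order_ideal_def intro: mpoly_zero mpoly_add mpoly_mult order_ge_poly)

text \<open>A monomial of degree at least \<open>k\<close> is divisible by one of degree \<open>k\<close>.\<close>

lemma order_ideal_least: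
  fixes J :: "'a::comm_ring_1 mpol set"
  assumes J: "ideal J (mpoly_ring V)"
    and mono: "\<And>\<alpha>. keys \<alpha> \<subseteq> V \<Longrightarrow> mdeg \<alpha> = k \<Longrightarrow> single \<alpha> 1 \<in> J"
  shows "order_ideal V k \<subseteq> J"
proof
  fix p :: "'a mpol" assume p: "p \<in> order_ideal V k"
  have "single \<alpha> (lookup p \<alpha>) \<in> J" if "\<alpha> \<in> keys p" for \<alpha>
  proof -
    have "k \<le> mdeg \<alpha>" using p that by (auto simp: order_ideal_def order_ge_def in_keys_iff not_less[symmetric])
    then obtain \<beta> \<delta> where \<alpha>: "\<alpha> = \<beta> + \<delta>" "mdeg \<beta> = k" by (rule mon_split)
    have "keys \<alpha> \<subseteq> V" using p that by (auto simp: order_ideal_def carrier_mpoly_ring)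
    then have "single \<beta> 1 \<in> J" "single \<delta> (lookup p \<alpha>) \<in> carrier (mpoly_ring V)"
      using \<alpha> mono by (auto simp: mon_keys_plus intro: mpoly_single)
    from ideal_mpolyD(5)[OF J this(2,1)] show ?thesis by (simp add: mult_single \<alpha>(1))
  qed
  then have "(\<Sum>\<alpha>\<in>keys p. single \<alpha> (lookup p \<alpha>)) \<in> J" by (rule ideal_mpoly_sum[OF J])
  then show "p \<in> J" by (simp add: poly_mapping_sum_monomials)
qed

lemma y_ideal_eq: "y_ideal c = (order_ideal {1..c} 1 :: 'f::field mpol set)"
proof
  interpret R: cring "mpoly_ring {1..c} :: 'f mpol ring" by (rule cring_mpoly_ring)
  have y: "mvar ` {1..c} \<subseteq> carrier (mpoly_ring {1..c} :: 'f mpol ring)" by (auto intro: mpoly_mvar)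
  have "single i (1::nat) \<noteq> 0" for i :: nat by (metis mdeg_single mdeg_0 zero_neq_one)
  then show "y_ideal c \<subseteq> (order_ideal {1..c} 1 :: 'f mpol set)" unfolding y_ideal_def
    by (intro R.genideal_minimal[OF ideal_order_ideal])
      (auto simp: order_ideal_def order_ge_1 mvar_def lookup_single when_def intro!: mpoly_single)
  show "(order_ideal {1..c} 1 :: 'f mpol set) \<subseteq> y_ideal c"
  proof (rule order_ideal_least)
    show "ideal (y_ideal c :: 'f mpol set) (mpoly_ring {1..c})"
      unfolding y_ideal_def by (rule R.genideal_ideal[OF y])
    fix \<alpha> :: mon assume \<alpha>: "keys \<alpha> \<subseteq> {1..c}" "mdeg \<alpha> = 1"
    then obtain i where i: "i \<in> keys \<alpha>" by (metis mdeg_eq_0 keys_eq_empty ex_in_conv zero_neq_one)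
    have "\<alpha> - single i 1 + single i 1 = \<alpha>"
      using i by (intro poly_mapping_eqI) (auto simp: lookup_add lookup_minus lookup_single when_def in_keys_iff)
    then have "\<alpha> = single i 1" using \<alpha>(2) mdeg_add[of "\<alpha> - single i 1" "single i 1"] by simp
    then show "single \<alpha> 1 \<in> (y_ideal c :: 'f mpol set)"
      using R.genideal_self[OF y] i \<alpha>(1) unfolding y_ideal_def mvar_def by auto
  qed
qed

lemma y_ideal_power: "y_ideal c [^]\<^bsub>ideals_set (mpoly_ring {1..c})\<^esub> k = (order_ideal {1..c} k :: 'f::field mpol set)"
proof (induction k)
  interpret R: cring "mpoly_ring {1..c} :: 'f mpol ring" by (rule cring_mpoly_ring)
  case 0 show ?case unfolding R.ideal_power_0 by (simp add: order_ideal_def)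
next
  interpret R: cring "mpoly_ring {1..c} :: 'f mpol ring" by (rule cring_mpoly_ring)
  case (Suc k)
  let ?P = "ideal_prod (mpoly_ring {1..c}) (order_ideal {1..c} k) (order_ideal {1..c} 1) :: 'f mpol set"
  have "?P = order_ideal {1..c} (Suc k)"
  proof
    show "?P \<subseteq> order_ideal {1..c} (Suc k)"
      by (rule R.ideal_prod_subset[OF ideal_order_ideal])
        (use order_ge_poly(4)[where j = k and k = 1, unfolded Suc_eq_plus1[symmetric]] in \<open>auto simp: order_ideal_def mpoly_ring_simps intro: mpoly_mult\<close>)
    show "order_ideal {1..c} (Suc k) \<subseteq> ?P"
    proof (rule order_ideal_least[OF R.ideal_prod_is_ideal[OF ideal_order_ideal ideal_order_ideal]])
      fix \<alpha> assume \<alpha>: "keys \<alpha> \<subseteq> {1..c}" "mdeg \<alpha> = Suc k"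
      obtain \<beta> \<delta> where e: "\<alpha> = \<beta> + \<delta>" "mdeg \<beta> = k"
        by (rule mon_split[of k \<alpha>]) (use \<alpha> in auto)
      with \<alpha> have "mdeg \<delta> = 1" by (simp add: mdeg_add)
      have "single \<beta> 1 \<in> (order_ideal {1..c} k :: 'f mpol set)" "single \<delta> 1 \<in> (order_ideal {1..c} 1 :: 'f mpol set)"
        using \<alpha> e \<open>mdeg \<delta> = 1\<close>
        by (auto simp: order_ideal_def order_ge_def mon_keys_plus lookup_single when_def intro!: mpoly_single)
      from ideal_prod.prod[OF this, of "mpoly_ring {1..c}"] show "single \<alpha> 1 \<in> ?P"
        by (simp add: mpoly_ring_simps mult_single e(1))
    qed
  qed
  then show ?case by (simp only: R.ideal_power_Suc Suc.IH) (simp only: y_ideal_eq)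
qed

lemma lookup_0_mult:
  fixes p q :: "'a::comm_ring_1 mpol"
  shows "lookup (p * q) 0 = lookup p 0 * lookup q 0"
proof -
  have "{(\<beta>, \<delta>). \<beta> + \<delta> = (0::mon)} = {(0, 0)}" by auto
  then show ?thesis by (simp add: lookup_mult_mps mps_mult_def del: mon_add_eq_0)
qed

lemma y_ideal_iff: "p \<in> y_ideal c \<longleftrightarrow> p \<in> carrier (mpoly_ring {1..c}) \<and> lookup p 0 = 0"
  by (simp add: y_ideal_eq order_ideal_def order_ge_1)

lemma primeideal_y_ideal: "primeideal (y_ideal c) (mpoly_ring {1..c})"
proof (rule primeidealI)
  show "ideal (y_ideal c) (mpoly_ring {1..c})" unfolding y_ideal_eq by (rule ideal_order_ideal)
  show "carrier (mpoly_ring {1..c}) \<noteq> y_ideal c"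
    using mpoly_one[of "{1..c}"] y_ideal_iff[of 1 c] by (metis lookup_one_zero one_neq_zero)
qed (auto simp: cring_mpoly_ring y_ideal_iff mpoly_ring_simps lookup_0_mult)

text \<open>If \<open>J\<close> contains a power of every element of \<open>\<langle>y\<rangle>\<close>, then \<open>s = s\<^sub>0 - \<mu>\<close> with \<open>s\<^sub>0 \<noteq> 0\<close> and
  \<open>\<mu> \<in> \<langle>y\<rangle>\<close> divides \<open>s\<^sub>0\<^sup>k - \<mu>\<^sup>k\<close>, hence is invertible modulo \<open>J\<close>.\<close>

lemma saturated_if_nil:
  fixes J :: "'f::field mpol set"
  assumes J: "ideal J (mpoly_ring {1..c})" and nil: "\<And>p. p \<in> y_ideal c \<Longrightarrow> \<exists>k. p ^ k \<in> J"
  shows "J \<in> saturated_ideals (mpoly_ring {1..c}) (y_ideal c)"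
proof -
  have "a \<in> J" if "s \<in> carrier (mpoly_ring {1..c})" "s \<notin> y_ideal c" "a \<in> carrier (mpoly_ring {1..c})" "s * a \<in> J" for s a
  proof -
    define s0 where "s0 = lookup s 0"
    define \<mu> where "\<mu> = mconst s0 - s"
    have s0: "s0 \<noteq> 0" using that by (simp add: y_ideal_iff s0_def)
    have "\<mu> \<in> y_ideal c" using that
      by (auto simp: y_ideal_iff \<mu>_def lookup_minus mconst_def s0_def intro!: mpoly_diff mpoly_single)
    then obtain k where k: "\<mu> ^ k \<in> J" using nil by blast
    define t where "t = (\<Sum>i<k. \<mu> ^ (k - Suc i) * mconst s0 ^ i)"
    have t: "t \<in> carrier (mpoly_ring {1..c})" unfolding t_def
      using \<open>\<mu> \<in> y_ideal c\<close> by (intro mpoly_sum mpoly_mult mpoly_power mpoly_mconst) (auto simp: y_ideal_iff)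
    have "mconst s0 ^ k - \<mu> ^ k = s * t"
      unfolding t_def by (subst power_diff_sumr2) (simp add: \<mu>_def)
    then have "mconst s0 ^ k * a = t * (s * a) + a * \<mu> ^ k" by (simp add: algebra_simps)
    also have "\<dots> \<in> J" by (intro ideal_mpolyD(3)[OF J] ideal_mpolyD(4)[OF J t] ideal_mpolyD(4)[OF J that(3)] that k)
    finally have "mconst (inverse s0 ^ k) * (mconst s0 ^ k * a) \<in> J" by (intro ideal_mpolyD(4)[OF J mpoly_mconst])
    moreover have "mconst (x ^ k) = mconst x ^ k" for x :: 'f by (induction k) (simp_all add: mconst_simps)
    then have "mconst (inverse s0 ^ k) * (mconst s0 ^ k * a) = a"
      using s0 by (simp add: mult.assoc[symmetric] mconst_simps[symmetric] power_mult_distrib[symmetric]) (simp add: mconst_simps)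
    ultimately show ?thesis by simp
  qed
  then show ?thesis using J by (auto simp: saturated_ideals_def mpoly_ring_simps)
qed

lemma order_ge_power: "order_ge 1 (lookup p) \<Longrightarrow> order_ge k (lookup (p ^ k))"
proof (induction k)
  case (Suc k) then show ?case using order_ge_poly(4)[of 1 p k "p ^ k"] by (simp add: plus_1_eq_Suc)
qed simp

lemma saturated_if_order_ideal_subset:
  fixes J :: "'f::field mpol set"
  assumes "ideal J (mpoly_ring {1..c})" "order_ideal {1..c} k \<subseteq> J"
  shows "J \<in> saturated_ideals (mpoly_ring {1..c}) (y_ideal c)"
proof (rule saturated_if_nil[OF assms(1)])
  fix p :: "'f mpol" assume "p \<in> y_ideal c"
  then have "p ^ k \<in> order_ideal {1..c} k"
    unfolding y_ideal_eq by (auto simp: order_ideal_def intro!: order_ge_power mpoly_power)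
  then show "\<exists>k. p ^ k \<in> J" using assms(2) by blast
qed

section \<open>Power series\<close>

lemma mps_carrier_iff: "f \<in> carrier (mps_ring V) \<longleftrightarrow> (\<forall>\<alpha>. f \<alpha> \<noteq> 0 \<longrightarrow> keys \<alpha> \<subseteq> V)"
  by (simp add: mps_ring_def)

lemma lookup_mps_carrier: "lookup p \<in> carrier (mps_ring V) \<longleftrightarrow> p \<in> carrier (mpoly_ring V)"
  by (simp add: mps_carrier_iff mpoly_carrier_iff)

lemma mps_mult_closed:
  "f \<in> carrier (mps_ring V) \<Longrightarrow> g \<in> carrier (mps_ring V) \<Longrightarrow> mps_mult f g \<in> carrier (mps_ring V)"
  using monoid.m_closed[OF cring.axioms(1)[OF cring_mps_ring, THEN ring.axioms(2)], of f V g]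
  by (simp add: mps_ring_simps)

lemma mps_add_closed:
  "f \<in> carrier (mps_ring V) \<Longrightarrow> g \<in> carrier (mps_ring V) \<Longrightarrow> (\<lambda>\<alpha>. f \<alpha> + g \<alpha>) \<in> carrier (mps_ring V)"
  unfolding mps_carrier_iff by (metis add.right_neutral)

lemma mps_mult_commute: "mps_mult f g = mps_mult g f"
  and mps_mult_assoc: "mps_mult (mps_mult f g) h = mps_mult f (mps_mult g h)"
proof -
  interpret cring "mps_ring UNIV :: 'a mps ring" by (rule cring_mps_ring)
  have "f \<in> carrier (mps_ring UNIV)" for f :: "'a mps" by (simp add: mps_carrier_iff)
  then show "mps_mult f g = mps_mult g f" "mps_mult (mps_mult f g) h = mps_mult f (mps_mult g h)"
    using m_comm[of f g] m_assoc[of f g h] by (simp_all add: mps_ring_simps)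
qed

lemma mps_mult_single: "mps_mult (lookup (single \<alpha> a)) g (\<alpha> + \<delta>) = a * g \<delta>"
proof -
  have "mps_mult (lookup (single \<alpha> a)) g (\<alpha> + \<delta>) = (\<Sum>p\<in>{(\<alpha>, \<delta>)}. a * g \<delta>)"
    unfolding mps_mult_def
    by (rule sum.mono_neutral_cong_right)
      (auto simp: finite_mon_decomp lookup_single when_def split: if_splits)
  then show ?thesis by simp
qed

lemma mps_mult_single_other:
  assumes "\<And>\<delta>. \<gamma> \<noteq> \<alpha> + \<delta>"
  shows "mps_mult (lookup (single \<alpha> a)) g \<gamma> = 0"
  unfolding mps_mult_def
  by (rule sum.neutral) (use assms in \<open>auto simp: lookup_single when_def\<close>)

lemma mps_mult_0: "mps_mult f g 0 = f 0 * g 0"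
proof -
  have "{(\<beta>, \<delta>). \<beta> + \<delta> = (0::mon)} = {(0, 0)}" by auto
  then show ?thesis by (simp add: mps_mult_def del: mon_add_eq_0)
qed

lemma mps_mult_one: "mps_mult (lookup 1) g = g"
proof
  fix \<alpha> show "mps_mult (lookup 1) g \<alpha> = g \<alpha>"
    using mps_mult_single[of 0 1 g \<alpha>] by simp
qed

lemma ideal_mps_iff:
  "ideal J (mps_ring V) \<longleftrightarrow> J \<subseteq> carrier (mps_ring V) \<and> (\<lambda>_. 0) \<in> J \<and>
     (\<forall>f\<in>J. \<forall>g\<in>J. (\<lambda>\<alpha>. f \<alpha> + g \<alpha>) \<in> J) \<and> (\<forall>r\<in>carrier (mps_ring V). \<forall>f\<in>J. mps_mult r f \<in> J)"
  by (simp add: cring.ideal_iff[OF cring_mps_ring] mps_ring_simps)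

lemma ideal_mpsD:
  assumes "ideal J (mps_ring V)"
  shows "f \<in> J \<Longrightarrow> f \<in> carrier (mps_ring V)" "(\<lambda>_. 0) \<in> J"
    "f \<in> J \<Longrightarrow> g \<in> J \<Longrightarrow> (\<lambda>\<alpha>. f \<alpha> + g \<alpha>) \<in> J"
    "r \<in> carrier (mps_ring V) \<Longrightarrow> f \<in> J \<Longrightarrow> mps_mult r f \<in> J"
    "r \<in> carrier (mps_ring V) \<Longrightarrow> f \<in> J \<Longrightarrow> mps_mult f r \<in> J"
    "f \<in> J \<Longrightarrow> g \<in> J \<Longrightarrow> (\<lambda>\<alpha>. f \<alpha> - g \<alpha>) \<in> J"
proof -
  show *: "f \<in> J \<Longrightarrow> f \<in> carrier (mps_ring V)" "(\<lambda>_. 0) \<in> J"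
    "f \<in> J \<Longrightarrow> g \<in> J \<Longrightarrow> (\<lambda>\<alpha>. f \<alpha> + g \<alpha>) \<in> J"
    "r \<in> carrier (mps_ring V) \<Longrightarrow> f \<in> J \<Longrightarrow> mps_mult r f \<in> J" for f g r
    using assms unfolding ideal_mps_iff by auto
  show "r \<in> carrier (mps_ring V) \<Longrightarrow> f \<in> J \<Longrightarrow> mps_mult f r \<in> J"
    using *(4)[of r f] by (simp add: mps_mult_commute)
  show "f \<in> J \<Longrightarrow> g \<in> J \<Longrightarrow> (\<lambda>\<alpha>. f \<alpha> - g \<alpha>) \<in> J"
  proof -
    assume fg: "f \<in> J" "g \<in> J"
    have "mps_mult (lookup (single 0 (-1))) g = (\<lambda>\<alpha>. - g \<alpha>)"
      using mps_mult_single[of 0 "-1" g] by (auto simp: fun_eq_iff)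
    moreover have "lookup (single 0 (-1)) \<in> carrier (mps_ring V)"
      by (simp only: lookup_mps_carrier) (simp add: mpoly_single)
    ultimately have "(\<lambda>\<alpha>. - g \<alpha>) \<in> J" using *(4)[of "lookup (single 0 (-1))" g] fg by simp
    from *(3)[OF fg(1) this] show ?thesis by simp
  qed
qed

lemma ideal_mps_sum:
  assumes "ideal J (mps_ring V)" "\<And>i. i \<in> S \<Longrightarrow> f i \<in> J"
  shows "(\<lambda>\<alpha>. \<Sum>i\<in>S. f i \<alpha>) \<in> J"
  using assms(2) by (induction S rule: infinite_finite_induct) (auto intro: ideal_mpsD[OF assms(1)])

definition order_ideal_ps :: "nat set \<Rightarrow> nat \<Rightarrow> 'a::comm_ring_1 mps set" where
  "order_ideal_ps V k = {f \<in> carrier (mps_ring V). order_ge k f}"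

lemma ideal_order_ideal_ps: "ideal (order_ideal_ps V k) (mps_ring V)"
  using order_ge_mult[where j = 0]
  by (auto simp: ideal_mps_iff order_ideal_ps_def intro!: mps_mult_closed mps_add_closed)
    (auto simp: order_ge_def mps_carrier_iff)

text \<open>Grouping the monomials of a series of order \<open>\<ge> k\<close> by a chosen divisor of degree \<open>k\<close>
  writes the series as a finite combination of the monomials of degree \<open>k\<close>.\<close>

lemma order_ideal_ps_least:
  fixes J :: "'a::comm_ring_1 mps set"
  assumes V: "finite V" and J: "ideal J (mps_ring V)"
    and mono: "\<And>\<alpha>. keys \<alpha> \<subseteq> V \<Longrightarrow> mdeg \<alpha> = k \<Longrightarrow> lookup (single \<alpha> 1) \<in> J"
  shows "order_ideal_ps V k \<subseteq> J"
proof
  fix f :: "'a mps" assume f: "f \<in> order_ideal_ps V k"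
  have "\<exists>\<beta>. (\<exists>\<delta>. \<gamma> = \<beta> + \<delta>) \<and> mdeg \<beta> = k" if "k \<le> mdeg \<gamma>" for \<gamma>
    using mon_split[OF that] by metis
  then obtain \<tau> where \<tau>: "\<And>\<gamma>. k \<le> mdeg \<gamma> \<Longrightarrow> (\<exists>\<delta>. \<gamma> = \<tau> \<gamma> + \<delta>) \<and> mdeg (\<tau> \<gamma>) = k"
    by metis
  define h where "h \<alpha> \<delta> = (if \<tau> (\<alpha> + \<delta>) = \<alpha> then f (\<alpha> + \<delta>) else 0)" for \<alpha> \<delta>
  define M where "M = {\<alpha>. keys \<alpha> \<subseteq> V \<and> mdeg \<alpha> = k}"
  have "finite M" by (rule finite_subset[OF _ finite_mon_mdeg[OF V, of "Suc k"]]) (auto simp: M_def)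
  have fV: "f \<gamma> = 0" if "\<not> keys \<gamma> \<subseteq> V" for \<gamma> using f that by (auto simp: order_ideal_ps_def mps_carrier_iff)
  have "h \<alpha> \<in> carrier (mps_ring V)" for \<alpha>
    unfolding mps_carrier_iff
  proof (intro allI impI)
    fix \<delta> assume "h \<alpha> \<delta> \<noteq> 0"
    then have "f (\<alpha> + \<delta>) \<noteq> 0" by (auto simp: h_def split: if_splits)
    then have "keys (\<alpha> + \<delta>) \<subseteq> V" using fV by blast
    then show "keys \<delta> \<subseteq> V" by (simp add: mon_keys_plus)
  qed
  then have "mps_mult (h \<alpha>) (lookup (single \<alpha> 1)) \<in> J" if "\<alpha> \<in> M" for \<alpha>
    using that mono by (intro ideal_mpsD(4)[OF J]) (auto simp: M_def)
  then have "mps_mult (lookup (single \<alpha> 1)) (h \<alpha>) \<in> J" if "\<alpha> \<in> M" for \<alpha>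
    using that by (subst mps_mult_commute)
  then have "(\<lambda>\<gamma>. \<Sum>\<alpha>\<in>M. mps_mult (lookup (single \<alpha> 1)) (h \<alpha>) \<gamma>) \<in> J"
    by (intro ideal_mps_sum[OF J])
  moreover have "(\<Sum>\<alpha>\<in>M. mps_mult (lookup (single \<alpha> 1)) (h \<alpha>) \<gamma>) = f \<gamma>" for \<gamma>
  proof -
    have tm: "mps_mult (lookup (single \<alpha> 1)) (h \<alpha>) \<gamma> =
        (if (\<exists>\<delta>. \<gamma> = \<alpha> + \<delta>) \<and> \<tau> \<gamma> = \<alpha> then f \<gamma> else 0)" for \<alpha>
    proof (cases "\<exists>\<delta>. \<gamma> = \<alpha> + \<delta>")
      case True
      then obtain \<delta> where "\<gamma> = \<alpha> + \<delta>" by blast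
      then show ?thesis using mps_mult_single[of \<alpha> 1 "h \<alpha>" \<delta>] by (auto simp: h_def)
    next
      case False
      then show ?thesis using mps_mult_single_other[of \<gamma> \<alpha> 1 "h \<alpha>"] by auto
    qed
    show ?thesis
    proof (cases "k \<le> mdeg \<gamma> \<and> keys \<gamma> \<subseteq> V")
      case True
      then obtain \<delta> where \<delta>: "\<gamma> = \<tau> \<gamma> + \<delta>" "mdeg (\<tau> \<gamma>) = k"
        using \<tau> by blast
      then have "keys (\<tau> \<gamma>) \<subseteq> V" using True mon_keys_plus[of "\<tau> \<gamma>" \<delta>] by simp
      then have "\<tau> \<gamma> \<in> M" using \<delta> by (simp add: M_def)
      have "(\<Sum>\<alpha>\<in>M. mps_mult (lookup (single \<alpha> 1)) (h \<alpha>) \<gamma>) = (\<Sum>\<alpha>\<in>M. if \<alpha> = \<tau> \<gamma> then f \<gamma> else 0)"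
        unfolding tm by (rule sum.cong) (use \<delta> in auto)
      then show ?thesis using \<open>\<tau> \<gamma> \<in> M\<close> \<open>finite M\<close> by simp
    next
      case False
      then have "f \<gamma> = 0" using f fV by (auto simp: order_ideal_ps_def order_ge_def)
      moreover from this have "(\<Sum>\<alpha>\<in>M. mps_mult (lookup (single \<alpha> 1)) (h \<alpha>) \<gamma>) = 0"
        unfolding tm by (intro sum.neutral) auto
      ultimately show ?thesis by simp
    qed
  qed
  ultimately show "f \<in> J" by simp
qed

function mps_inv :: "'f::field mps \<Rightarrow> mon \<Rightarrow> 'f" where
  "mps_inv f \<alpha> = (if \<alpha> = 0 then inverse (f 0)
     else - (\<Sum>p\<in>{p. fst p + snd p = \<alpha> \<and> snd p \<noteq> \<alpha>}. f (fst p) * mps_inv f (snd p)) / f 0)"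
  by pat_completeness auto
termination
proof (relation "measure (\<lambda>(f, \<alpha>). mdeg \<alpha>)")
  fix f :: "'f mps" and \<alpha> and p :: "mon \<times> mon" assume "p \<in> {p. fst p + snd p = \<alpha> \<and> snd p \<noteq> \<alpha>}"
  then have "fst p \<noteq> 0" "mdeg \<alpha> = mdeg (fst p) + mdeg (snd p)" by (auto simp: mdeg_add)
  then show "((f, snd p), f, \<alpha>) \<in> measure (\<lambda>(f, \<alpha>). mdeg \<alpha>)"
    by simp
qed simp

declare mps_inv.simps [simp del]

text \<open>Every factorization of a monomial that is not in the variables \<open>V\<close> has a factor of the same kind,
  so the recursion only produces zeros there.\<close>

lemma mps_inv_carrier:
  assumes "f \<in> carrier (mps_ring V)"
  shows "mps_inv f \<in> carrier (mps_ring V)"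
proof -
  have "mps_inv f \<alpha> = 0" if "\<not> keys \<alpha> \<subseteq> V" for \<alpha>
    using that
  proof (induction \<alpha> rule: measure_induct_rule[of mdeg])
    case (less \<alpha>)
    have "f (fst p) * mps_inv f (snd p) = 0" if p: "fst p + snd p = \<alpha>" "snd p \<noteq> \<alpha>" for p
    proof (cases "keys (fst p) \<subseteq> V")
      case True
      then have "\<not> keys (snd p) \<subseteq> V" using less(2) p(1) mon_keys_plus[of "fst p" "snd p"] by auto
      moreover have "fst p \<noteq> 0" using p by auto
      then have "mdeg (snd p) < mdeg \<alpha>" using mdeg_add[of "fst p" "snd p"] p(1) by simp
      ultimately show ?thesis using less(1) by simp
    next
      case False
      then show ?thesis using assms by (auto simp: mps_carrier_iff)
    qed
    then have "(\<Sum>p\<in>{p. fst p + snd p = \<alpha> \<and> snd p \<noteq> \<alpha>}. f (fst p) * mps_inv f (snd p)) = 0"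
      by (intro sum.neutral) blast
    moreover have "\<alpha> \<noteq> 0" using less(2) by auto
    ultimately show ?case by (subst mps_inv.simps) (simp only: if_False minus_zero div_0)
  qed
  then show ?thesis by (auto simp: mps_carrier_iff)
qed

lemma mps_inv_mult:
  assumes "f 0 \<noteq> 0"
  shows "mps_mult (mps_inv f) f = lookup 1"
proof -
  have "mps_mult f (mps_inv f) \<alpha> = lookup 1 \<alpha>" for \<alpha>
  proof (cases "\<alpha> = 0")
    case True
    then show ?thesis using assms by (simp add: mps_mult_0 mps_inv.simps)
  next
    case False
    let ?S = "{p. fst p + snd p = \<alpha> \<and> snd p \<noteq> \<alpha>}"
    have "{p. fst p + snd p = \<alpha>} = insert (0, \<alpha>) ?S" by (auto simp: prod_eq_iff)
    moreover have "finite ?S" by (rule finite_subset[OF _ finite_mon_decomp'[of \<alpha>]]) auto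
    ultimately have "mps_mult f (mps_inv f) \<alpha> = f 0 * mps_inv f \<alpha> + (\<Sum>p\<in>?S. f (fst p) * mps_inv f (snd p))"
      by (simp add: mps_mult_def split_def)
    also have "\<dots> = 0" using assms False by (subst mps_inv.simps) simp
    finally show ?thesis using False by (simp add: lookup_one)
  qed
  then show ?thesis by (subst mps_mult_commute) auto
qed

text \<open>Series with non-zero constant term are units.\<close>

lemma mps_ideals_saturated:
  fixes J :: "'f::field mps set"
  assumes J: "ideal J (mps_ring V)"
  shows "J \<in> saturated_ideals (mps_ring V) (order_ideal_ps V 1)"
proof -
  have "a \<in> J" if "s \<in> carrier (mps_ring V)" "s \<notin> order_ideal_ps V 1" "mps_mult s a \<in> J" for s a
  proof -
    have "s 0 \<noteq> 0" using that by (auto simp: order_ideal_ps_def order_ge_1)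
    have "mps_mult (mps_inv s) (mps_mult s a) \<in> J"
      by (intro ideal_mpsD(4)[OF J] that mps_inv_carrier)
    then show ?thesis
      by (simp add: mps_mult_assoc[symmetric] mps_inv_mult[of s, OF \<open>s 0 \<noteq> 0\<close>] mps_mult_one)
  qed
  then show ?thesis using J by (auto simp: saturated_ideals_def mps_ring_simps)
qed

lemma primeideal_order_ideal_ps: "primeideal (order_ideal_ps V 1) (mps_ring V :: 'f::field mps ring)"
proof (rule primeidealI[OF ideal_order_ideal_ps cring_mps_ring])
  have "lookup 1 \<in> carrier (mps_ring V)" "lookup 1 \<notin> (order_ideal_ps V 1 :: 'f mps set)"
    by (auto simp: order_ideal_ps_def order_ge_1 lookup_mps_carrier mpoly_one)
  then show "carrier (mps_ring V) \<noteq> (order_ideal_ps V 1 :: 'f mps set)" by blast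
qed (auto simp: order_ideal_ps_def order_ge_1 mps_ring_simps mps_mult_0)

lemma single_in_order_ideal_ps_power:
  assumes "keys \<alpha> \<subseteq> V" "mdeg \<alpha> = k"
  shows "lookup (single \<alpha> 1) \<in> (order_ideal_ps V 1 [^]\<^bsub>ideals_set (mps_ring V)\<^esub> k :: 'f::field mps set)"
  using assms
proof (induction k arbitrary: \<alpha>)
  interpret R: cring "mps_ring V :: 'f mps ring" by (rule cring_mps_ring)
  case 0 then show ?case unfolding R.ideal_power_0 by (simp add: lookup_mps_carrier mpoly_one)
next
  interpret R: cring "mps_ring V :: 'f mps ring" by (rule cring_mps_ring)
  case (Suc k)
  obtain \<beta> \<delta> where e: "\<alpha> = \<beta> + \<delta>" "mdeg \<beta> = k"
    by (rule mon_split[of k \<alpha>]) (use Suc in auto)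
  with Suc.prems have \<delta>: "mdeg \<delta> = 1" "keys \<beta> \<subseteq> V" "keys \<delta> \<subseteq> V"
    by (auto simp: mdeg_add mon_keys_plus)
  then have "\<delta> \<noteq> 0" by auto
  have "lookup (single \<delta> 1) \<in> (order_ideal_ps V 1 :: 'f mps set)"
    using \<delta> \<open>\<delta> \<noteq> 0\<close> by (auto simp: order_ideal_ps_def order_ge_1 lookup_mps_carrier lookup_single when_def intro!: mpoly_single)
  from ideal_prod.prod[OF Suc.IH[OF \<delta>(2) e(2)] this, of "mps_ring V"]
  show ?case unfolding R.ideal_power_Suc
    by (simp add: mps_ring_simps lookup_mult_mps[symmetric] mult_single e(1))
qed

section \<open>Ideals of finite colength and truncation\<close>

definition ideals_above :: "nat \<Rightarrow> nat \<Rightarrow> 'f::field mpol set set" where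
  "ideals_above c k = {J. ideal J (mpoly_ring {1..c}) \<and> order_ideal {1..c} k \<subseteq> J}"

definition series_ideals_above :: "nat \<Rightarrow> nat \<Rightarrow> 'f::field mps set set" where
  "series_ideals_above c k = {J. ideal J (mps_ring {1..c}) \<and> order_ideal_ps {1..c} k \<subseteq> J}"

lemma colength_series_ideal:
  assumes "I \<in> series_ideals_above c k"
  shows "colength (mps_ring {1..c}) I = chain_length {J \<in> series_ideals_above c k. I \<subseteq> J}"
proof -
  interpret R: cring "mps_ring {1..c} :: 'a mps ring" by (rule cring_mps_ring)
  show ?thesis using R.colength_eq_chain_length assms by (simp add: series_ideals_above_def)
qed

text \<open>The length condition alone forces an ideal of colength \<open>m\<close> to contain all series of order at least \<open>m\<close>.\<close>

lemma punctual_hilbert_eq: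
  "punctual_hilbert c m = {I \<in> series_ideals_above c m. chain_length {J \<in> series_ideals_above c m. I \<subseteq> J} = enat m}"
  (is "_ = ?H")
proof (intro equalityI subsetI)
  interpret R: cring "mps_ring {1..c} :: 'a mps ring" by (rule cring_mps_ring)
  fix I :: "'a mps set" assume "I \<in> punctual_hilbert c m"
  then have I: "ideal I (mps_ring {1..c})" "colength (mps_ring {1..c}) I = enat m"
    by (auto simp: punctual_hilbert_def)
  have "order_ideal_ps {1..c} 1 [^]\<^bsub>ideals_set (mps_ring {1..c})\<^esub> m \<subseteq> I"
    by (rule R.power_subset_if_colength[OF I(2) primeideal_order_ideal_ps I(1) mps_ideals_saturated])
  then have "order_ideal_ps {1..c} m \<subseteq> I"
    using I(1) single_in_order_ideal_ps_power by (intro order_ideal_ps_least) auto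
  then have "I \<in> series_ideals_above c m" using I(1) by (simp add: series_ideals_above_def)
  then show "I \<in> ?H" using colength_series_ideal[of I c m] I(2) by simp
next
  fix I :: "'a mps set" assume "I \<in> ?H"
  then show "I \<in> punctual_hilbert c m" using colength_series_ideal[of I c m]
    by (simp add: punctual_hilbert_def series_ideals_above_def)
qed

lemma punctual_hilbert_poly_eq:
  assumes "m \<ge> 1"
  shows "punctual_hilbert_poly c m = {I \<in> ideals_above c m. chain_length {J \<in> ideals_above c m. I \<subseteq> J} = enat m}"
  (is "_ = ?H")
proof (intro equalityI subsetI)
  interpret R: cring "mpoly_ring {1..c} :: 'a mpol ring" by (rule cring_mpoly_ring)
  have col: "colength (mpoly_ring {1..c}) I = chain_length {J \<in> ideals_above c m. I \<subseteq> J}"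
    if "I \<in> ideals_above c m" for I :: "'a mpol set"
    using R.colength_eq_chain_length that by (simp add: ideals_above_def)
  {
    fix I :: "'a mpol set" assume "I \<in> punctual_hilbert_poly c m"
    then have I: "ideal I (mpoly_ring {1..c})" "colength (mpoly_ring {1..c}) I = enat m"
      and rad: "radical (mpoly_ring {1..c}) I = y_ideal c"
      by (auto simp: punctual_hilbert_poly_def primary_to_def primary_ideal_def)
    have sat: "J \<in> saturated_ideals (mpoly_ring {1..c}) (y_ideal c)"
      if "ideal J (mpoly_ring {1..c})" "I \<subseteq> J" for J
      by (rule saturated_if_nil[OF that(1)]) (use rad that(2) in \<open>auto simp: radical_def mpoly_ring_pow\<close>)
    have "y_ideal c [^]\<^bsub>ideals_set (mpoly_ring {1..c})\<^esub> m \<subseteq> I"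
      by (rule R.power_subset_if_colength[OF I(2) primeideal_y_ideal I(1) sat])
    then have "I \<in> ideals_above c m" using I(1) by (simp add: ideals_above_def y_ideal_power)
    then show "I \<in> ?H" using col I(2) by auto
  }
  fix I :: "'a mpol set" assume H: "I \<in> ?H"
  then have I: "ideal I (mpoly_ring {1..c})" "order_ideal {1..c} m \<subseteq> I" by (auto simp: ideals_above_def)
  have "I \<noteq> carrier (mpoly_ring {1..c})"
    by (rule chain_length_proper[of "ideals_above c m" I m])
      (use H assms ideal_mpolyD(1) in \<open>auto simp: ideals_above_def\<close>)
  then have "primary_to (mpoly_ring {1..c}) (y_ideal c) I"
    using I R.primary_to_if_saturated[OF primeideal_y_ideal saturated_if_order_ideal_subset[OF I], of m]
    by (simp add: y_ideal_power)
  then show "I \<in> punctual_hilbert_poly c m" using H col[of I] by (simp add: punctual_hilbert_poly_def)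
qed

definition truncate :: "nat \<Rightarrow> nat \<Rightarrow> 'a::comm_ring_1 mps \<Rightarrow> 'a mpol" where
  "truncate c k f = (\<Sum>\<alpha> | keys \<alpha> \<subseteq> {1..c} \<and> mdeg \<alpha> < k. single \<alpha> (f \<alpha>))"

lemma lookup_truncate: "lookup (truncate c k f) \<alpha> = (if keys \<alpha> \<subseteq> {1..c} \<and> mdeg \<alpha> < k then f \<alpha> else 0)"
proof -
  have "lookup (truncate c k f) \<alpha> = (\<Sum>\<beta> | keys \<beta> \<subseteq> {1..c} \<and> mdeg \<beta> < k. if \<beta> = \<alpha> then f \<alpha> else 0)"
    unfolding truncate_def lookup_sum by (rule sum.cong) (auto simp: lookup_single when_def)
  then show ?thesis by (simp add: finite_mon_mdeg)
qed

lemma truncate_carrier: "truncate c k f \<in> carrier (mpoly_ring {1..c})"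
  by (simp add: mpoly_carrier_iff lookup_truncate)

lemma truncate_diff: "f \<in> carrier (mps_ring {1..c}) \<Longrightarrow> (\<lambda>\<alpha>. f \<alpha> - lookup (truncate c k f) \<alpha>) \<in> order_ideal_ps {1..c} k"
  by (auto simp: order_ideal_ps_def mps_carrier_iff lookup_truncate order_ge_def)

text \<open>Both rings have the same quotient by the elements of order at least \<open>k\<close>, namely the
  truncated polynomials.\<close>

lemma contract_extend_above:
  "mutually_inverse (contract_ideal c) (extend_ideal c) (series_ideals_above c k :: 'f::field mps set set) (ideals_above c k)"
  unfolding mutually_inverse_def
proof (intro conjI ballI subsetI)
  interpret R: cring "mps_ring {1..c} :: 'f mps ring" by (rule cring_mps_ring)
  interpret S: cring "mpoly_ring {1..c} :: 'f mpol ring" by (rule cring_mpoly_ring)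
  have lookup_add_fun: "lookup (p + q) = (\<lambda>\<alpha>. lookup p \<alpha> + lookup q \<alpha>)" for p q :: "'f mpol"
    by (simp add: fun_eq_iff lookup_add)
  have lookup_zero_fun: "lookup 0 = (\<lambda>\<alpha>. 0 :: 'f)" by (simp add: fun_eq_iff)
  have contract: "contract_ideal c I \<in> ideals_above c k" if "I \<in> series_ideals_above c k" for I :: "'f mps set"
  proof -
    have I: "ideal I (mps_ring {1..c})" "order_ideal_ps {1..c} k \<subseteq> I"
      using that by (auto simp: series_ideals_above_def)
    have "ideal (contract_ideal c I) (mpoly_ring {1..c})"
      unfolding ideal_mpoly_iff contract_ideal_def
      using ideal_mpsD[OF I(1)] by (auto simp: lookup_add_fun lookup_mult_mps lookup_zero_fun lookup_mps_carrier intro: mpoly_zero mpoly_add mpoly_mult)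
    moreover have "order_ideal {1..c} k \<subseteq> contract_ideal c I"
      using I(2) by (auto simp: order_ideal_def order_ideal_ps_def contract_ideal_def lookup_mps_carrier subset_iff)
    ultimately show ?thesis by (simp add: ideals_above_def)
  qed
  then show "J \<in> ideals_above c k" if "J \<in> contract_ideal c ` series_ideals_above c k" for J :: "'f mpol set"
    using that by auto
  have car: "lookup ` J \<subseteq> carrier (mps_ring {1..c})" if "ideal J (mpoly_ring {1..c})" for J :: "'f mpol set"
    using ideal_mpolyD(1)[OF that] by (auto simp: lookup_mps_carrier)
  have extend: "extend_ideal c J \<in> series_ideals_above c k" if "J \<in> ideals_above c k" for J :: "'f mpol set"
  proof -
    have J: "ideal J (mpoly_ring {1..c})" "order_ideal {1..c} k \<subseteq> J" using that by (auto simp: ideals_above_def)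
    have e: "ideal (extend_ideal c J) (mps_ring {1..c})" unfolding extend_ideal_def
      by (rule R.genideal_ideal[OF car[OF J(1)]])
    moreover have "order_ideal_ps {1..c} k \<subseteq> extend_ideal c J"
    proof (rule order_ideal_ps_least[OF _ e])
      fix \<alpha> assume "keys \<alpha> \<subseteq> {1..c}" "mdeg \<alpha> = k"
      then have "single \<alpha> 1 \<in> (order_ideal {1..c} k :: 'f mpol set)"
        by (auto simp: order_ideal_def order_ge_def lookup_single when_def intro!: mpoly_single)
      then show "lookup (single \<alpha> 1) \<in> extend_ideal c J"
        using R.genideal_self[OF car[OF J(1)]] J(2) unfolding extend_ideal_def by auto
    qed simp
    ultimately show ?thesis by (simp add: series_ideals_above_def)
  qed
  then show "I \<in> series_ideals_above c k" if "I \<in> extend_ideal c ` ideals_above c k" for I :: "'f mps set"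
    using that by auto
  show "extend_ideal c (contract_ideal c I) = I" if "I \<in> series_ideals_above c k" for I :: "'f mps set"
  proof
    have I: "ideal I (mps_ring {1..c})" "order_ideal_ps {1..c} k \<subseteq> I"
      using that by (auto simp: series_ideals_above_def)
    show "extend_ideal c (contract_ideal c I) \<subseteq> I"
      unfolding extend_ideal_def by (rule R.genideal_minimal[OF I(1)]) (auto simp: contract_ideal_def)
    note E = extend[OF contract[OF that]]
    have Ei: "ideal (extend_ideal c (contract_ideal c I)) (mps_ring {1..c})"
      and Eo: "order_ideal_ps {1..c} k \<subseteq> extend_ideal c (contract_ideal c I)"
      using E by (auto simp: series_ideals_above_def)
    show "I \<subseteq> extend_ideal c (contract_ideal c I)"
    proof
      fix f assume f: "f \<in> I"
      have d: "(\<lambda>\<alpha>. f \<alpha> - lookup (truncate c k f) \<alpha>) \<in> order_ideal_ps {1..c} k"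
        by (rule truncate_diff) (rule ideal_mpsD(1)[OF I(1) f])
      have "(\<lambda>\<alpha>. f \<alpha> - (f \<alpha> - lookup (truncate c k f) \<alpha>)) \<in> I"
        by (rule ideal_mpsD(6)[OF I(1) f]) (use d I(2) in blast)
      then have "truncate c k f \<in> contract_ideal c I" by (simp add: contract_ideal_def truncate_carrier)
      then have "lookup (truncate c k f) \<in> extend_ideal c (contract_ideal c I)"
        using R.genideal_self[OF car] contract[OF that] unfolding extend_ideal_def ideals_above_def by blast
      from ideal_mpsD(3)[OF Ei this subsetD[OF Eo d]]
      show "f \<in> extend_ideal c (contract_ideal c I)" by simp
    qed
  qed
  show "contract_ideal c (extend_ideal c J) = J" if "J \<in> ideals_above c k" for J :: "'f mpol set"
  proof
    have J: "ideal J (mpoly_ring {1..c})" "order_ideal {1..c} k \<subseteq> J" using that by (auto simp: ideals_above_def)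
    note Jc = ideal_mpolyD[OF J(1)]
    show "J \<subseteq> contract_ideal c (extend_ideal c J)"
      using R.genideal_self[OF car[OF J(1)]] Jc(1) unfolding contract_ideal_def extend_ideal_def by auto
    \<comment> \<open>An ideal that contains the extension of \<open>J\<close>, and whose polynomials lie in \<open>J\<close>.\<close>
    let ?T = "{f \<in> carrier (mps_ring {1..c}). truncate c k f \<in> J}"
    have eqm: "p \<in> J" if "q \<in> J" "p \<in> carrier (mpoly_ring {1..c})"
      "\<And>\<alpha>. keys \<alpha> \<subseteq> {1..c} \<Longrightarrow> mdeg \<alpha> < k \<Longrightarrow> lookup p \<alpha> = lookup q \<alpha>" for p q
    proof -
      have "p - q \<in> carrier (mpoly_ring {1..c})" using that Jc(1) by (intro mpoly_diff) auto
      moreover from this have "lookup (p - q) \<alpha> = 0" if "mdeg \<alpha> < k" for \<alpha>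
        using that \<open>\<And>\<alpha>. keys \<alpha> \<subseteq> {1..c} \<Longrightarrow> mdeg \<alpha> < k \<Longrightarrow> lookup p \<alpha> = lookup q \<alpha>\<close>[of \<alpha>]
        by (cases "keys \<alpha> \<subseteq> {1..c}") (auto simp: lookup_minus mpoly_carrier_iff)
      ultimately have "p - q \<in> J" using J(2) by (auto simp: order_ideal_def order_ge_def)
      from Jc(3)[OF this that(1)] show ?thesis by simp
    qed
    have mult: "lookup (truncate c k r * truncate c k f) \<alpha> = mps_mult r f \<alpha>"
      if "r \<in> carrier (mps_ring {1..c})" "f \<in> carrier (mps_ring {1..c})" "mdeg \<alpha> < k" for r f :: "'f mps" and \<alpha>
      unfolding lookup_mult_mps mps_mult_def
    proof (rule sum.cong, simp, clarify)
      fix \<beta> \<delta> assume "\<alpha> = \<beta> + \<delta>"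
      then have "mdeg \<beta> < k" "mdeg \<delta> < k" using that(3) by (auto simp: mdeg_add)
      then show "lookup (truncate c k r) \<beta> * lookup (truncate c k f) \<delta> = r \<beta> * f \<delta>"
        using that by (auto simp: lookup_truncate mps_carrier_iff)
    qed
    have "ideal ?T (mps_ring {1..c})" unfolding ideal_mps_iff
    proof (intro conjI ballI)
      show "(\<lambda>_. 0) \<in> ?T" using Jc(2) by (auto simp: mps_carrier_iff truncate_def)
      fix f g assume fg: "f \<in> ?T" "g \<in> ?T"
      have "(\<lambda>\<alpha>. f \<alpha> + g \<alpha>) \<in> carrier (mps_ring {1..c})"  using fg by (auto intro: mps_add_closed)
      moreover have "truncate c k (\<lambda>\<alpha>. f \<alpha> + g \<alpha>) = truncate c k f + truncate c k g"
        by (simp add: truncate_def single_add sum.distrib)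
      ultimately show "(\<lambda>\<alpha>. f \<alpha> + g \<alpha>) \<in> ?T" using fg Jc(3) by auto
    next
      fix r f :: "'f mps" assume r: "r \<in> carrier (mps_ring {1..c})" and f: "f \<in> ?T"
      have "truncate c k r * truncate c k f \<in> J" using f by (intro Jc(4) truncate_carrier) auto
      then have "truncate c k (mps_mult r f) \<in> J"
        by (rule eqm) (use mult r f in \<open>auto simp: truncate_carrier lookup_truncate\<close>)
      then show "mps_mult r f \<in> ?T" using r f mps_mult_closed by auto
    qed auto
    moreover have "lookup ` J \<subseteq> ?T"
    proof clarify
      fix p assume p: "p \<in> J"
      have "truncate c k (lookup p) \<in> J"
        by (rule eqm[OF p truncate_carrier]) (auto simp: lookup_truncate)
      then show "lookup p \<in> carrier (mps_ring {1..c}) \<and> truncate c k (lookup p) \<in> J"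
        using Jc(1)[OF p] by (simp add: lookup_mps_carrier)
    qed
    ultimately have T: "extend_ideal c J \<subseteq> ?T" unfolding extend_ideal_def by (rule R.genideal_minimal)
    show "contract_ideal c (extend_ideal c J) \<subseteq> J"
    proof
      fix p assume "p \<in> contract_ideal c (extend_ideal c J)"
      then have p: "p \<in> carrier (mpoly_ring {1..c})" "truncate c k (lookup p) \<in> J"
        using T by (auto simp: contract_ideal_def)
      show "p \<in> J" by (rule eqm[OF p(2,1)]) (simp add: lookup_truncate)
    qed
  qed
qed

lemma contract_ideal_mono: "I \<subseteq> J \<Longrightarrow> contract_ideal c I \<subseteq> contract_ideal c J"
  by (auto simp: contract_ideal_def)

lemma extend_ideal_mono:
  "I \<subseteq> J \<Longrightarrow> extend_ideal c I \<subseteq> extend_ideal c J"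
  unfolding extend_ideal_def genideal_def by (rule Inter_anti_mono) blast

lemma mutually_inverse_restrict:
  assumes inv: "mutually_inverse f g C D" and eq: "\<And>A. A \<in> C \<Longrightarrow> Q (f A) \<longleftrightarrow> R A"
  shows "mutually_inverse f g {A \<in> C. R A} {B \<in> D. Q B}"
proof -
  have C: "f A \<in> D" "g (f A) = A" if "A \<in> C" for A using inv that by (auto simp: mutually_inverse_def)
  have D: "g B \<in> C" "f (g B) = B" if "B \<in> D" for B using inv that by (auto simp: mutually_inverse_def)
  have "R (g B)" if "B \<in> D" "Q B" for B using eq[OF D(1)[OF that(1)]] D(2)[OF that(1)] that(2) by simp
  moreover have "Q (f A)" if "A \<in> C" "R A" for A using eq that by blast
  ultimately show ?thesis unfolding mutually_inverse_def
    by (intro conjI ballI image_subsetI CollectI) (use C D in blast)+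
qed

lemma contract_extend_hilbert:
  assumes "m \<ge> 1"
  shows "mutually_inverse (contract_ideal c) (extend_ideal c)
    (punctual_hilbert c m :: 'f::field mps set set) (punctual_hilbert_poly c m)"
  unfolding punctual_hilbert_eq punctual_hilbert_poly_eq[OF assms]
  by (rule mutually_inverse_restrict[OF contract_extend_above], subst chain_length_above_eq[OF contract_extend_above])
    (auto intro!: contract_ideal_mono extend_ideal_mono simp: ideals_above_def)

section \<open>Differentiation and Macaulay duality\<close>

lemma multi_iter_add:
  assumes c: "\<And>i j x. D i (D j x) = D j (D i x)"
  shows "multi_iter D (\<alpha> + \<beta>) x = multi_iter D \<alpha> (multi_iter D \<beta> x)"
proof (induction \<alpha> rule: mon_induct)
  case (plus \<alpha> i)
  have "\<alpha> + single i 1 + \<beta> = \<alpha> + \<beta> + single i 1" by (simp only: add_ac)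
  then show ?case using plus by (simp only: multi_iter_plus[of D, OF c])
qed simp

lemmas mi_mpderiv_plus = multi_iter_plus[of mpderiv, OF mpderiv_commute]
lemmas mi_mpderiv_comp = multi_iter_add[of mpderiv, OF mpderiv_commute]

lemma mi_mpderiv_shift: "multi_iter mpderiv (\<alpha> + single i 1) F = multi_iter mpderiv \<alpha> (mpderiv i F)"
proof -
  have "multi_iter mpderiv (single i 1) F = mpderiv i F" using mi_mpderiv_plus[of 0 i F] by simp
  then show ?thesis by (simp add: mi_mpderiv_comp)
qed

lemma lookup_mpderiv: "lookup (mpderiv i F) \<alpha> = of_nat (lookup \<alpha> i + 1) * lookup F (\<alpha> + single i 1)"
proof (induction F rule: pm_induct)
  case (single \<beta> b)
  show ?case
  proof (cases "\<beta> = \<alpha> + single i 1")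
    case True
    then show ?thesis by (simp add: mpderiv_single lookup_add)
  next
    case False
    show ?thesis
    proof (cases "lookup \<beta> i = 0")
      case False
      then have "\<beta> - single i 1 + single i 1 = \<beta>"
        by (intro poly_mapping_eqI) (auto simp: lookup_add lookup_minus lookup_single when_def)
      then have "\<beta> - single i 1 \<noteq> \<alpha>" using \<open>\<beta> \<noteq> _\<close> by auto
      then show ?thesis using \<open>\<beta> \<noteq> _\<close> by (simp add: mpderiv_single lookup_single when_def)
    qed (use False in \<open>simp add: mpderiv_single lookup_single when_def\<close>)
  qed
qed (simp add: mpderiv_add lookup_add distrib_left)

definition mfact :: "mon \<Rightarrow> nat" where
  "mfact \<alpha> = (\<Prod>i\<in>keys \<alpha>. fact (lookup \<alpha> i))"

lemma mfact_nonzero [simp]: "mfact \<alpha> \<noteq> 0"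
  by (simp add: mfact_def)

lemma mfact_0 [simp]: "mfact 0 = 1"
  by (simp add: mfact_def)

lemma mfact_plus: "mfact (\<alpha> + single i 1) = (lookup \<alpha> i + 1) * mfact \<alpha>"
proof -
  have e: "mfact \<beta> = (\<Prod>j\<in>insert i (keys \<alpha>). fact (lookup \<beta> j))" if "keys \<beta> \<subseteq> insert i (keys \<alpha>)" for \<beta>
    unfolding mfact_def by (rule prod.mono_neutral_left) (use that in \<open>auto simp: in_keys_iff\<close>)
  have f: "fact (n + 1) = (n + 1) * (fact n :: nat)" for n by (simp add: One_nat_def)
  have l: "lookup (\<alpha> + single i 1) i = lookup \<alpha> i + 1" by (simp add: lookup_add)
  have "mfact (\<alpha> + single i 1) = (\<Prod>j\<in>insert i (keys \<alpha>). fact (lookup (\<alpha> + single i 1) j))"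
    by (rule e) (auto simp: mon_keys_plus)
  also have "(\<Prod>j\<in>insert i (keys \<alpha>). fact (lookup (\<alpha> + single i 1) j)) = fact (lookup (\<alpha> + single i 1) i) * (\<Prod>j\<in>keys \<alpha> - {i}. fact (lookup (\<alpha> + single i 1) j))"
    by (subst prod.insert_remove) auto
  also have "(\<Prod>j\<in>keys \<alpha> - {i}. fact (lookup (\<alpha> + single i 1) j)) = (\<Prod>j\<in>keys \<alpha> - {i}. fact (lookup \<alpha> j))"
    by (rule prod.cong) (auto simp: lookup_add lookup_single when_def)
  also have "fact (lookup (\<alpha> + single i 1) i) * \<dots> = (lookup \<alpha> i + 1) * (fact (lookup \<alpha> i) * (\<Prod>j\<in>keys \<alpha> - {i}. fact (lookup \<alpha> j)))"
    by (simp only: l f mult.assoc)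
  also have "fact (lookup \<alpha> i) * (\<Prod>j\<in>keys \<alpha> - {i}. fact (lookup \<alpha> j)) = (\<Prod>j\<in>insert i (keys \<alpha>). fact (lookup \<alpha> j))"
    by (subst prod.insert_remove) auto
  also have "\<dots> = mfact \<alpha>" by (rule e[symmetric]) auto
  finally show ?thesis .
qed

text \<open>Induction on \<open>\<alpha>\<close>, moving one derivative at a time onto \<open>F\<close>.\<close>

lemma lookup_0_mi_mpderiv: "lookup (multi_iter mpderiv \<alpha> F) 0 = of_nat (mfact \<alpha>) * lookup F \<alpha>"
proof (induction \<alpha> arbitrary: F rule: mon_induct)
  case (plus \<alpha> i)
  show ?case unfolding mi_mpderiv_shift plus mfact_plus by (simp add: lookup_mpderiv mult_ac)
qed simp

text \<open>Multiplying by \<open>\<beta>!\<close> avoids the falling factorials of the usual formula: both sides are the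
  constant term of \<open>\<partial>\<^sup>\<alpha>\<^sup>+\<^sup>\<beta> F\<close>.\<close>

lemma lookup_mi_mpderiv:
  "of_nat (mfact \<beta>) * lookup (multi_iter mpderiv \<alpha> F) \<beta> = of_nat (mfact (\<alpha> + \<beta>)) * lookup F (\<alpha> + \<beta>)"
  unfolding lookup_0_mi_mpderiv[symmetric] by (simp add: mi_mpderiv_comp add.commute[of \<alpha>])

lemma mi_mpderiv_single_add:
  fixes b :: "'f::field_char_0"
  shows "multi_iter mpderiv \<beta> (single (\<beta> + \<delta>) b) = single \<delta> (b * of_nat (mfact (\<beta> + \<delta>)) / of_nat (mfact \<delta>))"
proof (rule poly_mapping_eqI)
  fix \<eta>
  show "lookup (multi_iter mpderiv \<beta> (single (\<beta> + \<delta>) b)) \<eta> = lookup (single \<delta> (b * of_nat (mfact (\<beta> + \<delta>)) / of_nat (mfact \<delta>))) \<eta>"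
    using lookup_mi_mpderiv[of \<eta> \<beta> "single (\<beta> + \<delta>) b"]
    by (auto simp: lookup_single when_def field_simps)
qed

lemma mi_mpderiv_carrier: "F \<in> carrier (mpoly_ring V) \<Longrightarrow> multi_iter mpderiv \<alpha> F \<in> carrier (mpoly_ring V)"
  by (induction \<alpha> rule: mon_induct) (simp_all only: mi_mpderiv_plus mpoly_deriv multi_iter_0 id_apply)

lemma mscale_simps:
  "mscale a (p + q) = mscale a p + mscale a q" "mscale (a + b) p = mscale a p + mscale b p"
  "mscale a 0 = 0" "mscale 0 p = 0" "mscale a (single \<alpha> b) = single \<alpha> (a * b)"
  by (simp_all add: mscale_def mconst_simps algebra_simps) (simp add: mconst_def mult_single)

lemma mscale_mult: "mscale a p * q = mscale a (p * q)" "p * mscale a q = mscale a (p * q)"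
  by (simp_all add: mscale_def mult_ac)

lemma mscale_mscale: "mscale a (mscale b p) = mscale (a * b) p"
  by (simp add: mscale_def mconst_simps mult_ac)

lemma mscale_sum: "mscale a (sum f T) = (\<Sum>i\<in>T. mscale a (f i))"
  by (simp add: mscale_def sum_distrib_left)

lemma mscale_sum_left: "mscale (sum a T) f = (\<Sum>i\<in>T. mscale (a i) f)"
  by (induction T rule: infinite_finite_induct) (simp_all add: mscale_simps)

lemma mpderiv_mconst: "mpderiv i (mconst a) = 0"
  by (simp add: mconst_def mpderiv_single)

lemma series_act_eq:
  assumes "finite A" "{\<alpha>. multi_iter mpderiv \<alpha> F \<noteq> 0} \<subseteq> A"
  shows "series_act f F = (\<Sum>\<alpha>\<in>A. mscale (f \<alpha>) (multi_iter mpderiv \<alpha> F))"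
  unfolding series_act_def by (rule sum.mono_neutral_left) (use assms in \<open>auto simp: mscale_simps\<close>)

lemma series_act_add: "series_act f (F + G) = series_act f F + series_act f G"
proof -
  let ?A = "{\<alpha>. multi_iter mpderiv \<alpha> F \<noteq> 0} \<union> {\<alpha>. multi_iter mpderiv \<alpha> G \<noteq> 0}"
  have A: "finite ?A" by (simp add: finite_nonzero_derivs)
  have "series_act f (F + G) = (\<Sum>\<alpha>\<in>?A. mscale (f \<alpha>) (multi_iter mpderiv \<alpha> (F + G)))"
    "series_act f F = (\<Sum>\<alpha>\<in>?A. mscale (f \<alpha>) (multi_iter mpderiv \<alpha> F))"
    "series_act f G = (\<Sum>\<alpha>\<in>?A. mscale (f \<alpha>) (multi_iter mpderiv \<alpha> G))"
    by (rule series_act_eq[OF A]; auto simp: mi_mpderiv_add)+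
  then show ?thesis by (simp add: mi_mpderiv_add mscale_simps sum.distrib)
qed

lemma series_act_mscale:
  fixes F :: "'f::field mpol"
  shows "series_act f (mscale a F) = mscale a (series_act f F)"
proof -
  have m: "multi_iter mpderiv \<alpha> (mscale a F) = mscale a (multi_iter mpderiv \<alpha> F)" for \<alpha> and a :: 'f and F :: "'f mpol"
  proof -
    have d: "mpderiv i (mscale a F) = mscale a (mpderiv i F)" for i F
      by (simp add: mscale_def mpderiv_mult mpderiv_mconst)
    show ?thesis by (induction \<alpha> rule: mon_induct) (simp_all only: mi_mpderiv_plus d multi_iter_0 id_apply)
  qed
  have "series_act f (mscale a F) = (\<Sum>\<alpha>\<in>{\<alpha>. multi_iter mpderiv \<alpha> F \<noteq> 0}. mscale (f \<alpha>) (multi_iter mpderiv \<alpha> (mscale a F)))"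
    by (rule series_act_eq[OF finite_nonzero_derivs]) (auto simp: m mscale_simps)
  also have "\<dots> = mscale a (series_act f F)"
    unfolding series_act_def mscale_sum by (rule sum.cong) (simp_all add: m mscale_mscale mult.commute)
  finally show ?thesis .
qed

lemma series_act_carrier: "F \<in> carrier (mpoly_ring V) \<Longrightarrow> series_act f F \<in> carrier (mpoly_ring V)"
  unfolding series_act_def by (intro mpoly_sum mpoly_mscale mi_mpderiv_carrier)

lemma series_act_monomial: "series_act (lookup (single \<beta> 1)) F = multi_iter mpderiv \<beta> F"
proof -
  have "series_act (lookup (single \<beta> 1)) F =
      (\<Sum>\<alpha>\<in>insert \<beta> {\<alpha>. multi_iter mpderiv \<alpha> F \<noteq> 0}. mscale (lookup (single \<beta> 1) \<alpha>) (multi_iter mpderiv \<alpha> F))"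
    by (rule series_act_eq) (auto simp: finite_nonzero_derivs)
  also have "\<dots> = (\<Sum>\<alpha>\<in>insert \<beta> {\<alpha>. multi_iter mpderiv \<alpha> F \<noteq> 0}. if \<alpha> = \<beta> then multi_iter mpderiv \<beta> F else 0)"
    by (rule sum.cong) (auto simp: lookup_single when_def mscale_simps mscale_def mconst_simps)
  finally show ?thesis by (simp add: finite_nonzero_derivs)
qed

text \<open>The constant term of \<open>f \<bullet> F\<close>, see \<open>pairing_eq\<close>; the weights \<open>\<alpha>!\<close> are invertible in
  characteristic zero.\<close>

definition pairing :: "'f::field mps \<Rightarrow> 'f mpol \<Rightarrow> 'f" where
  "pairing f F = (\<Sum>\<alpha>\<in>keys F. f \<alpha> * of_nat (mfact \<alpha>) * lookup F \<alpha>)"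

lemma pairing_add: "pairing f (F + G) = pairing f F + pairing f G"
  unfolding pairing_def by (rule keys_sum_add) (auto simp: distrib_left)

lemma pairing_single: "pairing f (single \<alpha> a) = f \<alpha> * of_nat (mfact \<alpha>) * a"
  unfolding pairing_def by (rule keys_sum_single) simp

lemma pairing_0 [simp]: "pairing f 0 = 0"
  by (simp add: pairing_def)

lemma pairing_sum: "pairing f (sum F S) = (\<Sum>i\<in>S. pairing f (F i))"
  by (induction S rule: infinite_finite_induct) (simp_all add: pairing_add)

lemma pairing_mscale: "pairing f (mscale a F) = a * pairing f F"
  by (induction F rule: pm_induct) (simp_all add: mscale_simps pairing_add pairing_single algebra_simps)

lemma pairing_monomial: "pairing (lookup (single \<alpha> 1)) F = of_nat (mfact \<alpha>) * lookup F \<alpha>"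
  by (induction F rule: pm_induct)
    (auto simp: pairing_add pairing_single lookup_add distrib_left lookup_single when_def)

lemma pairing_eq: "lookup (series_act f F) 0 = pairing f F"
proof (induction F rule: pm_induct)
  case (single \<beta> b)
  have "lookup (series_act f (single \<beta> b)) 0
      = (\<Sum>\<alpha>\<in>insert \<beta> {\<alpha>. multi_iter mpderiv \<alpha> (single \<beta> b) \<noteq> 0}. f \<alpha> * (of_nat (mfact \<alpha>) * lookup (single \<beta> b) \<alpha>))"
    by (subst series_act_eq[of "insert \<beta> {\<alpha>. multi_iter mpderiv \<alpha> (single \<beta> b) \<noteq> 0}"])
      (auto simp: finite_nonzero_derivs lookup_sum lookup_mscale lookup_0_mi_mpderiv)
  also have "\<dots> = (\<Sum>\<alpha>\<in>insert \<beta> {\<alpha>. multi_iter mpderiv \<alpha> (single \<beta> b) \<noteq> 0}. if \<alpha> = \<beta> then f \<beta> * of_nat (mfact \<beta>) * b else 0)"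
    by (rule sum.cong) (auto simp: lookup_single when_def)
  finally show ?case by (simp add: finite_nonzero_derivs pairing_single)
qed (simp add: series_act_add lookup_add pairing_add)

text \<open>The action on polynomials is adjoint to multiplication of power series. On \<open>z\<^sup>\<gamma>\<close> both sides are
  sums over the factorizations \<open>\<beta> + \<delta> = \<gamma>\<close>.\<close>

lemma pairing_mult:
  fixes f g :: "'f::field_char_0 mps"
  shows "pairing (mps_mult f g) F = pairing g (series_act f F)"
proof (induction F rule: pm_induct)
  case (single \<gamma> b)
  let ?D = "{(\<beta>, \<delta>). \<beta> + \<delta> = \<gamma>}"
  have sub: "{\<alpha>. multi_iter mpderiv \<alpha> (single \<gamma> b) \<noteq> 0} \<subseteq> fst ` ?D"
  proof
    fix \<alpha> assume "\<alpha> \<in> {\<alpha>. multi_iter mpderiv \<alpha> (single \<gamma> b) \<noteq> 0}"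
    then obtain \<beta> where "lookup (multi_iter mpderiv \<alpha> (single \<gamma> b)) \<beta> \<noteq> 0"
      by (auto simp: poly_mapping_eq_iff fun_eq_iff)
    then have "lookup (single \<gamma> b) (\<alpha> + \<beta>) \<noteq> 0"
      using lookup_mi_mpderiv[of \<beta> \<alpha> "single \<gamma> b"] by auto
    then have "(\<alpha>, \<beta>) \<in> ?D" by (auto simp: lookup_single when_def split: if_splits)
    then show "\<alpha> \<in> fst ` ?D" by force
  qed
  have "inj_on fst ?D" by (auto simp: inj_on_def)
  then have "series_act f (single \<gamma> b) = (\<Sum>p\<in>?D. mscale (f (fst p)) (multi_iter mpderiv (fst p) (single \<gamma> b)))"
    by (subst series_act_eq[OF _ sub]) (auto simp: finite_mon_decomp sum.reindex)
  also have "\<dots> = (\<Sum>p\<in>?D. single (snd p) (f (fst p) * (b * of_nat (mfact \<gamma>) / of_nat (mfact (snd p)))))"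
    by (rule sum.cong) (auto simp: mi_mpderiv_single_add mscale_simps)
  finally have "pairing g (series_act f (single \<gamma> b)) = (\<Sum>p\<in>?D. f (fst p) * g (snd p) * (of_nat (mfact \<gamma>) * b))"
    by (simp add: pairing_sum pairing_single mult_ac)
  then show ?case by (simp add: pairing_single mps_mult_def split_def sum_distrib_left sum_distrib_right mult_ac)
qed (simp add: series_act_add pairing_add)

lemma pairing_mpderiv:
  fixes f :: "'f::field_char_0 mps"
  shows "pairing f (multi_iter mpderiv \<beta> F) = pairing (mps_mult (lookup (single \<beta> 1)) f) F"
  by (simp add: pairing_mult series_act_monomial)

text \<open>By adjointness, the coefficient of \<open>z\<^sup>\<beta>\<close> in \<open>f \<bullet> F\<close> is, up to \<open>\<beta>!\<close>, the pairing of \<open>y\<^sup>\<beta> f\<close> with \<open>F\<close>.\<close>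

lemma series_act_eq_0_iff:
  fixes F :: "'f::field_char_0 mpol"
  assumes "F \<in> carrier (mpoly_ring V)"
  shows "series_act f F = 0 \<longleftrightarrow> (\<forall>\<beta>. keys \<beta> \<subseteq> V \<longrightarrow> pairing (mps_mult f (lookup (single \<beta> 1))) F = 0)"
proof -
  have "pairing (mps_mult f (lookup (single \<beta> 1))) F = of_nat (mfact \<beta>) * lookup (series_act f F) \<beta>" for \<beta>
    by (simp add: pairing_mult pairing_monomial)
  then have "?thesis \<longleftrightarrow> (series_act f F = 0 \<longleftrightarrow> (\<forall>\<beta>. keys \<beta> \<subseteq> V \<longrightarrow> lookup (series_act f F) \<beta> = 0))"
    by simp
  moreover have "lookup (series_act f F) \<beta> = 0" if "\<not> keys \<beta> \<subseteq> V" for \<beta>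
    using series_act_carrier[OF assms, of f] that by (auto simp: mpoly_carrier_iff)
  moreover have "series_act f F = 0 \<longleftrightarrow> (\<forall>\<beta>. lookup (series_act f F) \<beta> = 0)"
    by (metis lookup_zero poly_mapping_eqI)
  ultimately show ?thesis by blast
qed

text \<open>An ideal contains \<open>y\<^sup>\<beta> f\<close> together with \<open>f\<close>, so all coefficients of \<open>f \<bullet> F\<close> are controlled by pairings.\<close>

lemma inverse_system_eq:
  fixes I :: "'f::field_char_0 mps set"
  assumes I: "ideal I (mps_ring {1..c})"
  shows "inverse_system c I = {F \<in> carrier (mpoly_ring {1..c}). \<forall>f\<in>I. pairing f F = 0}"
proof -
  have "mps_mult f (lookup (single \<beta> 1)) \<in> I" if "f \<in> I" "keys \<beta> \<subseteq> {1..c}" for f \<beta>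
    by (intro ideal_mpsD(5)[OF I] that) (simp add: lookup_mps_carrier mpoly_single that)
  then have "(\<forall>f\<in>I. series_act f F = 0) \<longleftrightarrow> (\<forall>f\<in>I. pairing f F = 0)" if "F \<in> carrier (mpoly_ring {1..c})" for F
    using series_act_eq_0_iff[OF that] pairing_eq by (metis lookup_zero)
  then show ?thesis by (auto simp: inverse_system_def)
qed

text \<open>The family that corresponds to the ideals containing all series of order at least \<open>k\<close>.\<close>

definition dual_spaces :: "nat \<Rightarrow> nat \<Rightarrow> 'f::field mpol set set" where
  "dual_spaces c k = {V. (\<forall>F\<in>V. F \<in> carrier (mpoly_ring {1..c}) \<and> (\<forall>\<alpha>. k \<le> mdeg \<alpha> \<longrightarrow> lookup F \<alpha> = 0)) \<and>
     mpol_subspace V \<and> (\<forall>i\<in>{1..c}. \<forall>F\<in>V. mpderiv i F \<in> V)}"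

lemma mi_mpderiv_in:
  assumes "\<forall>i\<in>{1..c}. \<forall>F\<in>V. mpderiv i F \<in> V" "F \<in> V" "keys \<alpha> \<subseteq> {1..c}"
  shows "multi_iter mpderiv \<alpha> F \<in> V"
  using assms(3)
proof (induction \<alpha> rule: mon_induct)
  case (plus \<alpha> i)
  then show ?case using assms(1) unfolding mi_mpderiv_plus by (auto simp: mon_keys_plus)
qed (use assms(2) in simp)

text \<open>Here the coefficients of \<open>f \<bullet> F\<close> are pairings of \<open>f\<close> with derivatives of \<open>F\<close>, which lie in \<open>V\<close>.\<close>

lemma annihilator_eq:
  fixes V :: "'f::field_char_0 mpol set"
  assumes "V \<subseteq> carrier (mpoly_ring {1..c})" "\<forall>i\<in>{1..c}. \<forall>F\<in>V. mpderiv i F \<in> V"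
  shows "annihilator c V = {f \<in> carrier (mps_ring {1..c}). \<forall>F\<in>V. pairing f F = 0}"
proof -
  have p: "pairing (mps_mult f (lookup (single \<beta> 1))) F = pairing f (multi_iter mpderiv \<beta> F)"
    for f :: "'f mps" and F \<beta>
    using mps_mult_commute[of f "lookup (single \<beta> 1)"] by (simp add: pairing_mpderiv)
  have "(\<forall>F\<in>V. series_act f F = 0) \<longleftrightarrow> (\<forall>F\<in>V. pairing f F = 0)" for f
  proof
    assume zero: "\<forall>F\<in>V. pairing f F = 0"
    show "\<forall>F\<in>V. series_act f F = 0"
    proof
      fix F assume F: "F \<in> V"
      then have "F \<in> carrier (mpoly_ring {1..c})" using assms(1) by blast
      then show "series_act f F = 0"
        unfolding series_act_eq_0_iff[OF \<open>F \<in> carrier _\<close>] p using zero mi_mpderiv_in[OF assms(2) F] by blast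
    qed
  next
    assume "\<forall>F\<in>V. series_act f F = 0"
    then show "\<forall>F\<in>V. pairing f F = 0" by (simp add: pairing_eq[symmetric])
  qed
  then show ?thesis unfolding annihilator_def by simp
qed

lemma separating_functional:
  fixes V :: "'f::field mpol set"
  assumes V: "mpol_subspace V" and G: "G \<notin> V"
  obtains \<phi> where "\<And>x y. \<phi> (x + y) = \<phi> x + \<phi> y" "\<And>a x. \<phi> (mscale a x) = a * \<phi> x"
    "\<And>x. x \<in> V \<Longrightarrow> \<phi> x = 0" "\<phi> G = (1::'f)"
proof -
  interpret F: vector_space "(*) :: 'f \<Rightarrow> 'f \<Rightarrow> 'f" by unfold_locales (auto simp: algebra_simps)
  interpret pair: vector_space_pair "mscale :: 'f \<Rightarrow> 'f mpol \<Rightarrow> _" "(*) :: 'f \<Rightarrow> 'f \<Rightarrow> 'f" ..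
  obtain B where B: "B \<subseteq> V" "\<not> mpol_dependent B" "V \<subseteq> mpol_span B" by (rule mpol.basis_exists[of V])
  have "mpol_span B \<subseteq> V" by (rule mpol.span_minimal[OF B(1) V])
  then have "\<not> mpol_dependent (insert G B)" using G B mpol.independent_insertI by blast
  then have "\<not> module.dependent mscale (insert G B)" by (unfold mpol_dependent_def)
  from pair.linear_independent_extend[OF this, of "\<lambda>x. if x = G then 1 else 0"]
  obtain \<phi> where \<phi>: "Vector_Spaces.linear mscale (*) \<phi>" "\<And>x. x \<in> insert G B \<Longrightarrow> \<phi> x = (if x = G then 1 else 0)"
    by blast
  interpret \<phi>: Vector_Spaces.linear mscale "(*)" \<phi> by (rule \<phi>(1))
  have zero: "\<phi> x = 0" if "x \<in> mpol_span B" for x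
    by (rule \<phi>.eq_0_on_span[OF _ that[unfolded mpol_span_def]]) (use \<phi>(2) G B(1) in auto)
  show thesis
    by (rule that[of \<phi>]) (use \<phi>.add \<phi>.scale \<phi>(2)[of G] B(3) zero in auto)
qed

lemma functional_expand:
  fixes \<phi> :: "'f::field mpol \<Rightarrow> 'f"
  assumes "\<And>x y. \<phi> (x + y) = \<phi> x + \<phi> y" "\<And>a x. \<phi> (mscale a x) = a * \<phi> x"
  shows "\<phi> F = (\<Sum>\<alpha>\<in>keys F. \<phi> (single \<alpha> 1) * lookup F \<alpha>)"
proof (induction F rule: pm_induct)
  case (single \<alpha> a)
  have "\<phi> (single \<alpha> a) = a * \<phi> (single \<alpha> 1)"
    using assms(2)[of a "single \<alpha> 1"] by (simp add: mscale_simps)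
  then show ?case by (subst keys_sum_single) auto
next
  case (add p q)
  then show ?case using assms(1) by (subst keys_sum_add) (auto simp: algebra_simps)
qed

text \<open>Every linear functional on \<open>\<F>[z]\<close> is the pairing with a power series, so a polynomial
  outside \<open>V\<close> is separated from \<open>V\<close> by an element of the annihilator.\<close>

lemma inverse_system_annihilator:
  fixes V :: "'f::field_char_0 mpol set"
  assumes V: "V \<subseteq> carrier (mpoly_ring {1..c})" "\<forall>i\<in>{1..c}. \<forall>F\<in>V. mpderiv i F \<in> V" "mpol_subspace V"
    and I: "ideal (annihilator c V) (mps_ring {1..c})"
  shows "inverse_system c (annihilator c V) = V"
proof
  show "V \<subseteq> inverse_system c (annihilator c V)" using V(1) by (auto simp: inverse_system_def annihilator_def)
  show "inverse_system c (annihilator c V) \<subseteq> V"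
  proof (rule ccontr)
    assume "\<not> inverse_system c (annihilator c V) \<subseteq> V"
    then obtain G where G: "G \<in> inverse_system c (annihilator c V)" "G \<notin> V" by blast
    obtain \<phi> where \<phi>: "\<And>x y. \<phi> (x + y) = \<phi> x + \<phi> y" "\<And>a x. \<phi> (mscale a x) = a * \<phi> x"
      "\<And>x. x \<in> V \<Longrightarrow> \<phi> x = 0" "\<phi> G = (1::'f)" using separating_functional[OF V(3) G(2)] by blast
    define f where "f \<alpha> = (if keys \<alpha> \<subseteq> {1..c} then \<phi> (single \<alpha> 1) / of_nat (mfact \<alpha>) else 0)" for \<alpha>
    have p: "pairing f F = \<phi> F" if "F \<in> carrier (mpoly_ring {1..c})" for F
      unfolding functional_expand[OF \<phi>(1,2), of F] pairing_def
      by (rule sum.cong) (use that in \<open>auto simp: f_def carrier_mpoly_ring\<close>)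
    have "f \<in> carrier (mps_ring {1..c})" by (auto simp: f_def mps_carrier_iff)
    then have "f \<in> annihilator c V" using p V(1) \<phi>(3) unfolding annihilator_eq[OF V(1,2)] by auto
    then have "pairing f G = 0" using G(1) unfolding inverse_system_eq[OF I] by auto
    moreover have "G \<in> carrier (mpoly_ring {1..c})" using G(1) by (simp add: inverse_system_def)
    ultimately show False using p \<phi>(4) by simp
  qed
qed

lemma ideal_annihilator:
  fixes V :: "'f::field_char_0 mpol set"
  assumes "V \<subseteq> carrier (mpoly_ring {1..c})" "\<forall>i\<in>{1..c}. \<forall>F\<in>V. mpderiv i F \<in> V"
  shows "ideal (annihilator c V) (mps_ring {1..c})"
  unfolding ideal_mps_iff
proof (intro conjI ballI)
  note eq = annihilator_eq[OF assms]
  show "(\<lambda>_. 0) \<in> annihilator c V" by (simp add: eq pairing_def mps_carrier_iff)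
  show "(\<lambda>\<alpha>. f \<alpha> + g \<alpha>) \<in> annihilator c V" if "f \<in> annihilator c V" "g \<in> annihilator c V" for f g
    using that by (auto simp: eq pairing_def distrib_right sum.distrib intro: mps_add_closed)
  show "mps_mult r f \<in> annihilator c V" if "r \<in> carrier (mps_ring {1..c})" "f \<in> annihilator c V" for r f
  proof -
    have "pairing (mps_mult f r) F = 0" if "F \<in> V" for F
      using \<open>f \<in> annihilator c V\<close> that by (simp add: pairing_mult annihilator_def)
    then show ?thesis using that by (auto simp: eq mps_mult_commute[of r f] intro: mps_mult_closed)
  qed
qed (auto simp: annihilator_def)

text \<open>A series outside \<open>I\<close> has a truncation outside \<open>I\<close>. A functional on polynomials that vanishes on
  the polynomials in \<open>I\<close> but not on this truncation depends only on the coefficients of degree less than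
  \<open>k\<close>, once composed with truncation, and so is the pairing with a polynomial of \<open>I\<^sup>\<bottom>\<close>.\<close>

lemma annihilator_inverse_system:
  fixes I :: "'f::field_char_0 mps set"
  assumes "I \<in> series_ideals_above c k" and V: "inverse_system c I \<in> dual_spaces c k"
  shows "annihilator c (inverse_system c I) = I"
proof
  have I: "ideal I (mps_ring {1..c})" "order_ideal_ps {1..c} k \<subseteq> I"
    using assms by (auto simp: series_ideals_above_def)
  show "I \<subseteq> annihilator c (inverse_system c I)"
    using ideal_mpsD(1)[OF I(1)] by (auto simp: inverse_system_def annihilator_def)
  show "annihilator c (inverse_system c I) \<subseteq> I"
  proof (rule ccontr)
    assume "\<not> annihilator c (inverse_system c I) \<subseteq> I"
    then obtain g where g: "g \<in> annihilator c (inverse_system c I)" "g \<notin> I" by blast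
    then have gc: "g \<in> carrier (mps_ring {1..c})" by (simp add: annihilator_def)
    let ?J = "contract_ideal c I"
    have "?J \<in> ideals_above c k" using contract_extend_above[of c k] assms(1) by (auto simp: mutually_inverse_def)
    then have J: "ideal ?J (mpoly_ring {1..c})" by (simp add: ideals_above_def)
    have sub: "mpol_subspace ?J"
      unfolding mpol.subspace_def mscale_def
      using ideal_mpolyD(2,3)[OF J] ideal_mpolyD(4)[OF J mpoly_mconst] by blast
    have tr: "truncate c k f \<in> ?J \<longleftrightarrow> f \<in> I" if "f \<in> carrier (mps_ring {1..c})" for f
    proof -
      have d: "(\<lambda>\<alpha>. f \<alpha> - lookup (truncate c k f) \<alpha>) \<in> I"
        using truncate_diff[OF that, of k] I(2) by blast
      show ?thesis
      proof
        assume "truncate c k f \<in> ?J"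
        then have "lookup (truncate c k f) \<in> I" by (simp add: contract_ideal_def)
        from ideal_mpsD(3)[OF I(1) this d] show "f \<in> I" by simp
      next
        assume "f \<in> I"
        from ideal_mpsD(6)[OF I(1) this d] show "truncate c k f \<in> ?J" by (simp add: contract_ideal_def truncate_carrier)
      qed
    qed
    have "truncate c k g \<notin> ?J" using tr[OF gc] g(2) by simp
    obtain \<phi> where \<phi>: "\<And>x y. \<phi> (x + y) = \<phi> x + \<phi> y" "\<And>a x. \<phi> (mscale a x) = a * \<phi> x"
      "\<And>x. x \<in> ?J \<Longrightarrow> \<phi> x = 0" "\<phi> (truncate c k g) = (1::'f)"
      using separating_functional[OF sub \<open>truncate c k g \<notin> ?J\<close>] by blast
    define F where "F = truncate c k (\<lambda>\<alpha>. \<phi> (single \<alpha> 1) / of_nat (mfact \<alpha>))"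
    have \<phi>0: "\<phi> 0 = 0" using \<phi>(2)[of 0 0] by (simp add: mscale_simps)
    have \<phi>sum: "\<phi> (sum h S) = (\<Sum>i\<in>S. \<phi> (h i))" for h and S :: "mon set"
      by (induction S rule: infinite_finite_induct) (simp_all add: \<phi> \<phi>0)
    have p: "pairing f F = \<phi> (truncate c k f)" for f
    proof -
      have "pairing f F = (\<Sum>\<alpha> | keys \<alpha> \<subseteq> {1..c} \<and> mdeg \<alpha> < k. f \<alpha> * \<phi> (single \<alpha> 1))"
        unfolding F_def truncate_def pairing_sum by (simp add: pairing_single)
      also have "\<dots> = \<phi> (truncate c k f)"
        unfolding truncate_def \<phi>sum
      proof (rule sum.cong)
        fix \<alpha> show "f \<alpha> * \<phi> (single \<alpha> 1) = \<phi> (single \<alpha> (f \<alpha>))"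
          using \<phi>(2)[of "f \<alpha>" "single \<alpha> 1"] by (simp add: mscale_simps)
      qed simp
      finally show ?thesis .
    qed
    have "F \<in> inverse_system c I" unfolding inverse_system_eq[OF I(1)]
      using p tr \<phi>(3) ideal_mpsD(1)[OF I(1)] by (auto simp: F_def truncate_carrier)
    moreover have "inverse_system c I \<subseteq> carrier (mpoly_ring {1..c})" "\<forall>i\<in>{1..c}. \<forall>F\<in>inverse_system c I. mpderiv i F \<in> inverse_system c I"
      using V by (auto simp: dual_spaces_def)
    ultimately have "pairing g F = 0" using g(1) by (simp add: annihilator_eq)
    then show False using p \<phi>(4) by simp
  qed
qed

lemma macaulay_duality:
  "mutually_inverse (inverse_system c) (annihilator c)
     (series_ideals_above c k :: 'f::field_char_0 mps set set) (dual_spaces c k)"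
proof -
  have inv: "inverse_system c I \<in> dual_spaces c k" if "I \<in> series_ideals_above c k" for I :: "'f mps set"
  proof -
    have I: "ideal I (mps_ring {1..c})" "order_ideal_ps {1..c} k \<subseteq> I"
      using that by (auto simp: series_ideals_above_def)
    note eq = inverse_system_eq[OF I(1)]
    have "lookup F \<alpha> = 0" if F: "F \<in> inverse_system c I" "k \<le> mdeg \<alpha>" for F \<alpha>
    proof (cases "keys \<alpha> \<subseteq> {1..c}")
      case True
      then have "lookup (single \<alpha> 1) \<in> order_ideal_ps {1..c} k"
        using F(2) by (auto simp: order_ideal_ps_def order_ge_def lookup_mps_carrier lookup_single when_def intro!: mpoly_single)
      then have "pairing (lookup (single \<alpha> 1)) F = 0" using F(1) I(2) unfolding eq by blast
      then show ?thesis by (simp add: pairing_monomial)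
    qed (use F in \<open>auto simp: inverse_system_def mpoly_carrier_iff\<close>)
    moreover have "mpol_subspace (inverse_system c I)"
      unfolding mpol.subspace_def eq by (auto simp: pairing_add pairing_mscale intro: mpoly_zero mpoly_add mpoly_mscale)
    moreover have "mpderiv i F \<in> inverse_system c I" if F: "i \<in> {1..c}" "F \<in> inverse_system c I" for i F
    proof -
      have "pairing f (mpderiv i F) = 0" if "f \<in> I" for f
      proof -
        have "mps_mult (lookup (single (single i 1) 1)) f \<in> I"
          by (rule ideal_mpsD(4)[OF I(1) _ that]) (use F(1) in \<open>simp only: lookup_mps_carrier, auto intro: mpoly_single\<close>)
        then have "pairing (mps_mult (lookup (single (single i 1) 1)) f) F = 0" using F(2) by (auto simp: eq)
        then show ?thesis using mi_mpderiv_shift[of 0 i F] by (simp add: pairing_mpderiv[symmetric])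
      qed
      then show ?thesis using F by (auto simp: eq intro: mpoly_deriv)
    qed
    ultimately show ?thesis unfolding dual_spaces_def by (auto simp: inverse_system_def)
  qed
  have ann: "annihilator c V \<in> series_ideals_above c k" "inverse_system c (annihilator c V) = V"
    if "V \<in> dual_spaces c k" for V :: "'f mpol set"
  proof -
    have V: "V \<subseteq> carrier (mpoly_ring {1..c})" "\<forall>i\<in>{1..c}. \<forall>F\<in>V. mpderiv i F \<in> V" "mpol_subspace V"
      and Vd: "\<And>F \<alpha>. F \<in> V \<Longrightarrow> k \<le> mdeg \<alpha> \<Longrightarrow> lookup F \<alpha> = 0"
      using that by (auto simp: dual_spaces_def)
    have "pairing f F = 0" if "f \<in> order_ideal_ps {1..c} k" "F \<in> V" for f F
      unfolding pairing_def using that Vd by (intro sum.neutral) (auto simp: order_ideal_ps_def order_ge_def not_less[symmetric])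
    then have "order_ideal_ps {1..c} k \<subseteq> annihilator c V"
      unfolding annihilator_eq[OF V(1,2)] by (auto simp: order_ideal_ps_def)
    then show "annihilator c V \<in> series_ideals_above c k"
      using ideal_annihilator[OF V(1,2)] by (simp add: series_ideals_above_def)
    show "inverse_system c (annihilator c V) = V"
      by (rule inverse_system_annihilator[OF V ideal_annihilator[OF V(1,2)]])
  qed
  show ?thesis unfolding mutually_inverse_def
    using inv ann annihilator_inverse_system by blast
qed

lemma inverse_system_anti: "I \<subseteq> J \<Longrightarrow> inverse_system c J \<subseteq> inverse_system c I"
  by (auto simp: inverse_system_def)

lemma annihilator_anti: "V \<subseteq> W \<Longrightarrow> annihilator c W \<subseteq> annihilator c V"
  by (auto simp: annihilator_def)

lemma chain_length_dual:
  assumes "I \<in> (series_ideals_above c k :: 'f::field_char_0 mps set set)"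
  shows "chain_length {J \<in> series_ideals_above c k. I \<subseteq> J} = chain_length {W \<in> dual_spaces c k. W \<subseteq> inverse_system c I}"
proof (rule chain_length_eq_anti)
  have M: "inverse_system c J \<in> dual_spaces c k" "annihilator c (inverse_system c J) = J" if "J \<in> series_ideals_above c k" for J :: "'f mps set"
    using macaulay_duality[of c k] that unfolding mutually_inverse_def by auto
  have N: "annihilator c W \<in> series_ideals_above c k" "inverse_system c (annihilator c W) = W" if "W \<in> dual_spaces c k" for W :: "'f mpol set"
    using macaulay_duality[of c k] that unfolding mutually_inverse_def by auto
  show "mutually_inverse (inverse_system c) (annihilator c) {J \<in> series_ideals_above c k. I \<subseteq> J} {W \<in> dual_spaces c k. W \<subseteq> inverse_system c I}"
    unfolding mutually_inverse_def
  proof (intro conjI ballI image_subsetI CollectI)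
    fix W assume "W \<in> {W \<in> dual_spaces c k. W \<subseteq> inverse_system c I}"
    then show "I \<subseteq> annihilator c W" using annihilator_anti[of W "inverse_system c I"] M(2)[OF assms] by auto
  next
    fix J assume "J \<in> {J \<in> series_ideals_above c k. I \<subseteq> J}"
    then show "inverse_system c J \<subseteq> inverse_system c I" "inverse_system c J \<in> dual_spaces c k"
      "annihilator c (inverse_system c J) = J" using inverse_system_anti[of I J] M[of J] by auto
  qed (use N in auto)
qed (auto intro: inverse_system_anti annihilator_anti del: subsetI)

text \<open>A polynomial of least degree in \<open>V - W\<close> has all its derivatives in \<open>W\<close>, so adding it to \<open>W\<close>
  gives a space closed under differentiation.\<close>

lemma dual_space_step:
  fixes W V :: "'f::field_char_0 mpol set"
  assumes W: "W \<in> dual_spaces c k" and V: "V \<in> dual_spaces c k" and lt: "W \<subset> V"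
  obtains F where "F \<in> V" "F \<notin> W" "mpol_span (insert F W) \<in> dual_spaces c k"
proof -
  define d where "d = (LEAST d. \<exists>F\<in>V - W. \<forall>\<alpha>. d \<le> mdeg \<alpha> \<longrightarrow> lookup F \<alpha> = 0)"
  have "\<exists>d. \<exists>F\<in>V - W. \<forall>\<alpha>. d \<le> mdeg \<alpha> \<longrightarrow> lookup F \<alpha> = 0"
  proof -
    obtain F where "F \<in> V - W" using lt by blast
    then show ?thesis using V unfolding dual_spaces_def by blast
  qed
  then have "\<exists>F\<in>V - W. \<forall>\<alpha>. d \<le> mdeg \<alpha> \<longrightarrow> lookup F \<alpha> = 0"
    unfolding d_def by (rule LeastI_ex)
  then obtain F where F: "F \<in> V" "F \<notin> W" "\<And>\<alpha>. d \<le> mdeg \<alpha> \<Longrightarrow> lookup F \<alpha> = 0"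
    by blast
  have min: "G \<in> W" if "G \<in> V" "\<And>\<alpha>. d' \<le> mdeg \<alpha> \<Longrightarrow> lookup G \<alpha> = 0" "d' < d" for G d'
    using that not_less_Least[of d' "\<lambda>d. \<exists>F\<in>V - W. \<forall>\<alpha>. d \<le> mdeg \<alpha> \<longrightarrow> lookup F \<alpha> = 0"] unfolding d_def by blast
  have W': "mpol_subspace W" "W \<subseteq> V" using W lt by (auto simp: dual_spaces_def)
  have V': "mpol_subspace V" "\<And>i G. i \<in> {1..c} \<Longrightarrow> G \<in> V \<Longrightarrow> mpderiv i G \<in> V"
    using V by (auto simp: dual_spaces_def)
  have "d \<noteq> 0"
  proof
    assume "d = 0"
    then have "F = 0" using F(3) by (intro poly_mapping_eqI) simp
    then show False using F(2) mpol.subspace_0[OF W'(1)] by simp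
  qed
  have dF: "mpderiv i F \<in> W" if "i \<in> {1..c}" for i
  proof (rule min[of _ "d - 1"])
    show "mpderiv i F \<in> V" using V'(2) that F(1) by blast
    show "lookup (mpderiv i F) \<alpha> = 0" if "d - 1 \<le> mdeg \<alpha>" for \<alpha>
      using F(3)[of "\<alpha> + single i 1"] that by (simp add: lookup_mpderiv mdeg_add)
  qed (use \<open>d \<noteq> 0\<close> in simp)
  let ?U = "mpol_span (insert F W)"
  have UV: "?U \<subseteq> V" by (rule mpol.span_minimal) (use F W' V' in auto)
  have WU: "W \<subseteq> ?U" using mpol.span_superset[of "insert F W"] by blast
  have "mpderiv i G \<in> ?U" if i: "i \<in> {1..c}" and G: "G \<in> ?U" for i G
  proof -
    obtain a where a: "G - mscale a F \<in> W"
    proof -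
      have "mpol_span W = W" using W'(1) by (simp only: mpol.span_eq_iff)
      then show thesis using G that unfolding mpol.span_insert \<open>mpol_span W = W\<close> by blast
    qed
    have sc: "mpderiv i (mscale a H) = mscale a (mpderiv i H)" for a and H :: "'f mpol"
      by (induction H rule: pm_induct) (simp_all add: mscale_simps mpderiv_single mpderiv_add mult_ac)
    have "mpderiv i (G - mscale a F) \<in> W" using a W i by (auto simp: dual_spaces_def)
    moreover have "mscale a (mpderiv i F) \<in> W" by (rule mpol.subspace_scale[OF W'(1) dF[OF i]])
    ultimately have "mpderiv i (G - mscale a F) + mscale a (mpderiv i F) \<in> W" by (rule mpol.subspace_add[OF W'(1)])
    moreover have "mpderiv i (G - mscale a F) + mscale a (mpderiv i F) = mpderiv i G"
      unfolding sc[symmetric] mpderiv_add[symmetric] by simp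
    ultimately show ?thesis using WU by auto
  qed
  then have "?U \<in> dual_spaces c k" using UV V unfolding dual_spaces_def by (auto simp: mpol.subspace_span)
  then show thesis using that F by blast
qed

lemma dual_space_finite_span:
  assumes "V \<in> dual_spaces c k"
  shows "finite ((\<lambda>\<alpha>. single \<alpha> 1) ` {\<alpha>. keys \<alpha> \<subseteq> {1..c} \<and> mdeg \<alpha> < k})"
    "V \<subseteq> mpol_span ((\<lambda>\<alpha>. single \<alpha> 1) ` {\<alpha>. keys \<alpha> \<subseteq> {1..c} \<and> mdeg \<alpha> < k})"
proof -
  show "finite ((\<lambda>\<alpha>. single \<alpha> 1) ` {\<alpha>. keys \<alpha> \<subseteq> {1..c} \<and> mdeg \<alpha> < k})"
    by (simp add: finite_mon_mdeg)
  show "V \<subseteq> mpol_span ((\<lambda>\<alpha>. single \<alpha> 1) ` {\<alpha>. keys \<alpha> \<subseteq> {1..c} \<and> mdeg \<alpha> < k})"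
  proof
    fix F assume F: "F \<in> V"
    have "(\<Sum>\<alpha>\<in>keys F. mscale (lookup F \<alpha>) (single \<alpha> 1)) \<in> mpol_span ((\<lambda>\<alpha>. single \<alpha> 1) ` {\<alpha>. keys \<alpha> \<subseteq> {1..c} \<and> mdeg \<alpha> < k})"
    proof (intro mpol.span_sum mpol.span_scale mpol.span_base imageI CollectI conjI)
      fix \<alpha> assume \<alpha>: "\<alpha> \<in> keys F"
      then show "keys \<alpha> \<subseteq> {1..c}" "mdeg \<alpha> < k"
        using assms F by (auto simp: dual_spaces_def carrier_mpoly_ring in_keys_iff not_le[symmetric])
    qed
    then show "F \<in> mpol_span ((\<lambda>\<alpha>. single \<alpha> 1) ` {\<alpha>. keys \<alpha> \<subseteq> {1..c} \<and> mdeg \<alpha> < k})"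
      by (simp add: mscale_simps poly_mapping_sum_monomials)
  qed
qed

text \<open>Chains of subspaces are no longer than the dimension, and \<open>dual_space_step\<close> extends a chain
  from \<open>0\<close> by one dimension at a time until it reaches \<open>V\<close>.\<close>

lemma chain_length_dual_spaces:
  fixes V :: "'f::field_char_0 mpol set"
  assumes V: "V \<in> dual_spaces c k"
  shows "chain_length {W \<in> dual_spaces c k. W \<subseteq> V} = enat (mpol_dim V)"
proof (rule antisym)
  have sub: "mpol_subspace W" if "W \<in> dual_spaces c k" for W :: "'f mpol set" using that by (simp add: dual_spaces_def)
  obtain B where B: "B \<subseteq> V" "\<not> mpol_dependent B" "V \<subseteq> mpol_span B" "card B = mpol_dim V"
    by (rule mpol.basis_exists[of V])
  have fB: "finite B" using mpol.independent_span_bound[OF dual_space_finite_span(1)[OF V] B(2)] B(1) dual_space_finite_span(2)[OF V] by blast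
  have bound: "finite A \<and> card A \<le> mpol_dim V" if "\<not> mpol_dependent A" "A \<subseteq> V" for A
    using mpol.independent_span_bound[OF fB that(1)] that(2) B(3,4) by auto
  show "chain_length {W \<in> dual_spaces c k. W \<subseteq> V} \<le> enat (mpol_dim V)"
  proof (rule chain_length_leI)
    fix l :: nat and J assume J: "\<forall>i\<le>l. J i \<in> {W \<in> dual_spaces c k. W \<subseteq> V}" "\<forall>i<l. J i \<subset> J (Suc i)"
    have "\<exists>A. \<not> mpol_dependent A \<and> A \<subseteq> J i \<and> card A = i" if "i \<le> l" for i
      using that
    proof (induction i)
      case 0 then show ?case by (auto intro!: exI[of _ "{}"] simp: mpol.independent_empty)
    next
      case (Suc i)
      then obtain A where A: "\<not> mpol_dependent A" "A \<subseteq> J i" "card A = i" by auto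
      obtain x where x: "x \<in> J (Suc i)" "x \<notin> J i" using J(2) Suc.prems by (meson Suc_le_lessD psubsetE subsetI)
      have "mpol_span A \<subseteq> J i" by (rule mpol.span_minimal[OF A(2)]) (use J Suc.prems sub in auto)
      then have "x \<notin> mpol_span A" using x by blast
      then have i: "\<not> mpol_dependent (insert x A)" "x \<notin> A"
        using A(1) mpol.independent_insertI mpol.span_base by blast+
      have "J i \<subseteq> V" using J(1) Suc.prems by auto
      then have "A \<subseteq> V" using A(2) by blast
      then have "finite A" using bound[OF A(1)] by blast
      moreover have "J i \<subseteq> J (Suc i)" using J(2) Suc.prems Suc_le_lessD psubset_imp_subset by blast
      ultimately show ?case using A x i by (intro exI[of _ "insert x A"]) auto
    qed
    from this[of l] obtain A where A: "\<not> mpol_dependent A" "A \<subseteq> J l" "card A = l" by auto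
    moreover have "J l \<subseteq> V" using J(1) by auto
    ultimately show "enat l \<le> enat (mpol_dim V)" using bound[of A] by auto
  qed
  \<comment> \<open>The spanning set \<open>A\<close> of size at most \<open>l\<close> ensures that the chain has not reached \<open>V\<close> while \<open>l < dim V\<close>.\<close>
  have "\<exists>J. (\<forall>i\<le>l. J i \<in> {W \<in> dual_spaces c k. W \<subseteq> V}) \<and> (\<forall>i<l. J i \<subset> J (Suc i)) \<and>
      (\<exists>A. finite A \<and> card A \<le> l \<and> J l \<subseteq> mpol_span A)" if "l \<le> mpol_dim V" for l
    using that
  proof (induction l)
    case 0
    have "{0} \<in> (dual_spaces c k :: 'f mpol set set)"
      by (auto simp: dual_spaces_def mpoly_zero mpol.subspace_def mscale_simps)
    moreover have "{0} \<subseteq> V" using mpol.subspace_0[OF sub[OF V]] by simp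
    ultimately show ?case by (auto intro!: exI[of _ "\<lambda>_. {0}"] exI[of _ "{}"])
  next
    case (Suc l)
    then obtain J A where J: "\<forall>i\<le>l. J i \<in> {W \<in> dual_spaces c k. W \<subseteq> V}" "\<forall>i<l. J i \<subset> J (Suc i)"
      and A: "finite A" "card A \<le> l" "J l \<subseteq> mpol_span A" by auto
    have "J l \<noteq> V"
    proof
      assume "J l = V"
      then have "mpol_dim V \<le> card A" using mpol.dim_le_card[OF _ A(1)] A(3) by simp
      then show False using A(2) Suc.prems by simp
    qed
    then have "J l \<subset> V" "J l \<in> dual_spaces c k" using J(1) by auto
    then obtain F where F: "F \<in> V" "F \<notin> J l" "mpol_span (insert F (J l)) \<in> dual_spaces c k"
      using dual_space_step[OF _ V] by blast
    let ?U = "mpol_span (insert F (J l))"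
    have "?U \<subseteq> V" by (rule mpol.span_minimal) (use F \<open>J l \<subset> V\<close> sub[OF V] in auto)
    have "J l \<subset> ?U" using mpol.span_superset[of "insert F (J l)"] F(2) by blast
    have "?U \<subseteq> mpol_span (insert F A)"
    proof (rule mpol.span_minimal)
      show "insert F (J l) \<subseteq> mpol_span (insert F A)"
        using A(3) mpol.span_mono[of A "insert F A"] mpol.span_base[of F "insert F A"] by auto
    qed (rule mpol.subspace_span)
    moreover have "finite (insert F A)" "card (insert F A) \<le> Suc l" using A card_insert_le_m1[of "Suc l" A F] by auto
    ultimately show ?case using J \<open>?U \<subseteq> V\<close> \<open>J l \<subset> ?U\<close> F(3)
      by (intro exI[of _ "\<lambda>i. if i \<le> l then J i else ?U"] conjI exI[of _ "insert F A"]) (auto simp: less_Suc_eq)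
  qed
  from this[of "mpol_dim V"] show "enat (mpol_dim V) \<le> chain_length {W \<in> dual_spaces c k. W \<subseteq> V}"
    using chain_length_ge by blast
qed

text \<open>A finite-dimensional \<open>V\<close> has bounded degree, so its annihilator is an ideal of colength \<open>m\<close>; such
  an ideal contains all series of order at least \<open>m\<close>, which bounds the degrees in \<open>V\<close> by \<open>m\<close>.\<close>

lemma diff_closed_subspaces_eq:
  assumes "m \<ge> 1"
  shows "diff_closed_subspaces c m = {V \<in> (dual_spaces c m :: 'f::field_char_0 mpol set set). mpol_dim V = m}"
proof
  show "{V \<in> (dual_spaces c m :: 'f mpol set set). mpol_dim V = m} \<subseteq> diff_closed_subspaces c m"
    by (auto simp: dual_spaces_def diff_closed_subspaces_def)
  show "diff_closed_subspaces c m \<subseteq> {V \<in> (dual_spaces c m :: 'f mpol set set). mpol_dim V = m}"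
  proof
    fix V :: "'f mpol set" assume "V \<in> diff_closed_subspaces c m"
    then have V: "V \<subseteq> carrier (mpoly_ring {1..c})" "mpol_subspace V" "mpol_dim V = m"
      "\<forall>i\<in>{1..c}. \<forall>F\<in>V. mpderiv i F \<in> V" by (auto simp: diff_closed_subspaces_def)
    obtain B where B: "B \<subseteq> V" "\<not> mpol_dependent B" "V \<subseteq> mpol_span B" "card B = mpol_dim V"
      by (rule mpol.basis_exists[of V])
    then have "finite B" using V(3) assms by (metis card.infinite not_one_le_zero)
    \<comment> \<open>A crude bound on the degrees in a basis is enough here.\<close>
    define k where "k = Suc (\<Sum>F\<in>B. \<Sum>\<alpha>\<in>keys F. mdeg \<alpha>)"
    let ?U = "{F :: 'f mpol. \<forall>\<alpha>. k \<le> mdeg \<alpha> \<longrightarrow> lookup F \<alpha> = 0}"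
    have "B \<subseteq> ?U"
    proof clarify
      fix F \<alpha> assume F: "F \<in> B" "k \<le> mdeg \<alpha>"
      show "lookup F \<alpha> = 0"
      proof (rule ccontr)
        assume "lookup F \<alpha> \<noteq> 0"
        then have "mdeg \<alpha> \<le> (\<Sum>\<alpha>\<in>keys F. mdeg \<alpha>)"
          by (intro member_le_sum) (auto simp: in_keys_iff)
        also have "\<dots> \<le> (\<Sum>F\<in>B. \<Sum>\<alpha>\<in>keys F. mdeg \<alpha>)"
          using F(1) \<open>finite B\<close> by (intro member_le_sum[where f = "\<lambda>F. \<Sum>\<alpha>\<in>keys F. mdeg \<alpha>"]) auto
        finally show False using F(2) by (simp add: k_def)
      qed
    qed
    moreover have "mpol_subspace ?U" by (auto simp: mpol.subspace_def lookup_add lookup_mscale)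
    ultimately have "V \<subseteq> ?U" using B(3) mpol.span_minimal by blast
    then have Vk: "V \<in> dual_spaces c k" using V by (auto simp: dual_spaces_def)
    let ?I = "annihilator c V"
    have I: "?I \<in> series_ideals_above c k" "inverse_system c ?I = V"
      using macaulay_duality[of c k] Vk by (auto simp: mutually_inverse_def)
    have "colength (mps_ring {1..c}) ?I = enat m"
      using chain_length_dual[OF I(1)] chain_length_dual_spaces[OF Vk] I(2) V(3) colength_series_ideal[OF I(1)] by simp
    then have "?I \<in> punctual_hilbert c m" using I(1) by (simp add: punctual_hilbert_def series_ideals_above_def)
    then have "?I \<in> series_ideals_above c m" by (simp add: punctual_hilbert_eq)
    then have "inverse_system c ?I \<in> dual_spaces c m" using macaulay_duality[of c m] by (auto simp: mutually_inverse_def)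
    then show "V \<in> {V \<in> dual_spaces c m. mpol_dim V = m}" using I(2) V(3) by simp
  qed
qed

lemma inverse_system_hilbert:
  assumes "m \<ge> 1"
  shows "mutually_inverse (inverse_system c) (annihilator c)
    (punctual_hilbert c m :: 'f::field_char_0 mps set set) (diff_closed_subspaces c m)"
  unfolding punctual_hilbert_eq diff_closed_subspaces_eq[OF assms]
proof (rule mutually_inverse_restrict[OF macaulay_duality])
  fix I :: "'f mps set" assume I: "I \<in> series_ideals_above c m"
  then have "inverse_system c I \<in> dual_spaces c m" using macaulay_duality[of c m] by (auto simp: mutually_inverse_def)
  then show "mpol_dim (inverse_system c I) = m \<longleftrightarrow> chain_length {J \<in> series_ideals_above c m. I \<subseteq> J} = enat m"
    using chain_length_dual[OF I] chain_length_dual_spaces[of "inverse_system c I" c m] by simp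
qed

section \<open>Multiplicity and saturated ideals\<close>

text \<open>Ideals of the localization are generated by their contractions, since \<open>a/s\<close> and \<open>a/1\<close> differ by a unit.\<close>

lemma localization_correspondence:
  fixes A :: "'a::idom ring"
  assumes A: "A = ring_of_type_algebra\<lparr>carrier := C\<rparr>" "cring A" and P: "primeideal P A"
  shows "cring (localization A P)"
    and "mutually_inverse (\<lambda>J. {a \<in> C. Fract a 1 \<in> J}) (\<lambda>J. {Fract a s | a s. a \<in> J \<and> s \<in> C - P})
           {J. ideal J (localization A P)} (saturated_ideals A P)"
proof -
  interpret A: cring A by (rule A(2))
  interpret P: primeideal P A by (rule P)
  have ops: "carrier A = C" "monoid.mult A = (*)" "one A = 1" "ring.zero A = 0" "add A = (+)"
    by (simp_all add: A(1))
  let ?L = "localization A P"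
  let ?D = "C - P"
  have lops: "carrier ?L = {Fract a s | a s. a \<in> C \<and> s \<in> ?D}" "monoid.mult ?L = (*)" "one ?L = 1"
    "ring.zero ?L = 0" "add ?L = (+)"
    by (simp_all add: localization_def ops)
  have C: "0 \<in> C" "1 \<in> C" "\<And>a b. a \<in> C \<Longrightarrow> b \<in> C \<Longrightarrow> a + b \<in> C" "\<And>a b. a \<in> C \<Longrightarrow> b \<in> C \<Longrightarrow> a * b \<in> C"
    using A.zero_closed A.one_closed A.a_closed A.m_closed by (simp_all add: ops)
  have neg: "- a \<in> C" if "a \<in> C" for a
  proof -
    have "\<ominus>\<^bsub>A\<^esub> a + a = 0" "\<ominus>\<^bsub>A\<^esub> a \<in> C"
      using A.l_neg[of a] A.a_inv_closed[of a] that by (simp_all add: ops)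
    then show ?thesis by (metis add_eq_0_iff2)
  qed
  have D: "1 \<in> ?D" "\<And>s t. s \<in> ?D \<Longrightarrow> t \<in> ?D \<Longrightarrow> s * t \<in> ?D" "\<And>s. s \<in> ?D \<Longrightarrow> s \<noteq> 0"
    using P.I_notcarr P.one_imp_carrier P.I_prime P.zero_closed C by (auto simp: ops)
  show L: "cring ?L"
  proof (intro cringI abelian_groupI comm_monoidI; (simp only: lops)?)
    fix x y assume "x \<in> {Fract a s | a s. a \<in> C \<and> s \<in> ?D}" "y \<in> {Fract a s | a s. a \<in> C \<and> s \<in> ?D}"
    then obtain a s b t where *: "x = Fract a s" "y = Fract b t" "a \<in> C" "b \<in> C" "s \<in> ?D" "t \<in> ?D" by auto
    have "x + y = Fract (a * t + b * s) (s * t)" using * D(3) by (simp add: add_fract)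
    moreover have "a * t + b * s \<in> C" "s * t \<in> ?D" using * C D(2) by auto
    ultimately show "x + y \<in> {Fract a s | a s. a \<in> C \<and> s \<in> ?D}" by blast
    have "x * y = Fract (a * b) (s * t)" using * by simp
    then show "x * y \<in> {Fract a s | a s. a \<in> C \<and> s \<in> ?D}" using * C(4) D(2) by blast
  next
    show "0 \<in> {Fract a s | a s. a \<in> C \<and> s \<in> ?D}" using C(1) D(1) unfolding Zero_fract_def by blast
    show "1 \<in> {Fract a s | a s. a \<in> C \<and> s \<in> ?D}" using C(2) D(1) unfolding One_fract_def by blast
    fix x assume "x \<in> {Fract a s | a s. a \<in> C \<and> s \<in> ?D}"
    then obtain a s where "x = Fract a s" "a \<in> C" "s \<in> ?D" by auto
    then have "- x = Fract (- a) s" "- a \<in> C" "s \<in> ?D" using neg by simp_all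
    then have "- x \<in> {Fract a s | a s. a \<in> C \<and> s \<in> ?D}" by blast
    then show "\<exists>y\<in>{Fract a s | a s. a \<in> C \<and> s \<in> ?D}. y + x = 0"
      by (intro bexI[of _ "- x"] add.left_inverse)
  qed (auto simp: algebra_simps)
  have ideal_L: "ideal J ?L \<longleftrightarrow> J \<subseteq> carrier ?L \<and> 0 \<in> J \<and> (\<forall>x\<in>J. \<forall>y\<in>J. x + y \<in> J) \<and>
     (\<forall>r\<in>carrier ?L. \<forall>x\<in>J. r * x \<in> J)" for J
    by (simp add: cring.ideal_iff[OF L] lops(2-))
  have ideal_A: "ideal J A \<longleftrightarrow> J \<subseteq> C \<and> 0 \<in> J \<and> (\<forall>x\<in>J. \<forall>y\<in>J. x + y \<in> J) \<and> (\<forall>r\<in>C. \<forall>x\<in>J. r * x \<in> J)" for J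
    by (simp add: A.ideal_iff ops)
  have sat_A: "J \<in> saturated_ideals A P \<longleftrightarrow> ideal J A \<and> (\<forall>s\<in>?D. \<forall>a\<in>C. s * a \<in> J \<longrightarrow> a \<in> J)" for J
    by (simp add: saturated_ideals_def ops)
  have F: "Fract a s \<in> carrier ?L" if "a \<in> C" "s \<in> ?D" for a s using that unfolding lops(1) by blast
  show "mutually_inverse (\<lambda>J. {a \<in> C. Fract a 1 \<in> J}) (\<lambda>J. {Fract a s | a s. a \<in> J \<and> s \<in> ?D})
           {J. ideal J ?L} (saturated_ideals A P)"
    unfolding mutually_inverse_def
  proof (intro conjI ballI image_subsetI)
    fix J assume "J \<in> {J. ideal J ?L}"
    then have "ideal J ?L" by blast
    then have J: "J \<subseteq> carrier ?L" "0 \<in> J" "\<And>x y. x \<in> J \<Longrightarrow> y \<in> J \<Longrightarrow> x + y \<in> J"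
      "\<And>r x. r \<in> carrier ?L \<Longrightarrow> x \<in> J \<Longrightarrow> r * x \<in> J" unfolding ideal_L by auto
    let ?J = "{a \<in> C. Fract a 1 \<in> J}"
    have up: "Fract a s \<in> J" if "a \<in> ?J" "s \<in> ?D" for a s
      using J(4)[OF F[OF C(2) that(2)], of "Fract a 1"] that by simp
    have down: "a \<in> ?J" if "Fract a s \<in> J" "a \<in> C" "s \<in> ?D" for a s
    proof -
      have "Fract s 1 * Fract a s \<in> J" by (rule J(4)[OF F]) (use that D(1) in auto)
      moreover have "Fract s 1 * Fract a s = Fract a 1" using D(3)[OF that(3)] by (simp add: eq_fract)
      ultimately show ?thesis using that by simp
    qed
    show "?J \<in> saturated_ideals A P" unfolding sat_A ideal_A
    proof (intro conjI ballI impI)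
      show "0 \<in> ?J" using J(2) C(1) by (simp add: Zero_fract_def)
      show "x + y \<in> ?J" if "x \<in> ?J" "y \<in> ?J" for x y
        using J(3)[of "Fract x 1" "Fract y 1"] that C(3) by simp
      show "r * x \<in> ?J" if "r \<in> C" "x \<in> ?J" for r x
        using J(4)[OF F[OF that(1) D(1)], of "Fract x 1"] that C(4) by simp
      show "a \<in> ?J" if "s \<in> ?D" "a \<in> C" "s * a \<in> ?J" for s a
      proof -
        have "Fract (s * a) s = Fract a 1" using D(3)[OF that(1)] by (simp add: eq_fract)
        then show ?thesis using up[OF that(3,1)] that(2) by simp
      qed
    qed auto
    show "{Fract a s | a s. a \<in> ?J \<and> s \<in> ?D} = J"
      using up down J(1) unfolding lops(1) by blast
  next
    fix J assume "J \<in> saturated_ideals A P"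
    then have J: "J \<subseteq> C" "0 \<in> J" "\<And>x y. x \<in> J \<Longrightarrow> y \<in> J \<Longrightarrow> x + y \<in> J"
      "\<And>r x. r \<in> C \<Longrightarrow> x \<in> J \<Longrightarrow> r * x \<in> J" "\<And>s a. s \<in> ?D \<Longrightarrow> a \<in> C \<Longrightarrow> s * a \<in> J \<Longrightarrow> a \<in> J"
      unfolding sat_A ideal_A by auto
    let ?J = "{Fract a s | a s. a \<in> J \<and> s \<in> ?D}"
    have "ideal ?J ?L" unfolding ideal_L
    proof (intro conjI ballI)
      show "?J \<subseteq> carrier ?L" using J(1) unfolding lops(1) by blast
      show "0 \<in> ?J" using J(2) D(1) unfolding Zero_fract_def by blast
      fix x y assume "x \<in> ?J" "y \<in> ?J"
      then obtain a s b t where *: "x = Fract a s" "y = Fract b t" "a \<in> J" "b \<in> J" "s \<in> ?D" "t \<in> ?D" by auto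
      have "x + y = Fract (t * a + s * b) (s * t)" using * D(3) by (simp add: add_fract mult.commute)
      moreover have "t * a + s * b \<in> J" using * J(3,4) by auto
      ultimately show "x + y \<in> ?J" using D(2)[OF *(5,6)] by blast
    next
      fix r x assume "r \<in> carrier ?L" "x \<in> ?J"
      then obtain a s b t where *: "x = Fract a s" "r = Fract b t" "a \<in> J" "b \<in> C" "s \<in> ?D" "t \<in> ?D"
        unfolding lops(1) by auto
      then have "r * x = Fract (b * a) (t * s)" "b * a \<in> J" "t * s \<in> ?D" using J(4) D(2) by auto
      then show "r * x \<in> ?J" by blast
    qed
    then show "?J \<in> {J. ideal J ?L}" by blast
    show "{a \<in> C. Fract a 1 \<in> ?J} = J"
    proof (intro equalityI subsetI)
      fix a assume "a \<in> {a \<in> C. Fract a 1 \<in> ?J}"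
      then obtain b s where *: "a \<in> C" "Fract a 1 = Fract b s" "b \<in> J" "s \<in> ?D" by auto
      then have "s * a = b" using D(3) by (simp add: eq_fract mult.commute)
      then show "a \<in> J" using J(5) * by auto
    qed (use J(1) D(1) in auto)
  qed
qed

lemma multiplicity_eq_chain_length:
  fixes P :: "'k::field mpol set"
  assumes P: "primeideal P (mpoly_ring V)" and Q: "Q \<subseteq> carrier (mpoly_ring V)"
  shows "multiplicity_over (mpoly_ring V) P Q = chain_length {J \<in> saturated_ideals (mpoly_ring V) P. Q \<subseteq> J}"
proof -
  let ?R = "mpoly_ring V" and ?L = "localization (mpoly_ring V) P"
  let ?f = "\<lambda>J. {a \<in> carrier ?R. Fract a 1 \<in> J}"
    and ?g = "\<lambda>J. {Fract a s | a s. a \<in> J \<and> s \<in> carrier ?R - P}"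
  have R: "?R = ring_of_type_algebra\<lparr>carrier := carrier ?R\<rparr>" by (simp add: mpoly_ring_def)
  note L = localization_correspondence[OF R cring_mpoly_ring P]
  interpret L: cring ?L by (rule L(1))
  interpret P: primeideal P ?R by (rule P)
  have "1 \<notin> P" using P.I_notcarr P.one_imp_carrier by (auto simp: mpoly_ring_simps)
  then have "1 \<in> carrier ?R - P" by (simp add: mpoly_one)
  then have img: "(\<lambda>a. Fract a 1) ` Q \<subseteq> carrier ?L" using Q unfolding localization_def by auto
  have Qi: "ideal (localized_ideal ?R P Q) ?L" unfolding localized_ideal_def by (rule L.genideal_ideal[OF img])
  have iff: "localized_ideal ?R P Q \<subseteq> J \<longleftrightarrow> Q \<subseteq> ?f J" if "ideal J ?L" for J
    unfolding localized_ideal_def L.Idl_subset_ideal[OF that img] using Q by auto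
  have "multiplicity_over ?R P Q = chain_length {J. ideal J ?L \<and> localized_ideal ?R P Q \<subseteq> J}"
    unfolding multiplicity_over_def by (rule L.ring_length_quotient[OF Qi])
  also have "{J. ideal J ?L \<and> localized_ideal ?R P Q \<subseteq> J} = {J \<in> {J. ideal J ?L}. Q \<subseteq> ?f J}"
    using iff by blast
  also have "chain_length \<dots> = chain_length {J \<in> saturated_ideals ?R P. Q \<subseteq> J}"
    by (rule chain_length_eq[OF mutually_inverse_restrict[OF L(2)]]) blast+
  finally show ?thesis .
qed

section \<open>Evaluation of polynomials\<close>

lemma mpoly_generators_induct [consumes 1, case_names const var add mult]:
  assumes "p \<in> carrier (mpoly_ring V)"
    and "\<And>a. Q (mconst a)" "\<And>i. i \<in> V \<Longrightarrow> Q (mvar i)"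
    and "\<And>p q. p \<in> carrier (mpoly_ring V) \<Longrightarrow> q \<in> carrier (mpoly_ring V) \<Longrightarrow> Q p \<Longrightarrow> Q q \<Longrightarrow> Q (p + q)"
    and "\<And>p q. p \<in> carrier (mpoly_ring V) \<Longrightarrow> q \<in> carrier (mpoly_ring V) \<Longrightarrow> Q p \<Longrightarrow> Q q \<Longrightarrow> Q (p * q)"
  shows "Q p"
proof -
  have mono: "Q (single \<alpha> a)" if "keys \<alpha> \<subseteq> V" for \<alpha> a
    using that
  proof (induction \<alpha> rule: mon_induct)
    case zero then show ?case using assms(2)[of a] by (simp add: mconst_def)
  next
    case (plus \<alpha> i)
    then have k: "keys \<alpha> \<subseteq> V" "i \<in> V" by (auto simp: mon_keys_plus)
    have "Q (single \<alpha> a * mvar i)"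
      by (rule assms(5)[OF mpoly_single mpoly_mvar plus.IH assms(3)]) (use k in auto)
    then show ?case by (simp add: mvar_def mult_single)
  qed
  from assms(1) show ?thesis
  proof (induction p rule: mpoly_induct)
    case zero show ?case using assms(2)[of 0] by (simp add: mconst_simps)
  next
    case (add \<alpha> a p)
    then show ?case using assms(4)[OF mpoly_single _ mono] by blast
  qed
qed

lemma mpoly_in_UNIV: "p \<in> carrier (mpoly_ring UNIV)"
  by (simp add: carrier_mpoly_ring)

context
  fixes \<phi> :: "'a::comm_ring_1 \<Rightarrow> 'b::comm_ring_1" and g :: "nat \<Rightarrow> 'b"
  assumes hom: "\<And>a b. \<phi> (a + b) = \<phi> a + \<phi> b" "\<And>a b. \<phi> (a * b) = \<phi> a * \<phi> b" "\<phi> 1 = 1"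
begin

lemma hom_zero: "\<phi> 0 = 0"
  using hom(1)[of 0 0] by simp

lemma eval_mpoly_add: "eval_mpoly \<phi> g (p + q) = eval_mpoly \<phi> g p + eval_mpoly \<phi> g q"
  unfolding eval_mpoly_def by (rule keys_sum_add) (simp_all add: hom hom_zero distrib_right)

lemma eval_mpoly_single: "eval_mpoly \<phi> g (single \<alpha> a) = \<phi> a * (\<Prod>i\<in>keys \<alpha>. g i ^ lookup \<alpha> i)"
  unfolding eval_mpoly_def by (rule keys_sum_single) (simp add: hom_zero)

lemma eval_mpoly_mult: "eval_mpoly \<phi> g (p * q) = eval_mpoly \<phi> g p * eval_mpoly \<phi> g q"
proof -
  have *: "(\<Prod>i\<in>keys (\<alpha> + \<beta>). g i ^ lookup (\<alpha> + \<beta>) i)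
      = (\<Prod>i\<in>keys \<alpha>. g i ^ lookup \<alpha> i) * (\<Prod>i\<in>keys \<beta>. g i ^ lookup \<beta> i)" for \<alpha> \<beta> :: mon
  proof -
    have e: "(\<Prod>i\<in>keys \<gamma>. g i ^ lookup \<gamma> i) = (\<Prod>i\<in>keys \<alpha> \<union> keys \<beta>. g i ^ lookup \<gamma> i)"
      if "keys \<gamma> \<subseteq> keys \<alpha> \<union> keys \<beta>" for \<gamma> :: mon
      by (rule prod.mono_neutral_left) (use that in \<open>auto simp: in_keys_iff\<close>)
    show ?thesis
      by (subst (1 2 3) e) (auto simp: mon_keys_plus lookup_add power_add prod.distrib)
  qed
  show ?thesis
  proof (induction p rule: pm_induct)
    case (single \<alpha> a)
    show ?case
    proof (induction q rule: pm_induct)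
      case (single \<beta> b)
      show ?case by (simp add: mult_single eval_mpoly_single * hom mult_ac)
    qed (simp add: distrib_left eval_mpoly_add)
  qed (simp add: distrib_right eval_mpoly_add)
qed

lemma eval_mpoly_const: "eval_mpoly \<phi> g (mconst a) = \<phi> a"
  by (simp add: mconst_def eval_mpoly_single)

lemma eval_mpoly_var: "eval_mpoly \<phi> g (mvar i) = g i"
  by (simp add: mvar_def eval_mpoly_single hom)

end

lemma mpderiv_mvar: "mpderiv i (mvar j) = (if i = j then 1 else 0)"
  by (simp add: mvar_def mpderiv_single lookup_single when_def)

lemma mpoly_ring_mono: "V \<subseteq> W \<Longrightarrow> p \<in> carrier (mpoly_ring V) \<Longrightarrow> p \<in> carrier (mpoly_ring W)"
  by (auto simp: carrier_mpoly_ring)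

lemma lookup_mconst_0 [simp]: "lookup (mconst a) 0 = a"
  by (simp add: mconst_def)

lemma lookup_mvar_0 [simp]: "lookup (mvar i) 0 = 0"
proof -
  have "single i (1::nat) \<noteq> 0" by (metis mdeg_single mdeg_0 zero_neq_one)
  then show ?thesis by (simp add: mvar_def lookup_single when_def)
qed

text \<open>Used for \<open>\<gamma>(p\<^sub>i)\<close>, a polynomial in \<open>y\<^sub>i\<close> alone.\<close>

lemma divide_by_variable:
  assumes "p \<in> carrier (mpoly_ring {i})"
  obtains h where "h \<in> carrier (mpoly_ring {i})" "p = mconst (lookup p 0) + mvar i * h"
proof -
  let ?V = "mpoly_ring {i}"
  have "\<exists>a. \<exists>h\<in>carrier ?V. p = mconst a + mvar i * h"
    using assms
  proof (induction p rule: mpoly_generators_induct)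
    case (const a) show ?case by (intro exI[of _ a] bexI[of _ 0]) (auto simp: mpoly_zero)
  next
    case (var j) then show ?case by (intro exI[of _ 0] bexI[of _ 1]) (auto simp: mpoly_one mconst_simps)
  next
    case (add p q)
    then obtain a h b k where "h \<in> carrier ?V" "k \<in> carrier ?V" "p = mconst a + mvar i * h" "q = mconst b + mvar i * k"
      by blast
    then show ?case by (intro exI[of _ "a + b"] bexI[of _ "h + k"]) (auto simp: mconst_simps algebra_simps intro: mpoly_add)
  next
    case (mult p q)
    then obtain a h b k where *: "h \<in> carrier ?V" "k \<in> carrier ?V" "p = mconst a + mvar i * h" "q = mconst b + mvar i * k"
      by blast
    show ?case
    proof (intro exI[of _ "a * b"] bexI[of _ "mconst a * k + mconst b * h + mvar i * h * k"])
      show "p * q = mconst (a * b) + mvar i * (mconst a * k + mconst b * h + mvar i * h * k)"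
        by (simp add: *(3,4) mconst_simps algebra_simps)
    qed (use * in \<open>simp add: mpoly_add mpoly_mult mpoly_mconst mpoly_mvar\<close>)
  qed
  then obtain a h where h: "h \<in> carrier ?V" "p = mconst a + mvar i * h" by blast
  have "lookup p 0 = a" unfolding h(2) lookup_add lookup_0_mult by simp
  then show thesis using that h by blast
qed

lemma mon_split_vars:
  obtains \<beta> \<epsilon> :: mon where "\<alpha> = \<beta> + \<epsilon>" "keys \<beta> \<subseteq> V" "keys \<epsilon> \<inter> V = {}"
proof -
  have "\<exists>\<beta> \<epsilon>. \<alpha> = \<beta> + \<epsilon> \<and> keys \<beta> \<subseteq> V \<and> keys \<epsilon> \<inter> V = {}"
  proof (induction \<alpha> rule: mon_induct)
    case zero show ?case by (intro exI[of _ 0]) simp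
  next
    case (plus \<alpha> i)
    then obtain \<beta> \<epsilon> where *: "\<alpha> = \<beta> + \<epsilon>" "keys \<beta> \<subseteq> V" "keys \<epsilon> \<inter> V = {}"
      by blast
    show ?case
    proof (cases "i \<in> V")
      case True
      then show ?thesis using * by (intro exI[of _ "\<beta> + single i 1"] exI[of _ \<epsilon>]) (simp add: mon_keys_plus add_ac)
    next
      case False
      then show ?thesis using * by (intro exI[of _ \<beta>] exI[of _ "\<epsilon> + single i 1"]) (simp add: mon_keys_plus add_ac Int_Un_distrib2)
    qed
  qed
  then show thesis using that by blast
qed

section \<open>The generic point\<close>

text \<open>The image of \<open>(x\<^sub>1, \<dots>, x\<^sub>n)\<close> in \<open>\<F>\<^sup>n\<close> is the generic point of the variety of \<open>P\<close>, about which \<open>\<gamma>\<close>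
  expands polynomials in the directions \<open>x\<^sub>1, \<dots>, x\<^sub>c\<close>.\<close>

locale generic_point =
  fixes n c :: nat and P :: "'k::field_char_0 mpol set" and \<pi> :: "'k mpol \<Rightarrow> 'f::field_char_0"
  assumes prime: "primeideal P (mpoly_ring {1..n})"
    and c_le: "c \<le> n"
    and max_indep: "maximal_independent_mod n P {c+1..n}"
    and frac: "is_fraction_field_of_quotient (mpoly_ring {1..n}) P \<pi>"
begin

abbreviation "R \<equiv> carrier (mpoly_ring {1..n}) :: 'k mpol set"
abbreviation "R0 \<equiv> carrier (mpoly_ring {c+1..n}) :: 'k mpol set"
abbreviation "S \<equiv> carrier (mpoly_ring {1..c}) :: 'f mpol set"
abbreviation "\<gamma> \<equiv> gamma c \<pi>"

lemma P_ideal: "ideal P (mpoly_ring {1..n})"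
  using prime by (simp add: primeideal_def)

lemma P_subset: "P \<subseteq> R"
  using ideal_mpolyD(1)[OF P_ideal] by blast

lemma pi_hom: "\<pi> \<in> ring_hom (mpoly_ring {1..n}) ring_of_type_algebra"
  using frac by (simp add: is_fraction_field_of_quotient_def)

lemmas pi_simps = hom_simps[OF pi_hom]

lemma pi_eq_0_iff: "r \<in> R \<Longrightarrow> \<pi> r = 0 \<longleftrightarrow> r \<in> P"
  using frac by (auto simp: is_fraction_field_of_quotient_def a_kernel_def kernel_def)

lemma pi_sum: "(\<And>i. i \<in> T \<Longrightarrow> f i \<in> R) \<Longrightarrow> \<pi> (sum f T) = (\<Sum>i\<in>T. \<pi> (f i))"
  by (induction T rule: infinite_finite_induct) (simp_all add: pi_simps mpoly_sum)

lemma pi_uminus: "r \<in> R \<Longrightarrow> \<pi> (- r) = - \<pi> r"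
  using pi_simps(1)[of r "- r"] by (simp add: mpoly_uminus pi_simps(4) eq_neg_iff_add_eq_0 add.commute)

lemma pi_fraction: obtains a s where "a \<in> R" "s \<in> R - P" "z = \<pi> a / \<pi> s"
  using frac unfolding is_fraction_field_of_quotient_def by blast

lemma one_notin_P: "1 \<notin> P"
  using pi_eq_0_iff[OF mpoly_one] by (simp add: pi_simps)

lemma diff_P_mult: "s \<in> R - P \<Longrightarrow> t \<in> R - P \<Longrightarrow> s * t \<in> R - P"
  by (auto simp: mpoly_mult pi_simps simp flip: pi_eq_0_iff)

lemma R0_subset: "R0 \<subseteq> R"
  using mpoly_ring_mono[of "{c+1..n}" "{1..n}"] by auto

text \<open>This is the independence of \<open>x\<^sub>c\<^sub>+\<^sub>1, \<dots>, x\<^sub>n\<close> modulo \<open>P\<close>.\<close>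

lemma R0_pi: "r \<in> R0 \<Longrightarrow> \<pi> r = 0 \<longleftrightarrow> r = 0"
  using max_indep R0_subset pi_eq_0_iff
  unfolding maximal_independent_mod_def independent_mod_def by blast

lemma gamma_hom:
  "\<gamma> (p + q) = \<gamma> p + \<gamma> q" "\<gamma> (p * q) = \<gamma> p * \<gamma> q" "\<gamma> (mconst a) = mconst (\<pi> (mconst a))"
  "\<gamma> (mvar i) = (if i \<in> {1..c} then mvar i + mconst (\<pi> (mvar i)) else mconst (\<pi> (mvar i)))"
proof -
  have h: "mconst (\<pi> (mconst (a + b))) = mconst (\<pi> (mconst a)) + mconst (\<pi> (mconst b))"
    "mconst (\<pi> (mconst (a * b))) = mconst (\<pi> (mconst a)) * mconst (\<pi> (mconst b))"
    "mconst (\<pi> (mconst 1)) = 1" for a b :: 'k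
    by (simp_all add: mconst_simps pi_simps mpoly_mconst)
  show "\<gamma> (p + q) = \<gamma> p + \<gamma> q" "\<gamma> (p * q) = \<gamma> p * \<gamma> q" "\<gamma> (mconst a) = mconst (\<pi> (mconst a))"
    "\<gamma> (mvar i) = (if i \<in> {1..c} then mvar i + mconst (\<pi> (mvar i)) else mconst (\<pi> (mvar i)))"
    unfolding gamma_def
    by (rule eval_mpoly_add[OF h] eval_mpoly_mult[OF h] eval_mpoly_const[OF h] eval_mpoly_var[OF h])+
qed

lemma gamma_0: "\<gamma> 0 = 0" and gamma_1: "\<gamma> 1 = 1"
  using gamma_hom(3)[of 0] gamma_hom(3)[of 1] by (simp_all add: mconst_simps pi_simps)

lemma gamma_diff: "\<gamma> (p - q) = \<gamma> p - \<gamma> q"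
  using gamma_hom(1)[of "p - q" q] by simp

lemma gamma_sum: "\<gamma> (sum f T) = (\<Sum>i\<in>T. \<gamma> (f i))"
  by (induction T rule: infinite_finite_induct) (simp_all add: gamma_0 gamma_hom(1))

lemma gamma_in_S: "\<gamma> p \<in> S"
proof (rule mpoly_generators_induct[OF mpoly_in_UNIV[of p]])
  show "\<gamma> (mvar i) \<in> S" for i by (auto simp: gamma_hom(4) intro!: mpoly_add mpoly_mconst mpoly_mvar)
qed (auto simp: gamma_hom(1-3) intro: mpoly_add mpoly_mult mpoly_mconst)

lemma gamma_single_variable:
  assumes "p \<in> carrier (mpoly_ring (insert i {c+1..n}))"
  shows "\<gamma> p \<in> carrier (mpoly_ring {i})"
  using assms
proof (induction p rule: mpoly_generators_induct)
  case (var j)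
  then show ?case by (auto simp: gamma_hom(4) intro: mpoly_add mpoly_mconst mpoly_mvar)
qed (auto simp: gamma_hom(1-3) intro: mpoly_add mpoly_mult mpoly_mconst)

lemma gamma_R0: "r \<in> R0 \<Longrightarrow> \<gamma> r = mconst (\<pi> r)"
proof (induction r rule: mpoly_generators_induct)
  case (add p q)
  then show ?case using R0_subset[THEN subsetD, of p] R0_subset[THEN subsetD, of q]
    by (simp add: gamma_hom mconst_simps pi_simps)
next
  case (mult p q)
  then show ?case using R0_subset[THEN subsetD, of p] R0_subset[THEN subsetD, of q]
    by (simp add: gamma_hom mconst_simps pi_simps)
qed (auto simp: gamma_hom)

lemma gamma_const_term: "r \<in> R \<Longrightarrow> lookup (\<gamma> r) 0 = \<pi> r"
proof (induction r rule: mpoly_generators_induct)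
  case (var i)
  show ?case by (simp add: gamma_hom(4) lookup_add)
qed (simp_all add: gamma_hom(1-3) lookup_add lookup_0_mult pi_simps)

lemma mpderiv_gamma: "i \<in> {1..c} \<Longrightarrow> mpderiv i (\<gamma> p) = \<gamma> (mpderiv i p)"
proof (rule mpoly_generators_induct[OF mpoly_in_UNIV[of p]])
  show "mpderiv i (\<gamma> (mvar j)) = \<gamma> (mpderiv i (mvar j))" if "i \<in> {1..c}" for j
    using that by (auto simp: gamma_hom(4) mpderiv_add mpderiv_mconst mpderiv_mvar gamma_0 gamma_1)
qed (simp_all add: gamma_hom(1-3) mpderiv_add mpderiv_mult mpderiv_mconst gamma_0)

text \<open>Taylor's formula at the generic point: \<open>\<gamma>\<close> commutes with \<open>\<partial>\<^sub>i\<close>, and the constant term of \<open>\<gamma>(r)\<close> is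
  the class of \<open>r\<close> in \<open>\<F>\<close>.\<close>

lemma taylor:
  assumes "keys \<alpha> \<subseteq> {1..c}" "r \<in> R"
  shows "of_nat (mfact \<alpha>) * lookup (\<gamma> r) \<alpha> = \<pi> (multi_iter mpderiv \<alpha> r)"
proof -
  have "multi_iter mpderiv \<alpha> (\<gamma> r) = \<gamma> (multi_iter mpderiv \<alpha> r)"
    using assms(1)
  proof (induction \<alpha> rule: mon_induct)
    case (plus \<alpha> i)
    then have "i \<in> {1..c}" "keys \<alpha> \<subseteq> {1..c}" by (simp_all add: mon_keys_plus)
    then show ?case by (simp only: mi_mpderiv_plus plus.IH mpderiv_gamma)
  qed simp
  then show ?thesis
    by (simp add: lookup_0_mi_mpderiv[symmetric] gamma_const_term mi_mpderiv_carrier assms(2))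
qed

text \<open>Maximality of the independent set gives a non-zero element of \<open>P\<close> in \<open>x\<^sub>i\<close> and the independent
  variables. If it has least degree in \<open>x\<^sub>i\<close>, its derivative cannot lie in \<open>P\<close>: by minimality it would
  be zero, and then in characteristic zero the element itself would involve only independent variables.\<close>

lemma local_parameter:
  assumes i: "i \<in> {1..c}"
  obtains p h where "p \<in> P" "h \<in> S" "\<gamma> p = mvar i * h" "lookup h 0 = \<pi> (mpderiv i p)" "mpderiv i p \<in> R - P"
proof -
  let ?T = "insert i {c+1..n}"
  have "i \<notin> {c+1..n}" using i by simp
  then have "{c+1..n} \<subset> ?T" by blast
  moreover have "?T \<subseteq> {1..n}" using i c_le by auto
  ultimately have "\<not> independent_mod P ?T" using max_indep by (auto simp: maximal_independent_mod_def)
  moreover have "0 \<in> carrier (mpoly_ring ?T) \<inter> P" using ideal_mpolyD(2)[OF P_ideal] mpoly_zero by blast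
  ultimately obtain q where q: "q \<in> carrier (mpoly_ring ?T)" "q \<in> P" "q \<noteq> 0"
    unfolding independent_mod_def by blast
  \<comment> \<open>The number \<open>d\<close> bounds the degree of \<open>p\<close> in \<open>x\<^sub>i\<close>.\<close>
  let ?Q = "\<lambda>d p. p \<in> carrier (mpoly_ring ?T) \<and> p \<in> P \<and> p \<noteq> 0 \<and> (\<forall>\<alpha>. lookup p \<alpha> \<noteq> 0 \<longrightarrow> lookup \<alpha> i \<le> d)"
  have "?Q (\<Sum>\<alpha>\<in>keys q. lookup \<alpha> i) q"
    using q by (auto simp: in_keys_iff intro!: member_le_sum)
  then have ex: "\<exists>d p. ?Q d p" by blast
  define d where "d = (LEAST d. \<exists>p. ?Q d p)"
  have "\<exists>p. ?Q d p" unfolding d_def by (rule LeastI_ex[OF ex])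
  then obtain p where p: "p \<in> carrier (mpoly_ring ?T)" "p \<in> P" "p \<noteq> 0" "\<And>\<alpha>. lookup p \<alpha> \<noteq> 0 \<Longrightarrow> lookup \<alpha> i \<le> d"
    by blast
  have min: "\<not> ?Q d' p'" if "d' < d" for d' p' using not_less_Least[of d' "\<lambda>d. \<exists>p. ?Q d p"] that unfolding d_def by blast
  have dR: "mpderiv i p \<in> R" using P_subset p(2) by (blast intro: mpoly_deriv)
  have "mpderiv i p \<notin> P"
  proof
    assume dP: "mpderiv i p \<in> P"
    have "mpderiv i p = 0"
    proof (rule ccontr)
      assume nz: "mpderiv i p \<noteq> 0"
      have b: "Suc (lookup \<alpha> i) \<le> d" if "lookup (mpderiv i p) \<alpha> \<noteq> 0" for \<alpha>
        using p(4)[of "\<alpha> + single i 1"] that by (auto simp: lookup_mpderiv lookup_add)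
      obtain \<alpha> where "lookup (mpderiv i p) \<alpha> \<noteq> 0"
        using nz by (auto simp: poly_mapping_eq_iff fun_eq_iff)
      then have "d - 1 < d" using b[of \<alpha>] by simp
      moreover have "lookup \<alpha> i \<le> d - 1" if "lookup (mpderiv i p) \<alpha> \<noteq> 0" for \<alpha> using b[OF that] by simp
      ultimately show False using min[of "d - 1" "mpderiv i p"] dP nz mpoly_deriv[OF p(1)] by blast
    qed
    have "i \<notin> keys \<alpha>" if "lookup p \<alpha> \<noteq> 0" for \<alpha>
    proof
      assume "i \<in> keys \<alpha>"
      then have "lookup \<alpha> i \<noteq> 0" by (simp add: in_keys_iff)
      then have "\<alpha> - single i 1 + single i 1 = \<alpha>"
        by (intro poly_mapping_eqI) (auto simp: lookup_add lookup_minus lookup_single when_def)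
      then have "of_nat (lookup (\<alpha> - single i 1) i + 1) * lookup p \<alpha> = 0"
        using lookup_mpderiv[of i p "\<alpha> - single i 1"] \<open>mpderiv i p = 0\<close> by simp
      then show False using that by (simp del: of_nat_add)
    qed
    then have "p \<in> R0" using p(1) unfolding mpoly_carrier_iff by blast
    then have "p = 0" using R0_pi[of p] pi_eq_0_iff[of p] p(2) P_subset by blast
    then show False using p(3) by simp
  qed
  moreover obtain h where h: "h \<in> carrier (mpoly_ring {i})" "\<gamma> p = mconst (lookup (\<gamma> p) 0) + mvar i * h"
    by (rule divide_by_variable[OF gamma_single_variable[OF p(1)]])
  have pR: "p \<in> R" using p(2) P_subset by blast
  then have "\<pi> p = 0" using p(2) by (simp add: pi_eq_0_iff)
  then have g: "\<gamma> p = mvar i * h" using h(2) gamma_const_term[OF pR] by (simp add: mconst_simps)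
  moreover have "h \<in> S" using mpoly_ring_mono[of "{i}" "{1..c}" h] h(1) i by simp
  moreover have "lookup h 0 = \<pi> (mpderiv i p)"
  proof -
    have "lookup (mpderiv i (\<gamma> p)) 0 = \<pi> (mpderiv i p)" using i dR by (simp add: mpderiv_gamma gamma_const_term)
    moreover have "mpderiv i (\<gamma> p) = h + mvar i * mpderiv i h" by (simp add: g mpderiv_mult mpderiv_mvar)
    ultimately show ?thesis by (simp add: lookup_add lookup_0_mult)
  qed
  ultimately show thesis using that[of p h] p(2) dR by blast
qed

end

section \<open>Descent\<close>

lemma span_mult:
  assumes "x \<in> mpol_span A" "y \<in> mpol_span B" "\<And>a b. a \<in> A \<Longrightarrow> b \<in> B \<Longrightarrow> a * b \<in> mpol_span D"
  shows "x * y \<in> mpol_span D"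
  using assms(1)
proof (induction x rule: mpol.span_induct_alt)
  case base show ?case by (simp add: mpol.span_zero)
next
  case (step r a z)
  have "a * y \<in> mpol_span D"
    using assms(2)
  proof (induction y rule: mpol.span_induct_alt)
    case base show ?case by (simp add: mpol.span_zero)
  next
    case (step s b w)
    have "a * (mscale s b + w) = mscale s (a * b) + a * w" by (simp add: distrib_left mscale_mult)
    then show ?case using assms(3)[OF \<open>a \<in> A\<close> \<open>b \<in> B\<close>] step by (simp add: mpol.span_add mpol.span_scale)
  qed
  moreover have "(mscale r a + z) * y = mscale r (a * y) + z * y" by (simp add: distrib_right mscale_mult)
  ultimately show ?case using step by (simp add: mpol.span_add mpol.span_scale)
qed

lemma span_image_explicit:
  assumes "x \<in> mpol_span (g ` T)"
  obtains U a where "finite U" "U \<subseteq> T" "x = (\<Sum>r\<in>U. mscale (a r) (g r))"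
proof -
  have "\<exists>U a. finite U \<and> U \<subseteq> T \<and> x = (\<Sum>r\<in>U. mscale (a r) (g r))"
    using assms
  proof (induction x rule: mpol.span_induct_alt)
    case base show ?case by (intro exI[of _ "{}"]) simp
  next
    case (step b x y)
    then obtain r U a where *: "x = g r" "r \<in> T" "finite U" "U \<subseteq> T" "y = (\<Sum>r\<in>U. mscale (a r) (g r))"
      by blast
    let ?a = "\<lambda>q. (if q = r then b else 0) + (if q \<in> U then a q else 0)"
    have "(\<Sum>q\<in>insert r U. mscale (?a q) (g q)) =
        (\<Sum>q\<in>insert r U. if q = r then mscale b (g r) else 0) + (\<Sum>q\<in>insert r U. if q \<in> U then mscale (a q) (g q) else 0)"
      unfolding sum.distrib[symmetric] by (rule sum.cong) (auto simp: mscale_simps)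
    also have "\<dots> = mscale b x + y"
    proof -
      have "(\<Sum>q\<in>insert r U. if q \<in> U then mscale (a q) (g q) else 0) = y"
        unfolding *(5) by (rule sum.mono_neutral_cong_right) (use *(3) in auto)
      then show ?thesis using *(1,3) by simp
    qed
    finally show ?case using * by (intro exI[of _ "insert r U"] exI[of _ ?a]) simp
  qed
  then show thesis using that by blast
qed

context generic_point
begin

text \<open>Linear independence over \<open>K[x\<^sub>c\<^sub>+\<^sub>1, \<dots>, x\<^sub>n]\<close>, equivalently over its field of fractions.\<close>

definition independent_over_R0 :: "'f set \<Rightarrow> bool" where
  "independent_over_R0 E \<longleftrightarrow> (\<forall>k. (\<forall>e\<in>E. k e \<in> R0) \<and> (\<Sum>e\<in>E. \<pi> (k e) * e) = 0 \<longrightarrow> (\<forall>e\<in>E. k e = 0))"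

text \<open>Clearing denominators in a basis of the span over \<open>K(x\<^sub>c\<^sub>+\<^sub>1, \<dots>, x\<^sub>n)\<close>; the induction adds the
  elements of \<open>A\<close> one at a time and enlarges \<open>E\<close> only if the new element is independent of it.\<close>

lemma coordinates_over_R0:
  assumes "finite A"
  obtains E d k where "finite E" "independent_over_R0 E" "d \<in> R0" "\<pi> d \<noteq> 0"
    "\<And>x e. x \<in> A \<Longrightarrow> k x e \<in> R0" "\<And>x. x \<in> A \<Longrightarrow> \<pi> d * x = (\<Sum>e\<in>E. \<pi> (k x e) * e)"
proof -
  have "\<exists>E d k. finite E \<and> independent_over_R0 E \<and> d \<in> R0 \<and> \<pi> d \<noteq> 0 \<and>
      (\<forall>x\<in>A. \<forall>e. k x e \<in> R0) \<and> (\<forall>x\<in>A. \<pi> d * x = (\<Sum>e\<in>E. \<pi> (k x e) * e))"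
    using assms
  proof (induction A rule: finite_induct)
    case empty
    show ?case by (intro exI[of _ "{}"] exI[of _ 1]) (simp add: independent_over_R0_def mpoly_one pi_simps)
  next
    case (insert a A)
    then obtain E d k where IH: "finite E" "independent_over_R0 E" "d \<in> R0" "\<pi> d \<noteq> 0"
      "\<And>x e. x \<in> A \<Longrightarrow> k x e \<in> R0" "\<And>x. x \<in> A \<Longrightarrow> \<pi> d * x = (\<Sum>e\<in>E. \<pi> (k x e) * e)" by blast
    have R: "r \<in> R" if "r \<in> R0" for r using that R0_subset by blast
    consider "a \<in> E" | "a \<notin> E" "independent_over_R0 (insert a E)" | "a \<notin> E" "\<not> independent_over_R0 (insert a E)" by blast
    then show ?case
    proof cases
      case 1
      let ?k = "\<lambda>x e. if x = a then (if e = a then d else 0) else k x e"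
      have "(\<Sum>e\<in>E. \<pi> (?k a e) * e) = (\<Sum>e\<in>E. if e = a then \<pi> d * a else 0)"
        by (rule sum.cong) (auto simp: pi_simps)
      then have "\<pi> d * a = (\<Sum>e\<in>E. \<pi> (?k a e) * e)" using 1 IH(1) by simp
      moreover have "\<pi> d * x = (\<Sum>e\<in>E. \<pi> (?k x e) * e)" if "x \<in> A" for x
      proof -
        have "x \<noteq> a" using that insert(2) by blast
        then show ?thesis using IH(6)[OF that] by simp
      qed
      ultimately have "\<forall>x\<in>insert a A. \<pi> d * x = (\<Sum>e\<in>E. \<pi> (?k x e) * e)" by blast
      moreover have "\<forall>x\<in>insert a A. \<forall>e. ?k x e \<in> R0" using IH(3,5) by (simp add: mpoly_zero)
      ultimately show ?thesis
        by (intro exI[of _ E] exI[of _ d] exI[of _ ?k] conjI IH(1-4))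
    next
      case 2
      let ?k = "\<lambda>x e. if x = a then (if e = a then d else 0) else if e = a then 0 else k x e"
      have "(\<Sum>e\<in>insert a E. \<pi> (?k a e) * e) = (\<Sum>e\<in>insert a E. if e = a then \<pi> d * a else 0)"
        by (rule sum.cong) (auto simp: pi_simps)
      then have "\<pi> d * a = (\<Sum>e\<in>insert a E. \<pi> (?k a e) * e)" using IH(1) by simp
      moreover have "\<pi> d * x = (\<Sum>e\<in>insert a E. \<pi> (?k x e) * e)" if "x \<in> A" for x
      proof -
        have "x \<noteq> a" using that insert(2) by blast
        have "(\<Sum>e\<in>E. \<pi> (?k x e) * e) = (\<Sum>e\<in>E. \<pi> (k x e) * e)"
          by (rule sum.cong) (use 2 \<open>x \<noteq> a\<close> in auto)
        then show ?thesis using IH(1) IH(6)[OF that] 2 \<open>x \<noteq> a\<close> by (simp add: pi_simps)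
      qed
      ultimately have "\<forall>x\<in>insert a A. \<pi> d * x = (\<Sum>e\<in>insert a E. \<pi> (?k x e) * e)" by blast
      moreover have "\<forall>x\<in>insert a A. \<forall>e. ?k x e \<in> R0" using IH(3,5) by (simp add: mpoly_zero)
      moreover have "finite (insert a E)" using IH(1) by simp
      ultimately show ?thesis
        by (intro exI[of _ "insert a E"] exI[of _ d] exI[of _ ?k] conjI IH(3,4) 2(2))
    next
      case 3
      then obtain l where l: "\<And>e. e \<in> insert a E \<Longrightarrow> l e \<in> R0" "(\<Sum>e\<in>insert a E. \<pi> (l e) * e) = 0"
        "\<not> (\<forall>e\<in>insert a E. l e = 0)" unfolding independent_over_R0_def by blast
      have sum: "\<pi> (l a) * a + (\<Sum>e\<in>E. \<pi> (l e) * e) = 0" using l(2) IH(1) 3(1) by simp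
      have "l a \<noteq> 0"
      proof
        assume "l a = 0"
        then have "(\<Sum>e\<in>E. \<pi> (l e) * e) = 0" using sum by (simp add: pi_simps)
        then have "\<forall>e\<in>E. l e = 0" using IH(2) l(1) unfolding independent_over_R0_def by blast
        then show False using l(3) \<open>l a = 0\<close> by blast
      qed
      then have la: "l a \<in> R0" "\<pi> (l a) \<noteq> 0" using l(1) R0_pi by blast+
      let ?d = "d * l a"
      let ?k = "\<lambda>x e. if e \<in> E then (if x = a then - (d * l e) else l a * k x e) else 0"
      have "\<pi> ?d * a = (\<Sum>e\<in>E. \<pi> (?k a e) * e)"
      proof -
        have "\<pi> (l a) * a = - (\<Sum>e\<in>E. \<pi> (l e) * e)" using sum by (simp add: eq_neg_iff_add_eq_0)
        then have "\<pi> ?d * a = - (\<pi> d * (\<Sum>e\<in>E. \<pi> (l e) * e))"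
          by (simp add: pi_simps R IH(3) la(1) mult.assoc)
        also have "\<dots> = (\<Sum>e\<in>E. - (\<pi> d * \<pi> (l e)) * e)"
          by (simp add: sum_distrib_left mult.assoc sum_negf)
        also have "\<dots> = (\<Sum>e\<in>E. \<pi> (?k a e) * e)"
          by (rule sum.cong) (use l(1) IH(3) in \<open>auto simp: pi_uminus pi_simps R mpoly_mult\<close>)
        finally show ?thesis .
      qed
      moreover have "\<pi> ?d * x = (\<Sum>e\<in>E. \<pi> (?k x e) * e)" if "x \<in> A" for x
      proof -
        have "x \<noteq> a" using that insert(2) by blast
        have "\<pi> ?d * x = \<pi> (l a) * (\<Sum>e\<in>E. \<pi> (k x e) * e)"
          using IH(6)[OF that] by (simp add: pi_simps R IH(3) la(1) mult_ac)
        also have "\<dots> = (\<Sum>e\<in>E. \<pi> (?k x e) * e)"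
          unfolding sum_distrib_left
          by (rule sum.cong) (use IH(5)[OF that] la(1) \<open>x \<noteq> a\<close> in \<open>auto simp: pi_simps R mult_ac\<close>)
        finally show ?thesis .
      qed
      ultimately have "\<forall>x\<in>insert a A. \<pi> ?d * x = (\<Sum>e\<in>E. \<pi> (?k x e) * e)" by blast
      moreover have "\<forall>x\<in>insert a A. \<forall>e. ?k x e \<in> R0"
        using IH(3,5) la(1) l(1) by (auto intro!: mpoly_mult mpoly_uminus mpoly_zero)
      moreover have "?d \<in> R0" "\<pi> ?d \<noteq> 0" using IH(3,4) la by (simp_all add: mpoly_mult pi_simps R)
      ultimately show ?thesis
        by (intro exI[of _ E] exI[of _ ?d] exI[of _ ?k] conjI IH(1,2))
    qed
  qed
  then show thesis using that by blast
qed

text \<open>Choose a monomial of some \<open>s e\<close> whose part \<open>\<beta>\<close> in \<open>x\<^sub>1, \<dots>, x\<^sub>c\<close> has the largest degree. The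
  derivatives \<open>\<partial>\<^sup>\<beta> (s e)\<close> then involve only the independent variables, and the coefficient of \<open>y\<^sup>\<beta>\<close> in
  the given relation is a linear relation between the elements of \<open>E\<close> with these coefficients.\<close>

lemma gamma_independent:
  assumes E: "finite E" "independent_over_R0 E" and s: "\<And>e. e \<in> E \<Longrightarrow> s e \<in> R"
    and zero: "(\<Sum>e\<in>E. mscale e (\<gamma> (s e))) = 0" and e: "e \<in> E"
  shows "s e = 0"
proof (rule ccontr)
  assume nz: "s e \<noteq> 0"
  define wt where "wt \<alpha> = (\<Sum>i\<in>{1..c}. lookup \<alpha> i)" for \<alpha> :: mon
  have wt_add: "wt (\<alpha> + \<beta>) = wt \<alpha> + wt \<beta>" for \<alpha> \<beta> by (simp add: wt_def lookup_add sum.distrib)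
  define M where "M = (\<Union>e\<in>E. keys (s e))"
  have "finite M" using E(1) by (simp add: M_def)
  moreover have "M \<noteq> {}" using nz e by (auto simp: M_def)
  ultimately have "Max (wt ` M) \<in> wt ` M" by (intro Max_in) auto
  then obtain \<alpha> where "\<alpha> \<in> M" "wt \<alpha> = Max (wt ` M)" by auto
  then have \<alpha>: "\<alpha> \<in> M" "\<And>\<alpha>'. \<alpha>' \<in> M \<Longrightarrow> wt \<alpha>' \<le> wt \<alpha>"
    using \<open>finite M\<close> by auto
  obtain \<beta> \<epsilon> where \<beta>: "\<alpha> = \<beta> + \<epsilon>" "keys \<beta> \<subseteq> {1..c}" "keys \<epsilon> \<inter> {1..c} = {}"
    by (rule mon_split_vars)
  have "wt \<epsilon> = 0" using \<beta>(3) by (auto simp: wt_def in_keys_iff disjoint_iff)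
  define k where "k e = multi_iter mpderiv \<beta> (s e)" for e
  have kl: "of_nat (mfact \<delta>) * lookup (k e) \<delta> = of_nat (mfact (\<beta> + \<delta>)) * lookup (s e) (\<beta> + \<delta>)" for e \<delta>
    unfolding k_def by (rule lookup_mi_mpderiv)
  have k0: "k e \<in> R0" if "e \<in> E" for e
    unfolding mpoly_carrier_iff
  proof (intro allI impI)
    fix \<delta> assume \<delta>: "lookup (k e) \<delta> \<noteq> 0"
    have "lookup (s e) (\<beta> + \<delta>) \<noteq> 0" using kl[of \<delta> e] \<delta> by auto
    then have "\<beta> + \<delta> \<in> M" using that by (auto simp: M_def in_keys_iff)
    then have "wt \<delta> = 0" using \<alpha>(2)[of "\<beta> + \<delta>"] \<beta>(1) \<open>wt \<epsilon> = 0\<close> by (simp add: wt_add)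
    then have "keys \<delta> \<inter> {1..c} = {}" by (auto simp: wt_def in_keys_iff)
    moreover have "keys \<delta> \<subseteq> {1..n}"
      using mi_mpderiv_carrier[OF s[OF that], of \<beta>] \<delta> by (simp add: mpoly_carrier_iff k_def)
    ultimately show "keys \<delta> \<subseteq> {c+1..n}" by (fastforce simp: subset_iff disjoint_iff)
  qed
  have "(\<Sum>e\<in>E. \<pi> (k e) * e) = 0"
  proof -
    have "(\<Sum>e\<in>E. \<pi> (k e) * e) = (\<Sum>e\<in>E. of_nat (mfact \<beta>) * lookup (mscale e (\<gamma> (s e))) \<beta>)"
      by (rule sum.cong) (use taylor[OF \<beta>(2) s] in \<open>simp_all add: k_def lookup_mscale mult_ac\<close>)
    also have "\<dots> = of_nat (mfact \<beta>) * lookup (\<Sum>e\<in>E. mscale e (\<gamma> (s e))) \<beta>"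
      by (simp add: lookup_sum sum_distrib_left)
    finally show ?thesis by (simp add: zero)
  qed
  then have "k e = 0" if "e \<in> E" for e
    using E(2) k0 that unfolding independent_over_R0_def by blast
  moreover obtain e where "e \<in> E" "lookup (s e) \<alpha> \<noteq> 0" using \<alpha>(1) by (auto simp: M_def in_keys_iff)
  ultimately show False using kl[of \<epsilon> e] \<beta>(1) by simp
qed

text \<open>For an ideal \<open>J\<close> this \<open>\<F>\<close>-span is already the ideal \<open>\<gamma>(J)S\<close>, see \<open>extension_eq_Idl\<close>, because \<open>S\<close> is the
  \<open>\<F>\<close>-span of \<open>\<gamma>(R)\<close>.\<close>

definition extension :: "'k mpol set \<Rightarrow> 'f mpol set" where
  "extension J = mpol_span (\<gamma> ` J)"

lemma S_eq_span: "S = extension R"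
proof
  show "extension R \<subseteq> S" unfolding extension_def
    by (rule mpol.span_minimal)
      (auto simp: gamma_in_S mpol.subspace_def intro: mpoly_zero mpoly_add mpoly_mscale)
  show "S \<subseteq> extension R"
  proof
    fix p assume "p \<in> S"
    then show "p \<in> extension R" unfolding extension_def
    proof (induction p rule: mpoly_generators_induct)
      case (const a)
      have "mconst a = mscale a (\<gamma> 1)" by (simp add: mscale_def gamma_1)
      then show ?case by (simp add: mpol.span_scale mpol.span_base mpoly_one)
    next
      case (var i)
      then have "mvar i = \<gamma> (mvar i) - mscale (\<pi> (mvar i)) (\<gamma> 1)"
        by (simp add: mscale_def gamma_1 gamma_hom(4))
      moreover have "mvar i \<in> R" using var c_le by (intro mpoly_mvar) auto
      ultimately show ?case by (metis mpol.span_diff mpol.span_scale mpol.span_base imageI mpoly_one)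
    next
      case (mult p q)
      show ?case by (rule span_mult[OF mult.IH])
        (auto simp: gamma_hom(2)[symmetric] intro!: mpol.span_base imageI mpoly_mult)
    qed (rule mpol.span_add)
  qed
qed

lemma ideal_extension:
  assumes J: "ideal J (mpoly_ring {1..n})"
  shows "ideal (extension J) (mpoly_ring {1..c})"
  unfolding ideal_mpoly_iff
proof (intro conjI ballI)
  show "extension J \<subseteq> S" unfolding extension_def
    by (rule mpol.span_minimal)
      (auto simp: gamma_in_S mpol.subspace_def intro: mpoly_zero mpoly_add mpoly_mscale)
  fix r x assume "r \<in> S" "x \<in> extension J"
  then show "r * x \<in> extension J" unfolding S_eq_span extension_def
    by (rule span_mult) (auto simp: gamma_hom(2)[symmetric] intro!: mpol.span_base imageI ideal_mpolyD(4)[OF J])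
qed (auto simp: extension_def mpol.span_zero mpol.span_add)

lemma extension_eq_Idl:
  assumes J: "ideal J (mpoly_ring {1..n})"
  shows "extension J = Idl\<^bsub>mpoly_ring {1..c}\<^esub> (\<gamma> ` J)"
proof
  interpret S: cring "mpoly_ring {1..c} :: 'f mpol ring" by (rule cring_mpoly_ring)
  have img: "\<gamma> ` J \<subseteq> S" by (auto simp: gamma_in_S)
  note I = S.genideal_ideal[OF img]
  show "extension J \<subseteq> Idl\<^bsub>mpoly_ring {1..c}\<^esub> (\<gamma> ` J)" unfolding extension_def
    by (rule mpol.span_minimal[OF S.genideal_self[OF img]])
      (auto simp: mpol.subspace_def mscale_def intro: ideal_mpolyD[OF I] mpoly_mconst)
  show "Idl\<^bsub>mpoly_ring {1..c}\<^esub> (\<gamma> ` J) \<subseteq> extension J"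
    by (rule S.genideal_minimal[OF ideal_extension[OF J]]) (auto simp: extension_def mpol.span_base)
qed

text \<open>An explicit form of the faithful flatness of \<open>R\<^sub>P \<rightarrow> S\<^sub>\<langle>\<^sub>y\<^sub>\<rangle>\<close>. Write \<open>H\<close> and \<open>H \<gamma>(f)\<close> as combinations of elements
  of \<open>\<gamma>(R)\<close> and \<open>\<gamma>(J)\<close>, and expand the coefficients in an independent family \<open>E\<close>. The coordinate at
  \<open>e \<in> E\<close> gives \<open>w\<^sub>e f \<in> J\<close>. Up to a non-zero factor, the classes of the \<open>w\<^sub>e\<close> are the coordinates of
  \<open>H(0)\<close>, so some \<open>w\<^sub>e\<close> is outside \<open>P\<close>.\<close>

lemma descent:
  assumes J: "J \<in> saturated_ideals (mpoly_ring {1..n}) P" and f: "f \<in> R"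
    and H: "H \<in> S" "lookup H 0 \<noteq> 0" and Hf: "H * \<gamma> f \<in> extension J"
  shows "f \<in> J"
proof -
  have Ji: "ideal J (mpoly_ring {1..n})" and Js: "\<And>s a. s \<in> R - P \<Longrightarrow> a \<in> R \<Longrightarrow> s * a \<in> J \<Longrightarrow> a \<in> J"
    using J by (auto simp: saturated_ideals_def mpoly_ring_simps)
  have JR: "J \<subseteq> R" using ideal_mpolyD(1)[OF Ji] by blast
  obtain T a where T: "finite T" "T \<subseteq> R" "H = (\<Sum>r\<in>T. mscale (a r) (\<gamma> r))"
    using H(1) span_image_explicit unfolding S_eq_span extension_def by blast
  obtain T' b where T': "finite T'" "T' \<subseteq> J" "H * \<gamma> f = (\<Sum>q\<in>T'. mscale (b q) (\<gamma> q))"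
    using Hf span_image_explicit unfolding extension_def by blast
  obtain E d k where E: "finite E" "independent_over_R0 E" "d \<in> R0" "\<pi> d \<noteq> 0"
    and k: "\<And>x e. x \<in> a ` T \<union> b ` T' \<Longrightarrow> k x e \<in> R0"
      "\<And>x. x \<in> a ` T \<union> b ` T' \<Longrightarrow> \<pi> d * x = (\<Sum>e\<in>E. \<pi> (k x e) * e)"
    by (rule coordinates_over_R0[of "a ` T \<union> b ` T'"]) (use T(1) T'(1) in auto)
  have R: "r \<in> R" if "r \<in> R0" for r using that R0_subset by blast
  have scale: "mscale (\<pi> d) (\<Sum>r\<in>U. mscale (x r) (\<gamma> r)) = (\<Sum>e\<in>E. mscale e (\<gamma> (\<Sum>r\<in>U. k (x r) e * r)))"
    if "x ` U \<subseteq> a ` T \<union> b ` T'" for x U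
  proof -
    have "mscale (\<pi> d) (\<Sum>r\<in>U. mscale (x r) (\<gamma> r)) = (\<Sum>r\<in>U. \<Sum>e\<in>E. mscale (\<pi> (k (x r) e) * e) (\<gamma> r))"
      unfolding mscale_sum mscale_mscale mscale_sum_left[symmetric]
      by (rule sum.cong) (use that k(2) in \<open>auto simp: image_subset_iff\<close>)
    also have "\<dots> = (\<Sum>e\<in>E. \<Sum>r\<in>U. mscale (\<pi> (k (x r) e) * e) (\<gamma> r))" by (rule sum.swap)
    also have "\<dots> = (\<Sum>e\<in>E. mscale e (\<gamma> (\<Sum>r\<in>U. k (x r) e * r)))"
      unfolding gamma_sum mscale_sum
    proof (intro sum.cong refl)
      fix e r assume "r \<in> U"
      then have "k (x r) e \<in> R0" using that k(1) by blast
      then show "mscale (\<pi> (k (x r) e) * e) (\<gamma> r) = mscale e (\<gamma> (k (x r) e * r))"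
        by (simp add: gamma_hom(2) gamma_R0 mscale_def mconst_simps mult_ac)
    qed
    finally show ?thesis .
  qed
  define w where "w e = (\<Sum>r\<in>T. k (a r) e * r)" for e
  define z where "z e = (\<Sum>q\<in>T'. k (b q) e * q)" for e
  have wR: "w e \<in> R" for e unfolding w_def using T(2) k(1) R by (intro mpoly_sum mpoly_mult) auto
  have zJ: "z e \<in> J" for e unfolding z_def
    by (rule ideal_mpoly_sum[OF Ji]) (use T'(2) k(1) R in \<open>auto intro!: ideal_mpolyD(4)[OF Ji]\<close>)
  have dH: "mscale (\<pi> d) H = (\<Sum>e\<in>E. mscale e (\<gamma> (w e)))" unfolding T(3) w_def by (rule scale) auto
  have "(\<Sum>e\<in>E. mscale e (\<gamma> (w e * f - z e))) = mscale (\<pi> d) H * \<gamma> f - mscale (\<pi> d) (H * \<gamma> f)"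
  proof -
    have "mscale (\<pi> d) (H * \<gamma> f) = (\<Sum>e\<in>E. mscale e (\<gamma> (z e)))"
      unfolding T'(3) z_def by (rule scale) auto
    moreover have "mscale e (\<gamma> (w e * f - z e)) = mscale e (\<gamma> (w e)) * \<gamma> f - mscale e (\<gamma> (z e))" for e
      by (simp add: gamma_diff gamma_hom(2) mscale_def algebra_simps)
    ultimately show ?thesis unfolding dH by (simp add: sum_subtractf sum_distrib_right)
  qed
  also have "\<dots> = 0" by (simp add: mscale_mult)
  finally have "w e * f - z e = 0" if "e \<in> E" for e
    using gamma_independent[OF E(1,2), of "\<lambda>e. w e * f - z e"] that wR zJ JR f
    by (auto intro!: mpoly_diff mpoly_mult)
  then have wf: "w e * f \<in> J" if "e \<in> E" for e using zJ[of e] that by (metis eq_iff_diff_eq_0)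
  have "(\<Sum>e\<in>E. e * \<pi> (w e)) = lookup (mscale (\<pi> d) H) 0"
    unfolding dH lookup_sum lookup_mscale by (simp add: gamma_const_term wR)
  also have "\<dots> \<noteq> 0" using E(4) H(2) by (simp add: lookup_mscale)
  finally obtain e where "e \<in> E" "\<pi> (w e) \<noteq> 0" by (metis (no_types, lifting) mult_zero_right sum.neutral)
  then have "w e \<in> R - P" using wR pi_eq_0_iff by blast
  then show ?thesis using Js wf \<open>e \<in> E\<close> f by blast
qed

definition saturated_extension :: "'k mpol set \<Rightarrow> 'f mpol set" where
  "saturated_extension J = {a \<in> S. \<exists>s\<in>S - y_ideal c. s * a \<in> extension J}"

lemma ideal_saturated_extension:
  assumes "ideal J (mpoly_ring {1..n})"
  shows "ideal (saturated_extension J) (mpoly_ring {1..c})"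
  using cring.saturation_ideal[OF cring_mpoly_ring primeideal_y_ideal ideal_extension[OF assms]]
  by (simp add: saturated_ideals_def saturated_extension_def mpoly_ring_simps)

lemma extension_subset_saturated:
  assumes "ideal J (mpoly_ring {1..n})"
  shows "extension J \<subseteq> saturated_extension J"
proof
  fix x assume x: "x \<in> extension J"
  have "1 \<in> S - y_ideal c" using mpoly_one[of "{1..c}"] by (auto simp: y_ideal_iff)
  then show "x \<in> saturated_extension J"
    using x ideal_mpolyD(1)[OF ideal_extension[OF assms] x] unfolding saturated_extension_def
    by (auto intro!: bexI[of _ 1])
qed

abbreviation "Ppow k \<equiv> P [^]\<^bsub>ideals_set (mpoly_ring {1..n})\<^esub> (k::nat)"

lemma ideal_Ppow: "ideal (Ppow k) (mpoly_ring {1..n})"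
  by (rule cring.ideal_power_ideal[OF cring_mpoly_ring P_ideal])

text \<open>Up to units of the localized ring \<open>S\<^sub>\<langle>\<^sub>y\<^sub>\<rangle>\<close>, the variables \<open>y\<^sub>i\<close> are the images \<open>\<gamma>(p\<^sub>i)\<close> of elements of \<open>P\<close>.\<close>

lemma order_ideal_subset_saturated_extension:
  "order_ideal {1..c} k \<subseteq> saturated_extension (Ppow k)"
proof (rule order_ideal_least[OF ideal_saturated_extension[OF ideal_Ppow]])
  interpret R: cring "mpoly_ring {1..n} :: 'k mpol ring" by (rule cring_mpoly_ring)
  fix \<alpha> assume "keys \<alpha> \<subseteq> {1..c}" "mdeg \<alpha> = k"
  then show "single \<alpha> 1 \<in> saturated_extension (Ppow k)"
  proof (induction \<alpha> arbitrary: k rule: mon_induct)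
    case zero
    then have "1 \<in> extension (Ppow k)"
      using R.ideal_power_0[of P] by (simp add: S_eq_span[symmetric] mpoly_one)
    then show ?case using extension_subset_saturated[OF ideal_Ppow] by auto
  next
    case (plus \<alpha> i)
    then obtain l where l: "k = Suc l" "mdeg \<alpha> = l" by (auto simp: mdeg_add)
    have i: "i \<in> {1..c}" "keys \<alpha> \<subseteq> {1..c}" using plus(2) by (auto simp: mon_keys_plus)
    obtain H where H: "H \<in> S - y_ideal c" "H * single \<alpha> 1 \<in> extension (Ppow l)"
      using plus.IH[OF i(2) l(2)] by (auto simp: saturated_extension_def)
    obtain p h where ph: "p \<in> P" "h \<in> S" "\<gamma> p = mvar i * h" "lookup h 0 = \<pi> (mpderiv i p)" "mpderiv i p \<in> R - P"
      by (rule local_parameter[OF i(1)])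
    have "(H * single \<alpha> 1) * \<gamma> p \<in> extension (Ppow k)"
    proof -
      have "\<gamma> p \<in> mpol_span {\<gamma> p}" by (simp add: mpol.span_base)
      with H(2) show ?thesis unfolding extension_def
      proof (rule span_mult)
        fix x y assume "x \<in> \<gamma> ` Ppow l" "y \<in> {\<gamma> p}"
        then obtain q where q: "x = \<gamma> q" "q \<in> Ppow l" "y = \<gamma> p" by blast
        have "q * p \<in> Ppow k" unfolding l(1) R.ideal_power_Suc
          using ideal_prod.prod[OF q(2) ph(1), of "mpoly_ring {1..n}"] by (simp add: mpoly_ring_simps)
        then show "x * y \<in> mpol_span (\<gamma> ` Ppow k)" by (auto simp: q gamma_hom(2)[symmetric] intro: mpol.span_base)
      qed
    qed
    moreover have "(H * single \<alpha> 1) * \<gamma> p = (H * h) * single (\<alpha> + single i 1) 1"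
      by (simp add: ph(3) mvar_def mult_single mult_ac)
    moreover have "lookup h 0 \<noteq> 0" using ph(4,5) pi_eq_0_iff by auto
    then have "H * h \<in> S - y_ideal c" using H(1) ph(2) by (auto simp: y_ideal_iff lookup_0_mult intro: mpoly_mult)
    ultimately show ?case using plus(2) by (auto simp: saturated_extension_def intro: mpoly_single)
  qed
qed

lemma saturated_extension_mono: "I \<subseteq> J \<Longrightarrow> saturated_extension I \<subseteq> saturated_extension J"
  unfolding saturated_extension_def extension_def using mpol.span_mono[OF image_mono, of I J \<gamma>] by blast

section \<open>Primary ideals and the punctual Hilbert scheme\<close>

text \<open>Constants are fractions of classes, and \<open>y\<^sub>i\<close> agrees with \<open>\<gamma>(p\<^sub>i)/\<gamma>(\<partial>\<^sub>ip\<^sub>i)\<close> up to order two.\<close>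

lemma approx_monomial:
  assumes "keys \<alpha> \<subseteq> {1..c}"
  shows "\<exists>s\<in>R - P. \<exists>a\<in>R. order_ge (Suc (mdeg \<alpha>)) (lookup (\<gamma> s * single \<alpha> b - \<gamma> a))"
  using assms
proof (induction \<alpha> rule: mon_induct)
  case zero
  obtain a s where as: "a \<in> R" "s \<in> R - P" "b = \<pi> a / \<pi> s" by (rule pi_fraction)
  then have "\<pi> s \<noteq> 0" using pi_eq_0_iff by blast
  moreover have "lookup (single 0 b) (0::mon) = b" by simp
  ultimately have "lookup (\<gamma> s * single 0 b - \<gamma> a) 0 = 0"
    using as by (simp only: lookup_minus lookup_0_mult gamma_const_term Diff_iff) simp
  then show ?case using as(1,2) by (auto simp: order_ge_1 plus_1_eq_Suc[symmetric])
next
  case (plus \<alpha> i)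
  then have i: "i \<in> {1..c}" "keys \<alpha> \<subseteq> {1..c}" by (auto simp: mon_keys_plus)
  obtain s a where sa: "s \<in> R - P" "a \<in> R" "order_ge (Suc (mdeg \<alpha>)) (lookup (\<gamma> s * single \<alpha> b - \<gamma> a))"
    using plus.IH i(2) by blast
  obtain p h where ph: "p \<in> P" "h \<in> S" "\<gamma> p = mvar i * h" "lookup h 0 = \<pi> (mpderiv i p)" "mpderiv i p \<in> R - P"
    by (rule local_parameter[OF i(1)])
  let ?t = "mpderiv i p"
  have p: "order_ge 1 (lookup (\<gamma> p))"
    unfolding order_ge_1 ph(3) lookup_0_mult by simp
  have "order_ge 1 (lookup (\<gamma> ?t - h))"
    using ph(4,5) by (simp add: order_ge_1 lookup_minus gamma_const_term)
  moreover have "order_ge 1 (lookup (mvar i))" by (simp add: order_ge_1)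
  ultimately have quad: "order_ge (1 + 1) (lookup (mvar i * (\<gamma> ?t - h)))" by (intro order_ge_poly(4))
  have "order_ge (mdeg \<alpha>) (lookup (single \<alpha> b))"
    by (auto simp: order_ge_def lookup_single when_def)
  then have "order_ge (mdeg \<alpha>) (lookup (\<gamma> s * single \<alpha> b))" by (rule order_ge_poly(5))
  from order_ge_poly(4)[OF this quad]
  have 1: "order_ge (mdeg \<alpha> + (1 + 1)) (lookup (\<gamma> s * single \<alpha> b * (mvar i * (\<gamma> ?t - h))))" .
  have 2: "order_ge (Suc (mdeg \<alpha>) + 1) (lookup ((\<gamma> s * single \<alpha> b - \<gamma> a) * \<gamma> p))"
    by (rule order_ge_poly(4)[OF sa(3) p])
  have m: "single (\<alpha> + single i 1) b = single \<alpha> b * mvar i" by (simp add: mvar_def mult_single)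
  have "\<gamma> (s * ?t) * single (\<alpha> + single i 1) b - \<gamma> (a * p)
      = \<gamma> s * single \<alpha> b * (mvar i * (\<gamma> ?t - h)) + (\<gamma> s * single \<alpha> b - \<gamma> a) * \<gamma> p"
    unfolding m by (simp add: gamma_hom(2) ph(3) algebra_simps)
  moreover have "mdeg \<alpha> + (1 + 1) = Suc (mdeg (\<alpha> + single i 1))" "Suc (mdeg \<alpha>) + 1 = Suc (mdeg (\<alpha> + single i 1))"
    by (simp_all add: mdeg_add)
  ultimately have "order_ge (Suc (mdeg (\<alpha> + single i 1))) (lookup (\<gamma> (s * ?t) * single (\<alpha> + single i 1) b - \<gamma> (a * p)))"
    using order_ge_poly(2)[OF 1[unfolded \<open>mdeg \<alpha> + (1 + 1) = _\<close>] 2[unfolded \<open>Suc (mdeg \<alpha>) + 1 = _\<close>]]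
    by (simp only:)
  moreover have "s * ?t \<in> R - P" by (rule diff_P_mult[OF sa(1) ph(5)])
  moreover have "a * p \<in> R" using sa(2) ph(1) P_subset by (blast intro: mpoly_mult)
  ultimately show ?case by blast
qed

lemma approx_order:
  assumes e: "e \<in> order_ideal {1..c} k"
  shows "\<exists>s\<in>R - P. \<exists>a\<in>R. order_ge (Suc k) (lookup (\<gamma> s * e - \<gamma> a))"
proof -
  let ?Q = "\<lambda>e. \<exists>s\<in>R - P. \<exists>a\<in>R. order_ge (Suc k) (lookup (\<gamma> s * e - \<gamma> a))"
  have one: "1 \<in> R - P" using one_notin_P by (simp add: mpoly_one)
  have term1: "?Q (single \<alpha> (lookup e \<alpha>))" if "\<alpha> \<in> keys e" for \<alpha>
  proof -
    have \<alpha>: "keys \<alpha> \<subseteq> {1..c}" "k \<le> mdeg \<alpha>"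
      using e that by (auto simp: order_ideal_def order_ge_def carrier_mpoly_ring in_keys_iff not_less[symmetric])
    obtain s a where "s \<in> R - P" "a \<in> R" "order_ge (Suc (mdeg \<alpha>)) (lookup (\<gamma> s * single \<alpha> (lookup e \<alpha>) - \<gamma> a))"
      using approx_monomial[OF \<alpha>(1)] by blast
    then show ?thesis using order_ge_mono[of "Suc (mdeg \<alpha>)" _ "Suc k"] \<alpha>(2) by blast
  qed
  have add: "?Q (x + y)" if "?Q x" "?Q y" for x y
  proof -
    from that obtain s a t b where *: "s \<in> R - P" "a \<in> R" "t \<in> R - P" "b \<in> R"
      "order_ge (Suc k) (lookup (\<gamma> s * x - \<gamma> a))" "order_ge (Suc k) (lookup (\<gamma> t * y - \<gamma> b))" by blast
    have "\<gamma> (s * t) * (x + y) - \<gamma> (t * a + s * b) = \<gamma> t * (\<gamma> s * x - \<gamma> a) + \<gamma> s * (\<gamma> t * y - \<gamma> b)"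
      by (simp add: gamma_hom(1,2) algebra_simps)
    then have "order_ge (Suc k) (lookup (\<gamma> (s * t) * (x + y) - \<gamma> (t * a + s * b)))"
      using * by (simp add: order_ge_poly(2,5))
    moreover have "s * t \<in> R - P" "t * a + s * b \<in> R" using * diff_P_mult by (auto intro: mpoly_add mpoly_mult)
    ultimately show ?thesis by blast
  qed
  have "?Q (\<Sum>\<alpha>\<in>T. single \<alpha> (lookup e \<alpha>))" if "finite T" "T \<subseteq> keys e" for T
    using that
  proof (induction T rule: finite_induct)
    case empty
    have "order_ge (Suc k) (lookup (\<gamma> 1 * 0 - \<gamma> 0))"
      by (simp only: gamma_0 mult_zero_right diff_zero order_ge_poly(1))
    then show ?case using one mpoly_zero unfolding sum.empty by blast
  next
    case (insert \<alpha> T)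
    then show ?case using add[OF term1[of \<alpha>] insert.IH] by simp
  qed
  from this[of "keys e"] show ?thesis by (simp add: poly_mapping_sum_monomials)
qed

lemma approx:
  assumes g: "g \<in> S"
  shows "\<exists>s\<in>R - P. \<exists>a\<in>R. \<gamma> s * g - \<gamma> a \<in> order_ideal {1..c} k"
proof (induction k)
  case 0
  have "1 \<in> R - P" "0 \<in> R" using one_notin_P by (auto simp: mpoly_one mpoly_zero)
  moreover have "\<gamma> 1 * g - \<gamma> 0 \<in> order_ideal {1..c} 0"
    using g by (simp add: gamma_0 gamma_1 order_ideal_def)
  ultimately show ?case by blast
next
  case (Suc k)
  then obtain s a where sa: "s \<in> R - P" "a \<in> R" "\<gamma> s * g - \<gamma> a \<in> order_ideal {1..c} k" by blast
  from approx_order[OF sa(3)] obtain t b where tb: "t \<in> R - P" "b \<in> R"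
    "order_ge (Suc k) (lookup (\<gamma> t * (\<gamma> s * g - \<gamma> a) - \<gamma> b))" by blast
  have "\<gamma> t * (\<gamma> s * g - \<gamma> a) - \<gamma> b = \<gamma> (t * s) * g - \<gamma> (t * a + b)"
    by (simp add: gamma_hom(1,2) algebra_simps)
  then have "\<gamma> (t * s) * g - \<gamma> (t * a + b) \<in> order_ideal {1..c} (Suc k)"
    using tb(3) g by (auto simp: order_ideal_def intro!: mpoly_diff mpoly_mult gamma_in_S)
  moreover have "t * s \<in> R - P" "t * a + b \<in> R" using sa tb diff_P_mult by (auto intro: mpoly_add mpoly_mult)
  ultimately show ?case by blast
qed

text \<open>The counterpart in \<open>R\<close> of the ideals of \<open>S\<close> that contain \<open>\<langle>y\<rangle>\<^sup>m\<close>.\<close>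

definition saturated_above :: "nat \<Rightarrow> 'k mpol set set" where
  "saturated_above m = {J \<in> saturated_ideals (mpoly_ring {1..n}) P. Ppow m \<subseteq> J}"

lemma primary_to_hilbert_eq:
  assumes "ideal J (mpoly_ring {1..n})"
  shows "primary_to_hilbert c \<pi> m J = {x + y | x y. x \<in> order_ideal {1..c} m \<and> y \<in> extension J}"
  unfolding primary_to_hilbert_def y_ideal_power extension_eq_Idl[OF assms, symmetric]
  by (auto simp: set_add_def' mpoly_ring_simps)

lemma gamma_Ppow: "p \<in> Ppow k \<Longrightarrow> \<gamma> p \<in> order_ideal {1..c} k"
proof (induction k arbitrary: p)
  case 0 then show ?case by (simp add: order_ideal_def gamma_in_S)
next
  interpret R: cring "mpoly_ring {1..n} :: 'k mpol ring" by (rule cring_mpoly_ring)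
  case (Suc k)
  let ?K = "{p \<in> R. \<gamma> p \<in> order_ideal {1..c} (Suc k)}"
  note O = ideal_mpolyD[OF ideal_order_ideal[of "{1..c}" "Suc k"]]
  have "ideal ?K (mpoly_ring {1..n})" unfolding ideal_mpoly_iff
    by (auto simp: gamma_hom(1,2) gamma_0 intro: mpoly_zero mpoly_add mpoly_mult O gamma_in_S)
  moreover have "i * j \<in> ?K" if ij: "i \<in> Ppow k" "j \<in> P" for i j
  proof -
    have R: "i \<in> R" "j \<in> R" using ideal_mpolyD(1)[OF ideal_Ppow ij(1)] ij(2) P_subset by blast+
    have "order_ge 1 (lookup (\<gamma> j))" using ij(2) R(2) by (simp add: order_ge_1 gamma_const_term pi_eq_0_iff)
    moreover have "order_ge k (lookup (\<gamma> i))" using Suc.IH[OF ij(1)] by (simp add: order_ideal_def)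
    ultimately have "order_ge (Suc k) (lookup (\<gamma> i * \<gamma> j))"
      unfolding Suc_eq_plus1 by (intro order_ge_poly(4))
    then show ?thesis using R by (simp add: gamma_hom(2) order_ideal_def gamma_in_S mpoly_mult)
  qed
  ultimately have "Ppow (Suc k) \<subseteq> ?K"
    unfolding R.ideal_power_Suc by (intro R.ideal_prod_subset) (simp_all only: mpoly_ring_simps)
  then show ?case using Suc.prems by blast
qed

text \<open>Going from \<open>R\<close> to \<open>S\<close> and back is the identity by \<open>descent\<close>, since \<open>\<langle>y\<rangle>\<^sup>m\<close> lies in the saturated
  extension of \<open>P\<^sup>m\<close>. Going from \<open>S\<close> to \<open>R\<close> and back is the identity by \<open>approx\<close>: an element \<open>g\<close> of \<open>I\<close> satisfies
  \<open>\<gamma>(s) g \<equiv> \<gamma>(a)\<close> modulo \<open>\<langle>y\<rangle>\<^sup>m\<close>, where \<open>a\<close> lies in the contraction of \<open>I\<close>, and \<open>\<gamma>(s)\<close> is a unit modulo \<open>\<langle>y\<rangle>\<^sup>m\<close>.\<close>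

lemma primary_hilbert_correspondence:
  "mutually_inverse (primary_to_hilbert c \<pi> m) (hilbert_to_primary n c \<pi>) (saturated_above m) (ideals_above c m)"
proof -
  interpret S: cring "mpoly_ring {1..c} :: 'f mpol ring" by (rule cring_mpoly_ring)
  have zero: "0 \<in> order_ideal {1..c} m" by (rule ideal_mpolyD(2)[OF ideal_order_ideal])
  have fwd: "primary_to_hilbert c \<pi> m J \<in> ideals_above c m" and inv1: "hilbert_to_primary n c \<pi> (primary_to_hilbert c \<pi> m J) = J"
    if "J \<in> saturated_above m" for J
  proof -
    have J: "J \<in> saturated_ideals (mpoly_ring {1..n}) P" "ideal J (mpoly_ring {1..n})" "Ppow m \<subseteq> J"
      using that by (auto simp: saturated_above_def saturated_ideals_def)
    note eq = primary_to_hilbert_eq[OF J(2), of m]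
    note ext = ideal_mpolyD[OF ideal_extension[OF J(2)]]
    have "ideal (order_ideal {1..c} m <+>\<^bsub>mpoly_ring {1..c}\<^esub> extension J) (mpoly_ring {1..c})"
      by (rule S.add_ideals[OF ideal_order_ideal ideal_extension[OF J(2)]])
    moreover have "order_ideal {1..c} m <+>\<^bsub>mpoly_ring {1..c}\<^esub> extension J = primary_to_hilbert c \<pi> m J"
      unfolding eq by (auto simp: set_add_def' mpoly_ring_simps)
    ultimately have "ideal (primary_to_hilbert c \<pi> m J) (mpoly_ring {1..c})" by simp
    moreover have "order_ideal {1..c} m \<subseteq> primary_to_hilbert c \<pi> m J"
    proof
      fix x :: "'f mpol" assume x: "x \<in> order_ideal {1..c} m"
      have "x + 0 \<in> primary_to_hilbert c \<pi> m J" unfolding eq using x ext(2) by blast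
      then show "x \<in> primary_to_hilbert c \<pi> m J" by simp
    qed
    ultimately show "primary_to_hilbert c \<pi> m J \<in> ideals_above c m" by (simp add: ideals_above_def)
    have "order_ideal {1..c} m \<subseteq> saturated_extension J"
      using order_ideal_subset_saturated_extension saturated_extension_mono[OF J(3)] by blast
    then have sub: "primary_to_hilbert c \<pi> m J \<subseteq> saturated_extension J" unfolding eq
      using extension_subset_saturated[OF J(2)] ideal_mpolyD(3)[OF ideal_saturated_extension[OF J(2)]] by blast
    show "hilbert_to_primary n c \<pi> (primary_to_hilbert c \<pi> m J) = J"
    proof
      show "hilbert_to_primary n c \<pi> (primary_to_hilbert c \<pi> m J) \<subseteq> J"
      proof
        fix f assume "f \<in> hilbert_to_primary n c \<pi> (primary_to_hilbert c \<pi> m J)"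
        then have f: "f \<in> R" "\<gamma> f \<in> saturated_extension J" using sub by (auto simp: hilbert_to_primary_def)
        then obtain H where H: "H \<in> S - y_ideal c" "H * \<gamma> f \<in> extension J"
          by (auto simp: saturated_extension_def)
        show "f \<in> J" by (rule descent[OF J(1) f(1) _ _ H(2)]) (use H(1) in \<open>auto simp: y_ideal_iff\<close>)
      qed
      show "J \<subseteq> hilbert_to_primary n c \<pi> (primary_to_hilbert c \<pi> m J)"
      proof
        fix f assume f: "f \<in> J"
        have "\<gamma> f \<in> extension J" using f by (simp add: extension_def mpol.span_base)
        then have "0 + \<gamma> f \<in> primary_to_hilbert c \<pi> m J" unfolding eq using zero by blast
        then show "f \<in> hilbert_to_primary n c \<pi> (primary_to_hilbert c \<pi> m J)"
          using ideal_mpolyD(1)[OF J(2) f] by (simp add: hilbert_to_primary_def)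
      qed
    qed
  qed
  have bwd: "hilbert_to_primary n c \<pi> I \<in> saturated_above m" and inv2: "primary_to_hilbert c \<pi> m (hilbert_to_primary n c \<pi> I) = I"
    if "I \<in> ideals_above c m" for I
  proof -
    have I: "ideal I (mpoly_ring {1..c})" "order_ideal {1..c} m \<subseteq> I" using that by (auto simp: ideals_above_def)
    note Ic = ideal_mpolyD[OF I(1)]
    have Is: "a \<in> I" if "s \<in> S" "lookup s 0 \<noteq> 0" "a \<in> S" "s * a \<in> I" for s a
      using saturated_if_order_ideal_subset[OF I] that by (auto simp: saturated_ideals_def mpoly_ring_simps y_ideal_iff)
    let ?J = "hilbert_to_primary n c \<pi> I"
    have Ji: "ideal ?J (mpoly_ring {1..n})" unfolding ideal_mpoly_iff hilbert_to_primary_def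
      by (auto simp: gamma_hom(1,2) gamma_0 intro: mpoly_zero mpoly_add mpoly_mult Ic gamma_in_S)
    moreover have "a \<in> ?J" if "s \<in> R - P" "a \<in> R" "s * a \<in> ?J" for s a
    proof -
      have "\<gamma> s * \<gamma> a \<in> I" using that(3) by (simp add: hilbert_to_primary_def gamma_hom(2))
      moreover have "lookup (\<gamma> s) 0 \<noteq> 0" using that(1) by (simp add: gamma_const_term pi_eq_0_iff)
      ultimately show ?thesis using Is[OF gamma_in_S _ gamma_in_S] that(2) by (simp add: hilbert_to_primary_def)
    qed
    moreover have "Ppow m \<subseteq> ?J"
      using gamma_Ppow I(2) ideal_mpolyD(1)[OF ideal_Ppow] by (auto simp: hilbert_to_primary_def)
    ultimately show J: "?J \<in> saturated_above m"
      by (auto simp: saturated_above_def saturated_ideals_def mpoly_ring_simps)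
    note eq = primary_to_hilbert_eq[OF Ji, of m]
    have "mpol_subspace I" unfolding mpol.subspace_def mscale_def using Ic(2,3) Ic(4)[OF mpoly_mconst] by blast
    then have "extension ?J \<subseteq> I" unfolding extension_def
      by (intro mpol.span_minimal) (auto simp: hilbert_to_primary_def)
    then have "primary_to_hilbert c \<pi> m ?J \<subseteq> I" unfolding eq using I(2) Ic(3) by blast
    moreover have "I \<subseteq> primary_to_hilbert c \<pi> m ?J"
    proof
      fix g assume g: "g \<in> I"
      then obtain s a where sa: "s \<in> R - P" "a \<in> R" "\<gamma> s * g - \<gamma> a \<in> order_ideal {1..c} m"
        using approx[OF Ic(1)[OF g], of m] by blast
      have "\<gamma> s * g - (\<gamma> s * g - \<gamma> a) \<in> I"
        by (rule Ic(6)) (use sa I(2) Ic(4)[OF gamma_in_S g] in auto)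
      then have "a \<in> ?J" using sa(2) by (simp add: hilbert_to_primary_def)
      then have "(\<gamma> s * g - \<gamma> a) + \<gamma> a \<in> primary_to_hilbert c \<pi> m ?J" unfolding eq
        using sa(3) by (blast intro: mpol.span_base[of "\<gamma> a" "\<gamma> ` ?J", folded extension_def])
      then have "\<gamma> s * g \<in> primary_to_hilbert c \<pi> m ?J" by simp
      moreover have "lookup (\<gamma> s) 0 \<noteq> 0" using sa(1) by (simp add: gamma_const_term pi_eq_0_iff)
      moreover have "primary_to_hilbert c \<pi> m ?J \<in> saturated_ideals (mpoly_ring {1..c}) (y_ideal c)"
        using fwd[OF J] saturated_if_order_ideal_subset by (auto simp: ideals_above_def)
      ultimately show "g \<in> primary_to_hilbert c \<pi> m ?J"
        using gamma_in_S[of s] Ic(1)[OF g] by (auto simp: saturated_ideals_def mpoly_ring_simps y_ideal_iff)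
    qed
    ultimately show "primary_to_hilbert c \<pi> m ?J = I" by blast
  qed
  show ?thesis unfolding mutually_inverse_def using fwd inv1 bwd inv2 by blast
qed

text \<open>Multiplicity \<open>m\<close> forces \<open>P\<^sup>m \<subseteq> Q\<close>; conversely, a proper saturated ideal containing \<open>P\<^sup>m\<close> is
  \<open>P\<close>-primary.\<close>

lemma primary_ideals_eq:
  assumes "m \<ge> 1"
  shows "primary_ideals n P m = {Q \<in> saturated_above m. chain_length {J \<in> saturated_above m. Q \<subseteq> J} = enat m}"
proof (intro equalityI subsetI)
  interpret R: cring "mpoly_ring {1..n} :: 'k mpol ring" by (rule cring_mpoly_ring)
  have mult: "multiplicity_over (mpoly_ring {1..n}) P Q = chain_length {J \<in> saturated_above m. Q \<subseteq> J}"
    if "Q \<in> saturated_above m" for Q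
  proof -
    have "Q \<subseteq> R" using that by (auto simp: saturated_above_def saturated_ideals_def dest: ideal_mpolyD(1))
    moreover have "{J \<in> saturated_above m. Q \<subseteq> J} = {J \<in> saturated_ideals (mpoly_ring {1..n}) P. Q \<subseteq> J}"
      using that by (auto simp: saturated_above_def)
    ultimately show ?thesis by (simp add: multiplicity_eq_chain_length[OF prime])
  qed
  {
    fix Q assume "Q \<in> primary_ideals n P m"
    then have Q: "primary_ideal Q (mpoly_ring {1..n})" "radical (mpoly_ring {1..n}) Q = P"
      "multiplicity_over (mpoly_ring {1..n}) P Q = enat m" by (auto simp: primary_ideals_def primary_to_def)
    have Qi: "ideal Q (mpoly_ring {1..n})" using Q(1) by (simp add: primary_ideal_def)
    have "a \<in> Q" if "s \<in> R - P" "a \<in> R" "s * a \<in> Q" for s a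
    proof -
      have "a * s \<in> Q" using that(3) by (simp only: mult.commute)
      moreover have "s ^ k \<notin> Q" for k using that(1) Q(2) unfolding radical_def mpoly_ring_pow by blast
      ultimately show ?thesis using Q(1) that(1,2) unfolding primary_ideal_def mpoly_ring_simps mpoly_ring_pow by blast
    qed
    then have sat: "Q \<in> saturated_ideals (mpoly_ring {1..n}) P"
      using Qi by (auto simp: saturated_ideals_def mpoly_ring_simps)
    have "Q \<subseteq> R" using ideal_mpolyD(1)[OF Qi] by blast
    then have "chain_length {J \<in> saturated_ideals (mpoly_ring {1..n}) P. Q \<subseteq> J} = enat m"
      using Q(3) multiplicity_eq_chain_length[OF prime] by simp
    then have "Ppow m \<subseteq> Q" by (rule R.power_subset_if_chain_length[OF _ prime sat])
    then have "Q \<in> saturated_above m" using sat by (simp add: saturated_above_def)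
    then show "Q \<in> {Q \<in> saturated_above m. chain_length {J \<in> saturated_above m. Q \<subseteq> J} = enat m}"
      using mult Q(3) by simp
  }
  fix Q assume "Q \<in> {Q \<in> saturated_above m. chain_length {J \<in> saturated_above m. Q \<subseteq> J} = enat m}"
  then have Q: "Q \<in> saturated_above m" "chain_length {J \<in> saturated_above m. Q \<subseteq> J} = enat m" by auto
  have "Q \<noteq> R"
    by (rule chain_length_proper[OF Q(2) assms]) (auto simp: saturated_above_def saturated_ideals_def dest: ideal_mpolyD(1))
  then have "primary_to (mpoly_ring {1..n}) P Q"
    using Q(1) by (intro R.primary_to_if_saturated[OF prime, of _ m]) (auto simp: saturated_above_def)
  then show "Q \<in> primary_ideals n P m" using mult[OF Q(1)] Q(2) by (simp add: primary_ideals_def)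
qed

lemma primary_hilbert:
  assumes "m \<ge> 1"
  shows "mutually_inverse (primary_to_hilbert c \<pi> m) (hilbert_to_primary n c \<pi>)
    (primary_ideals n P m) (punctual_hilbert_poly c m)"
  unfolding primary_ideals_eq[OF assms] punctual_hilbert_poly_eq[OF assms]
proof (rule mutually_inverse_restrict[OF primary_hilbert_correspondence])
  fix Q assume Q: "Q \<in> saturated_above m"
  have "chain_length {J \<in> saturated_above m. Q \<subseteq> J} = chain_length {I \<in> ideals_above c m. primary_to_hilbert c \<pi> m Q \<subseteq> I}"
  proof (rule chain_length_above_eq[OF primary_hilbert_correspondence Q])
    show "primary_to_hilbert c \<pi> m A \<subseteq> primary_to_hilbert c \<pi> m B"
      if "A \<in> saturated_above m" "B \<in> saturated_above m" "A \<subseteq> B" for A B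
    proof -
      have AB: "ideal A (mpoly_ring {1..n})" "ideal B (mpoly_ring {1..n})"
        using that by (auto simp: saturated_above_def saturated_ideals_def)
      have "extension A \<subseteq> extension B" unfolding extension_def by (intro mpol.span_mono image_mono that)
      then show ?thesis unfolding primary_to_hilbert_eq[OF AB(1)] primary_to_hilbert_eq[OF AB(2)] by blast
    qed
  qed (auto simp: hilbert_to_primary_def)
  then show "chain_length {J \<in> ideals_above c m. primary_to_hilbert c \<pi> m Q \<subseteq> J} = enat m \<longleftrightarrow>
      chain_length {J \<in> saturated_above m. Q \<subseteq> J} = enat m" by simp
qed

section \<open>Noetherian operators\<close>

lemma pure_tensor_partial: "pure_tensor \<pi> a (weyl_partial \<alpha>) = single \<alpha> a"
  by (simp add: pure_tensor_def weyl_partial_def pi_simps)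

lemma omega_eq: "omega \<pi> F = F"
  by (simp add: omega_def pure_tensor_partial mscale_simps poly_mapping_sum_monomials)

lemma pure_tensor_scale: "pure_tensor \<pi> a A = mscale a (pure_tensor \<pi> 1 A)"
  by (simp add: pure_tensor_def mscale_sum mscale_simps)

text \<open>Taylor's formula, summed over the terms of \<open>A\<close>.\<close>

lemma pi_weyl_act:
  assumes A: "A \<in> carrier (weyl_algebra n c)" and f: "f \<in> R"
  shows "\<pi> (weyl_act A f) = pairing (lookup (\<gamma> f)) (pure_tensor \<pi> 1 A)"
proof -
  have k: "keys \<alpha> \<subseteq> {1..c}" "lookup A \<alpha> \<in> R" if "\<alpha> \<in> keys A" for \<alpha> using A that by (auto simp: weyl_simps)
  have "\<pi> (weyl_act A f) = (\<Sum>\<alpha>\<in>keys A. \<pi> (lookup A \<alpha>) * \<pi> (multi_iter mpderiv \<alpha> f))"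
    unfolding weyl_act_def using k f by (subst pi_sum) (auto simp: pi_simps mi_mpderiv_carrier intro!: mpoly_mult sum.cong)
  also have "\<dots> = (\<Sum>\<alpha>\<in>keys A. lookup (\<gamma> f) \<alpha> * of_nat (mfact \<alpha>) * \<pi> (lookup A \<alpha>))"
    by (rule sum.cong) (simp_all add: taylor[OF k(1) f, symmetric])
  finally show ?thesis by (simp add: pure_tensor_def pairing_sum pairing_single)
qed

lemma weyl_act_R: "A \<in> carrier (weyl_algebra n c) \<Longrightarrow> f \<in> R \<Longrightarrow> weyl_act A f \<in> R"
  unfolding weyl_act_def by (intro mpoly_sum mpoly_mult mi_mpderiv_carrier) (auto simp: weyl_simps)

text \<open>The pairing is linear in the power series, and \<open>\<gamma>(R)\<close> spans all polynomials.\<close>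

lemma pairing_gamma_separates:
  assumes G: "G \<in> S" and zero: "\<And>f. f \<in> R \<Longrightarrow> pairing (lookup (\<gamma> f)) G = 0"
  shows "G = 0"
proof -
  have all: "pairing (lookup p) G = 0" if "p \<in> S" for p
    using that unfolding S_eq_span extension_def
  proof (induction p rule: mpol.span_induct_alt)
    case base show ?case by (simp add: pairing_def)
  next
    case (step a x y)
    have "pairing (lookup (mscale a x + y)) G = a * pairing (lookup x) G + pairing (lookup y) G"
      by (simp add: pairing_def lookup_add lookup_mscale sum.distrib sum_distrib_left distrib_right mult.assoc)
    then show ?case using step zero by auto
  qed
  have "lookup G \<alpha> = 0" if "keys \<alpha> \<subseteq> {1..c}" for \<alpha>
    using pairing_monomial[of \<alpha> G] all[OF mpoly_single[OF that], of 1] by simp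
  then show ?thesis using G by (intro poly_mapping_eqI) (auto simp: mpoly_carrier_iff)
qed

text \<open>For \<open>w = 1 \<otimes> \<partial>\<^sup>\<beta>\<close> it is enough to compare pairings with \<open>\<gamma>(f)\<close>. On the left this gives
  the class of \<open>\<partial>\<^sup>\<beta> (r f)\<close>, which by Taylor's formula is the pairing of \<open>\<gamma>(r) \<gamma>(f)\<close> with \<open>z\<^sup>\<beta>\<close>.\<close>

lemma right_act_eq:
  assumes w: "w \<in> S" and r: "r \<in> R"
  shows "right_act n c \<pi> w r = series_act (lookup (\<gamma> r)) w"
proof -
  have one: "pure_tensor \<pi> 1 (weyl_mult (weyl_partial \<beta>) (weyl_coeff r)) = series_act (lookup (\<gamma> r)) (single \<beta> 1)"
    if \<beta>: "keys \<beta> \<subseteq> {1..c}" for \<beta>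
  proof -
    let ?A = "weyl_mult (weyl_partial \<beta>) (weyl_coeff r)"
    have pc: "weyl_partial \<beta> \<in> carrier (weyl_algebra n c)" "weyl_coeff r \<in> carrier (weyl_algebra n c)"
      unfolding weyl_partial_def weyl_coeff_def using \<beta> r by (auto intro!: weyl_single simp: mpoly_one)
    then have A: "?A \<in> carrier (weyl_algebra n c)" by (rule weyl_mult_closed)
    have A_S: "pure_tensor \<pi> 1 ?A \<in> S" unfolding pure_tensor_def
      using A by (intro mpoly_sum mpoly_single) (auto simp: weyl_simps)
    let ?G = "pure_tensor \<pi> 1 ?A - series_act (lookup (\<gamma> r)) (single \<beta> 1)"
    have "?G = 0"
    proof (rule pairing_gamma_separates)
      show "?G \<in> S" by (intro mpoly_diff A_S series_act_carrier mpoly_single \<beta>)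
      fix f assume f: "f \<in> R"
      have diff: "pairing g (x - y) = pairing g x - pairing g y" for g and x y :: "'f mpol"
        using pairing_add[of g "x - y" y] by simp
      have "pairing (lookup (\<gamma> f)) (pure_tensor \<pi> 1 ?A) = \<pi> (multi_iter mpderiv \<beta> (r * f))"
        using pi_weyl_act[OF A f] by (simp add: weyl_act_mult weyl_partial_def weyl_coeff_def act_single)
      also have "\<dots> = of_nat (mfact \<beta>) * lookup (\<gamma> r * \<gamma> f) \<beta>"
        using taylor[OF \<beta>, of "r * f"] r f by (simp add: mpoly_mult gamma_hom(2))
      also have "\<dots> = pairing (lookup (\<gamma> f)) (series_act (lookup (\<gamma> r)) (single \<beta> 1))"
        by (simp add: pairing_mult[symmetric] lookup_mult_mps pairing_single)
      finally show "pairing (lookup (\<gamma> f)) ?G = 0" by (simp add: diff)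
    qed
    then show ?thesis by simp
  qed
  have "right_act n c \<pi> w r = (\<Sum>\<beta>\<in>keys w. mscale (lookup w \<beta>) (series_act (lookup (\<gamma> r)) (single \<beta> 1)))"
    unfolding right_act_def
  proof (rule sum.cong)
    fix \<beta> assume "\<beta> \<in> keys w"
    then have "keys \<beta> \<subseteq> {1..c}" using w by (auto simp: carrier_mpoly_ring)
    then show "pure_tensor \<pi> (lookup w \<beta>) (weyl_partial \<beta> \<otimes>\<^bsub>weyl_algebra n c\<^esub> weyl_coeff r)
        = mscale (lookup w \<beta>) (series_act (lookup (\<gamma> r)) (single \<beta> 1))"
      by (subst pure_tensor_scale) (simp add: one weyl_simps)
  qed simp
  also have "\<dots> = (\<Sum>\<beta>\<in>keys w. series_act (lookup (\<gamma> r)) (single \<beta> (lookup w \<beta>)))"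
    by (simp add: series_act_mscale[symmetric] mscale_simps)
  also have "\<dots> = series_act (lookup (\<gamma> r)) (\<Sum>\<beta>\<in>keys w. single \<beta> (lookup w \<beta>))"
  proof -
    have "series_act f (sum h T) = (\<Sum>i\<in>T. series_act f (h i))" for f :: "'f mps" and h and T :: "mon set"
      by (induction T rule: infinite_finite_induct) (simp_all add: series_act_add, simp_all add: series_act_def mi_mpderiv_zero)
    then show ?thesis by simp
  qed
  finally show ?thesis by (simp add: poly_mapping_sum_monomials)
qed

text \<open>Right multiplication by \<open>x\<^sub>i\<close> is \<open>u\<^sub>i + \<partial>\<^sub>i\<close>, where \<open>u\<^sub>i\<close> is the class of \<open>x\<^sub>i\<close>, and right multiplication by any \<open>r\<close> is
  an \<open>\<F>\<close>-combination of the operators \<open>\<partial>\<^sup>\<alpha>\<close>.\<close>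

lemma sub_bimodules_eq: "sub_bimodules n c \<pi> m = diff_closed_subspaces c m"
proof (intro equalityI subsetI)
  have module: "weyl_noether_module c = S" by (simp add: weyl_noether_module_def carrier_mpoly_ring)
  {
    fix E assume "E \<in> sub_bimodules n c \<pi> m"
    then have E: "E \<subseteq> S" "mpol_subspace E" "mpol_dim E = m" and act: "\<And>r w. r \<in> R \<Longrightarrow> w \<in> E \<Longrightarrow> right_act n c \<pi> w r \<in> E"
      by (auto simp: sub_bimodules_def module)
    have "mpderiv i w \<in> E" if i: "i \<in> {1..c}" and w: "w \<in> E" for i w
    proof -
      have x: "mvar i \<in> R" using i c_le by (intro mpoly_mvar) auto
      have wS: "w \<in> S" using E(1) w by blast
      have d: "multi_iter mpderiv (single i 1) w = mpderiv i w" using mi_mpderiv_plus[of 0 i w] by simp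
      have "lookup (\<gamma> (mvar i)) = (\<lambda>\<alpha>. lookup (single (single i 1) 1) \<alpha> + \<pi> (mvar i) * lookup (single 0 1) \<alpha>)"
      proof -
        have "\<gamma> (mvar i) = mvar i + mconst (\<pi> (mvar i))" using i by (simp add: gamma_hom(4))
        moreover have "lookup (mconst u) \<alpha> = u * lookup (single 0 1) \<alpha>" for u :: 'f and \<alpha>
          by (simp add: mconst_def lookup_single lookup_one when_def)
        ultimately show ?thesis by (simp only: fun_eq_iff lookup_add) (simp only: mvar_def simp_thms)
      qed
      then have "series_act (lookup (\<gamma> (mvar i))) w
          = series_act (lookup (single (single i 1) 1)) w + mscale (\<pi> (mvar i)) (series_act (lookup (single 0 1)) w)"
        unfolding series_act_def by (simp add: mscale_simps sum.distrib mscale_sum mscale_mscale)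
      also have "\<dots> = mpderiv i w + mscale (\<pi> (mvar i)) w"
        unfolding series_act_monomial d by simp
      finally have "mpderiv i w = right_act n c \<pi> w (mvar i) - mscale (\<pi> (mvar i)) w"
        by (simp add: right_act_eq[OF wS x])
      then show ?thesis using act[OF x w] E(2) w by (simp add: mpol.subspace_diff mpol.subspace_scale)
    qed
    then show "E \<in> diff_closed_subspaces c m" using E by (auto simp: diff_closed_subspaces_def)
  }
  fix E :: "'f mpol set" assume "E \<in> diff_closed_subspaces c m"
  then have E: "E \<subseteq> S" "mpol_subspace E" "mpol_dim E = m" "\<forall>i\<in>{1..c}. \<forall>F\<in>E. mpderiv i F \<in> E"
    by (auto simp: diff_closed_subspaces_def)
  have "right_act n c \<pi> w r \<in> E" if "r \<in> R" "w \<in> E" for r w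
  proof -
    have "mscale (lookup (\<gamma> r) \<alpha>) (multi_iter mpderiv \<alpha> w) \<in> E" for \<alpha>
    proof (cases "keys \<alpha> \<subseteq> {1..c}")
      case True
      then show ?thesis by (intro mpol.subspace_scale[OF E(2)] mi_mpderiv_in[OF E(4) that(2)])
    next
      case False
      then have "lookup (\<gamma> r) \<alpha> = 0" using gamma_in_S[of r] by (auto simp: mpoly_carrier_iff)
      then show ?thesis using mpol.subspace_0[OF E(2)] by (simp add: mscale_simps)
    qed
    moreover have "w \<in> S" using that(2) E(1) by blast
    ultimately show ?thesis unfolding right_act_eq[OF \<open>w \<in> S\<close> that(1)] series_act_def
      by (intro mpol.subspace_sum[OF E(2)])
  qed
  then show "E \<in> sub_bimodules n c \<pi> m"
    using E mpol.subspace_scale[OF E(2)] by (auto simp: sub_bimodules_def module)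
qed

lemma omega_preimage_eq: "E \<subseteq> S \<Longrightarrow> omega_preimage c \<pi> E = E"
  by (auto simp: omega_preimage_def omega_eq)

lemma lift_exists:
  assumes w: "w \<in> S"
  obtains A where "is_lift n c \<pi> A w"
proof -
  have "\<exists>s\<in>R - P. \<forall>\<alpha>\<in>T. \<exists>a\<in>R. \<pi> s * lookup w \<alpha> = \<pi> a" if "finite T" for T
    using that
  proof (induction T rule: finite_induct)
    case empty show ?case using one_notin_P mpoly_one by blast
  next
    case (insert \<alpha> T)
    then obtain s where s: "s \<in> R - P" "\<And>\<beta>. \<beta> \<in> T \<Longrightarrow> \<exists>a\<in>R. \<pi> s * lookup w \<beta> = \<pi> a"
      by blast
    obtain b t where bt: "b \<in> R" "t \<in> R - P" "lookup w \<alpha> = \<pi> b / \<pi> t" by (rule pi_fraction)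
    have st: "s * t \<in> R - P" by (rule diff_P_mult[OF s(1) bt(2)])
    have "\<pi> t \<noteq> 0" using bt(2) pi_eq_0_iff by blast
    then have "\<pi> (s * t) * lookup w \<alpha> = \<pi> (s * b)" using s(1) bt by (simp add: pi_simps)
    moreover have "\<exists>a\<in>R. \<pi> (s * t) * lookup w \<beta> = \<pi> a" if \<beta>: "\<beta> \<in> T" for \<beta>
    proof -
      obtain a where a: "a \<in> R" "\<pi> s * lookup w \<beta> = \<pi> a" using s(2)[OF \<beta>] by blast
      then have "\<pi> (s * t) * lookup w \<beta> = \<pi> (t * a)" using s(1) bt(2) by (simp add: pi_simps mult_ac)
      then show ?thesis using a bt(2) by (blast intro: mpoly_mult)
    qed
    moreover have "s * b \<in> R" using s(1) bt(1) by (blast intro: mpoly_mult)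
    ultimately show ?case using st by blast
  qed
  then obtain s where s: "s \<in> R - P" "\<And>\<alpha>. \<alpha> \<in> keys w \<Longrightarrow> \<exists>a\<in>R. \<pi> s * lookup w \<alpha> = \<pi> a"
    by (meson finite_keys)
  then obtain a where a: "\<And>\<alpha>. \<alpha> \<in> keys w \<Longrightarrow> a \<alpha> \<in> R \<and> \<pi> s * lookup w \<alpha> = \<pi> (a \<alpha>)"
    by metis
  let ?A = "\<Sum>\<alpha>\<in>keys w. single \<alpha> (a \<alpha>)"
  have A: "?A \<in> carrier (weyl_algebra n c)"
    by (intro weyl_sum weyl_single) (use a w in \<open>auto simp: carrier_mpoly_ring\<close>)
  have lA: "lookup ?A \<alpha> = (if \<alpha> \<in> keys w then a \<alpha> else 0)" for \<alpha>
  proof -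
    have "lookup ?A \<alpha> = (\<Sum>\<beta>\<in>keys w. if \<beta> = \<alpha> then a \<alpha> else 0)"
      unfolding lookup_sum by (rule sum.cong) (auto simp: lookup_single when_def)
    then show ?thesis by simp
  qed
  have "mscale (\<pi> s) w = pure_tensor \<pi> 1 ?A"
  proof (rule poly_mapping_eqI)
    fix \<alpha> show "lookup (mscale (\<pi> s) w) \<alpha> = lookup (pure_tensor \<pi> 1 ?A) \<alpha>"
      using a[of \<alpha>] by (auto simp: lookup_mscale lookup_pure_tensor[of \<pi>, OF pi_simps(4)] lA pi_simps(4) in_keys_iff)
  qed
  moreover have "\<pi> s \<noteq> 0" using s(1) pi_eq_0_iff by blast
  ultimately show thesis using that[of ?A] A by (auto simp: is_lift_def)
qed

text \<open>Membership of \<open>\<gamma>(f)\<close> in the annihilator of \<open>E\<close> is orthogonality to \<open>E\<close>, which can be tested on a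
  basis; by \<open>pi_weyl_act\<close> the pairing with \<open>b l\<close> is a non-zero multiple of the class of \<open>A l \<bullet> f\<close>.\<close>

lemma noetherian_operators:
  assumes E: "E \<in> sub_bimodules n c \<pi> m" and b: "is_basis m b E"
    and A: "\<And>l. l \<in> {1..m} \<Longrightarrow> is_lift n c \<pi> (A l) (b l)"
  shows "hilbert_to_primary n c \<pi> (contract_ideal c (annihilator c (omega_preimage c \<pi> E)))
    = {f \<in> R. \<forall>l\<in>{1..m}. weyl_act (A l) f \<in> P}"
proof -
  have "E \<in> diff_closed_subspaces c m" using E by (simp add: sub_bimodules_eq)
  then have Ed: "E \<subseteq> S" "\<forall>i\<in>{1..c}. \<forall>F\<in>E. mpderiv i F \<in> E"
    by (auto simp: diff_closed_subspaces_def)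
  have span: "mpol_span (b ` {1..m}) = E" using b by (simp add: is_basis_def)
  have "(\<forall>F\<in>E. pairing (lookup (\<gamma> f)) F = 0) \<longleftrightarrow> (\<forall>l\<in>{1..m}. weyl_act (A l) f \<in> P)" if f: "f \<in> R" for f
  proof -
    have "mpol_subspace {F. pairing (lookup (\<gamma> f)) F = 0}"
      by (auto simp: mpol.subspace_def pairing_add pairing_mscale)
    then have "(\<forall>F\<in>E. pairing (lookup (\<gamma> f)) F = 0) \<longleftrightarrow> (\<forall>l\<in>{1..m}. pairing (lookup (\<gamma> f)) (b l) = 0)"
      using mpol.span_minimal[of "b ` {1..m}" "{F. pairing (lookup (\<gamma> f)) F = 0}"] mpol.span_superset[of "b ` {1..m}"]
      unfolding span by blast
    moreover have "pairing (lookup (\<gamma> f)) (b l) = 0 \<longleftrightarrow> weyl_act (A l) f \<in> P" if l: "l \<in> {1..m}" for l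
    proof -
      obtain d where d: "A l \<in> carrier (weyl_algebra n c)" "d \<noteq> 0" "mscale d (b l) = pure_tensor \<pi> 1 (A l)"
        using A[OF l] by (auto simp: is_lift_def)
      have "d * pairing (lookup (\<gamma> f)) (b l) = \<pi> (weyl_act (A l) f)"
        using pi_weyl_act[OF d(1) f] by (simp add: d(3)[symmetric] pairing_mscale)
      then show ?thesis using d(2) pi_eq_0_iff[OF weyl_act_R[OF d(1) f]] by (metis mult_eq_0_iff)
    qed
    ultimately show ?thesis by blast
  qed
  then show ?thesis
    unfolding hilbert_to_primary_def contract_ideal_def omega_preimage_eq[OF Ed(1)] annihilator_eq[OF Ed]
    using gamma_in_S by (auto simp: lookup_mps_carrier)
qed

end

theorem theorem2p1:
  fixes n c m :: nat
    and P :: "'k::field_char_0 mpol set"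
    and \<pi> :: "'k mpol \<Rightarrow> 'f::field_char_0"
  assumes "primeideal P (mpoly_ring {1..n})"
    and "c \<le> n"
    and "codimension (mpoly_ring {1..n}) P = enat c"
    and "maximal_independent_mod n P {c+1..n}"
    and "is_fraction_field_of_quotient (mpoly_ring {1..n}) P \<pi>"
    and "m \<ge> 1"
  shows
    "mutually_inverse (contract_ideal c) (extend_ideal c)
       (punctual_hilbert c m :: 'f mps set set) (punctual_hilbert_poly c m) \<and>
     mutually_inverse (primary_to_hilbert c \<pi> m) (hilbert_to_primary n c \<pi>)
       (primary_ideals n P m) (punctual_hilbert_poly c m) \<and>
     mutually_inverse (inverse_system c) (annihilator c)
       (punctual_hilbert c m :: 'f mps set set) (diff_closed_subspaces c m) \<and>
     mutually_inverse (\<lambda>V. omega \<pi> ` V) (omega_preimage c \<pi>)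
       (diff_closed_subspaces c m) (sub_bimodules n c \<pi> m) \<and>
     (\<forall>E \<in> sub_bimodules n c \<pi> m. \<forall>b. is_basis m b E \<longrightarrow>
        (\<exists>A. \<forall>l\<in>{1..m}. is_lift n c \<pi> (A l) (b l)) \<and>
        (\<forall>A. (\<forall>l\<in>{1..m}. is_lift n c \<pi> (A l) (b l)) \<longrightarrow>
           hilbert_to_primary n c \<pi> (contract_ideal c (annihilator c (omega_preimage c \<pi> E)))
             = {f \<in> carrier (mpoly_ring {1..n}). \<forall>l\<in>{1..m}. weyl_act (A l) f \<in> P}))"
proof -
  interpret generic_point n c P \<pi> by (rule generic_point.intro) (rule assms)+
  have sub: "V \<subseteq> S" if "V \<in> diff_closed_subspaces c m" for V :: "'f mpol set"
    using that by (simp add: diff_closed_subspaces_def)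
  have omega: "mutually_inverse (\<lambda>V. omega \<pi> ` V) (omega_preimage c \<pi>) (diff_closed_subspaces c m) (sub_bimodules n c \<pi> m)"
    unfolding mutually_inverse_def sub_bimodules_eq using omega_preimage_eq[OF sub] by (simp add: omega_eq)
  have lifts: "\<exists>A. \<forall>l\<in>{1..m}. is_lift n c \<pi> (A l) (b l)" if E: "E \<in> sub_bimodules n c \<pi> m" and b: "is_basis m b E" for E b
  proof -
    have "E \<subseteq> S" using E sub by (simp add: sub_bimodules_eq)
    moreover have "b ` {1..m} \<subseteq> E" using b mpol.span_superset[of "b ` {1..m}"] by (auto simp: is_basis_def)
    ultimately have "\<exists>A. is_lift n c \<pi> A (b l)" if "l \<in> {1..m}" for l
      using lift_exists[of "b l"] that by blast
    then show ?thesis by metis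
  qed
  show ?thesis
    using contract_extend_hilbert[OF assms(6)] primary_hilbert[OF assms(6)] inverse_system_hilbert[OF assms(6)]
      omega lifts noetherian_operators by blast
qed

end
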